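(* Assume that the map $\phi:D\times\mathbb R^d\to E$ is Hadamard differentiable at $(H,\theta(H))$ and at $(R(H),\theta(R(H)))$, both tangentially to the same measurable linear space $D_0\times\mathbb R^d\subset D\times\mathbb R^d$, with derivatives denoted $\phi'_H$ and $\phi'_{R(H)}$, respectively. Suppose that, under $H$, (B1) $\sqrt n\,(\mathbb H_n-H,\hat\theta_n-\theta(H))\rightsquigarrow(\mathbb G_H,U_H)$ in $D\times\mathbb R^d$; (B2) $\sqrt n\,(\mathbb H_n^*-R_n,\theta_n^*-\hat\theta_n)\mid X_1,\dots,X_n\rightsquigarrow(\mathbb G_{R(H)},V_{R(H)})$ in $D\times\mathbb R^d$, in outer probability; (B3) the sequence $\sqrt n\,(R_n-R(H),\hat\theta_n-\theta(H))$ is asymptotically tight in $D\times\mathbb R^d$; where $\mathbb G_H$ and $\mathbb G_{R(H)}$ take their values in $D_0$. Then, under $H$, $$T_n\rightsquigarrow\|\phi'_H(\mathbb G_H,U_H)\|_E\ \text{ if }\phi(H,\theta(H))=0,\qquad T_n\rightsquigarrow\infty\ \text{ if }\phi(H,\theta(H))\ne0,$$ while $$T_n^*\mid X_1,\dots,X_n\rightsquigarrow\|\phi'_{R(H)}(\mathbb G_{R(H)},V_{R(H)})\|_E,\quad\text{in outer probability}.$$ Consequently, for every $\alpha\in(0,1)$ such that the variable $\|\phi'_H(\mathbb G_H,U_H)\|_E$ does not have an atom at its $(1-\alpha)$-quantile: (i) if $\phi(H,\theta(H))=0$ and $\|\phi'_{R(H)}(\mathbb G_{R(H)},V_{R(H)})\|_E$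 and $\|\phi'_H(\mathbb G_H,U_H)\|_E$ are equal in distribution, then $P(T_n\ge\xi^*_{n,1-\alpha})\to\alpha$; (ii) if $\phi(H,\theta(H))\ne0$, then $P_{o}(T_n>\xi^*_{n,1-\alpha})\to1$. If $\phi$ is uniformly Hadamard differentiable at $(R(H),\theta(R(H)))$ (tangentially to $D_0\times\mathbb R^d$), then (B3) can be relaxed to the convergence $(R_n,\hat\theta_n)\to(R(H),\theta(R(H)))$ in outer probability in $D\times\mathbb R^d$.
   Context: Setting. $X_1,\dots,X_n$ are i.i.d. with distribution $H$ in a measurable space $(\mathcal X,\mathcal A)$. Probability measures on $\mathcal X$ are embedded in (identified with elements of) a normed space $(D,\|\cdot\|_D)$; $(E,\|\cdot\|_E)$ is a normed space. $\mathbb H_n=n^{-1}\sum_{i=1}^n\delta_{X_i}$ is the empirical distribution and $\hat\theta_n=\hat\theta_n(X_1,\dots,X_n)$ are given statistics with values in $\mathbb R^d$; $\theta(\cdot)$ assigns a vector in $\mathbb R^d$ to $H$ and to $R(H)$. $R_n=R_n(X_1,\dots,X_n)$ is a probability measure on $\mathcal X$; given $X_1,\dots,X_n$, the bootstrap values $X_1^*,\dots,X_n^*$ are i.i.d. from $R_n$, $\mathbb H_n^*=n^{-1}\sum_{i=1}^n\delta_{X_i^*}$, and $\theta_n^*=\theta_n^*(X_1^*,\dots,X_n^*;X_1,\dots,X_n)$ are given maps with values in $\mathbb R^d$. $R(H)$ is a deterministic element of $D$ (the limit of $R_n$ under $H$). Formally, $X_1,\dots,X_n$ are the coordinate projections on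 the first factor of a product probability space $(\mathcal X^n,\mathcal A^n,H^n)\times(\mathcal Z,\mathcal C,Q)$, and the $X_i^*$ are measurable maps on this product which, for fixed $(x_1,\dots,x_n)$, are i.i.d. $R_n(x_1,\dots,x_n)$ under $Q$. The statistics are $$T_n=\sqrt n\,\|\phi(\mathbb H_n,\hat\theta_n)\|_E,\qquad T_n^*=\sqrt n\,\|\phi(\mathbb H_n^*,\theta_n^* )-\phi(R_n,\hat\theta_n)\|_E,$$ and $\xi^*_{n,1-\alpha}$ is the $(1-\alpha)$-quantile of the conditional distribution of $T_n^*$ given $X_1,\dots,X_n$ (it is assumed that these can be defined in a measurable way). $P_{o}$ is inner probability. All limit variables are tight Borel measurable random elements. Weak convergence. $\rightsquigarrow$ is in the Hoffmann-Jørgensen sense: for possibly non-measurable maps $Y_n$ into a metric space $M$ and a Borel measurable $Y$, $Y_n\rightsquigarrow Y$ means $\mathbb E^{o}h(Y_n)\to\mathbb E h(Y)$ for every bounded continuous $h:M\to\mathbb R$, with $\mathbb E^{o}$ outer expectation. $T_n\rightsquigarrow\infty$ means $P_{o}(T_n>t)\to1$ for every $t$. Conditional weak convergence $Y_n^*\mid X_1,\dots,X_n\rightsquigarrow Y$ in $M$, in outer probability, means $$\sup_{h\in \mathrm{BL}_1(M)}\bigl|\mathbb E[h(Y_n^* )^{o}\mid X_1,\dots,X_n]-\mathbb E h(Y)\bigr|\to0$$ in outer probability, where $\mathrm{BL}_1(M)$ is the set of functions $h:M\to[-1,1]$ that are Lipschitz with constant $1$, and $h(Y_n^* )^{o}$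 is the least measurable majorant of $h(Y_n^* )$ on the product probability space. A sequence $Y_n$ is asymptotically tight if for every $\varepsilon>0$ there is a compact $K$ such that for every $\delta>0$ the liminf of the inner probabilities that $Y_n\in K^\delta$ is at least $1-\varepsilon$, with $K^\delta$ the $\delta$-enlargement of $K$. Differentiability. A map $\phi:B_\phi\subset B\to E$ between normed spaces is uniformly Hadamard differentiable at $b\in B_\phi$ tangentially to $B_0\subset B$ if there is a continuous linear map $\phi_b':\operatorname{lin}B_0\to E$ such that $t_n^{-1}(\phi(b_n+t_nh_n)-\phi(b_n))\to\phi_b'(h)$ for all $t_n\to0$ in $\mathbb R$, $b_n\to b$ in $B$, $h_n\to h\in B_0$ with $b_n\in B_\phi$ and $b_n+t_nh_n\in B_\phi$ for every $n$. It is Hadamard differentiable at $b$ tangentially to $B_0$ if this holds with $b_n=b$ for all $n$.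
   Formalization: As stated (B3) does not suffice: the formal (B3) also assumes θ(R(H))=θ(H) and takes the compact sets of asymptotic tightness inside D_0×R^d; "no atom at its (1−α)-quantile" is required at every (1−α)-quantile when it is not unique. *)

theory Defs
  imports "HOL-Probability.Probability"
begin

section \<open>Outer and inner probability, stochastic convergence\<close>

definition inner_measure_of :: "'a measure \<Rightarrow> 'a set \<Rightarrow> ennreal" where
  "inner_measure_of M A = (SUP B \<in> {B \<in> sets M. B \<subseteq> A}. emeasure M B)"

text \<open>Only used for bounded \<open>f\<close> on a probability space, where the set below is nonempty and
  bounded from below.\<close>

definition outer_expectation :: "'a measure \<Rightarrow> ('a \<Rightarrow> real) \<Rightarrow> real" where
  "outer_expectation M f = Inf {integral\<^sup>L M g | g. integrable M g \<and> (\<forall>x\<in>space M. f x \<le> g x)}"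

definition least_measurable_majorant ::
  "'a measure \<Rightarrow> ('a \<Rightarrow> real) \<Rightarrow> ('a \<Rightarrow> real) \<Rightarrow> bool" where
  "least_measurable_majorant M f g \<longleftrightarrow>
     g \<in> borel_measurable M \<and> (\<forall>x\<in>space M. f x \<le> g x) \<and>
     (\<forall>u\<in>borel_measurable M. (AE x in M. f x \<le> u x) \<longrightarrow> (AE x in M. g x \<le> u x))"

definition tendsto_zero_outer_prob ::
  "(nat \<Rightarrow> 'a measure) \<Rightarrow> (nat \<Rightarrow> 'a \<Rightarrow> ereal) \<Rightarrow> bool" where
  "tendsto_zero_outer_prob M \<Delta> \<longleftrightarrow>
     (\<forall>\<epsilon>>0. (\<lambda>n. outer_measure_of (M n) {\<omega> \<in> space (M n). \<Delta> n \<omega> > ereal \<epsilon>}) \<longlonglongrightarrow> 0)"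

definition tight_random_element ::
  "'p measure \<Rightarrow> ('p \<Rightarrow> 'm::metric_space) \<Rightarrow> bool" where
  "tight_random_element N Y \<longleftrightarrow>
     Y \<in> borel_measurable N \<and>
     (\<forall>\<epsilon>>0. \<exists>K. compact K \<and> measure N {\<omega> \<in> space N. Y \<omega> \<in> K} \<ge> 1 - \<epsilon>)"

text \<open>Hoffmann-Joergensen weak convergence; the maps \<open>Y n\<close> need not be measurable.\<close>

definition weakly_converges ::
  "(nat \<Rightarrow> 'a measure) \<Rightarrow> (nat \<Rightarrow> 'a \<Rightarrow> 'm::metric_space) \<Rightarrow> 'p measure \<Rightarrow> ('p \<Rightarrow> 'm) \<Rightarrow> bool" where
  "weakly_converges M Y N Y0 \<longleftrightarrow>
     Y0 \<in> borel_measurable N \<and>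
     (\<forall>h :: 'm \<Rightarrow> real. continuous_on UNIV h \<and> bounded (range h) \<longrightarrow>
        (\<lambda>n. outer_expectation (M n) (\<lambda>\<omega>. h (Y n \<omega>))) \<longlonglongrightarrow> integral\<^sup>L N (\<lambda>\<omega>. h (Y0 \<omega>)))"

definition diverges_weakly :: "(nat \<Rightarrow> 'a measure) \<Rightarrow> (nat \<Rightarrow> 'a \<Rightarrow> real) \<Rightarrow> bool" where
  "diverges_weakly M Y \<longleftrightarrow>
     (\<forall>t. (\<lambda>n. inner_measure_of (M n) {\<omega> \<in> space (M n). Y n \<omega> > t}) \<longlonglongrightarrow> 1)"

text \<open>Asymptotic tightness with approximating compact sets inside \<open>S\<close>; \<open>S = UNIV\<close> is the usual
  notion. Differentiability tangentially to \<open>S\<close> says nothing about directions staying away from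
  \<open>S\<close>, so that a delta method needs the compact sets inside \<open>S\<close>. The enlargement of \<open>K\<close> is a union of balls, so that it is empty for empty \<open>K\<close>
  (unlike \<open>{y. infdist y K < \<delta>}\<close>).\<close>

definition asymptotically_tight_in ::
  "'m set \<Rightarrow> (nat \<Rightarrow> 'a measure) \<Rightarrow> (nat \<Rightarrow> 'a \<Rightarrow> 'm::metric_space) \<Rightarrow> bool" where
  "asymptotically_tight_in S M Y \<longleftrightarrow>
     (\<forall>\<epsilon>>0. \<exists>K. compact K \<and> K \<subseteq> S \<and>
        (\<forall>\<delta>>0. liminf (\<lambda>n. inner_measure_of (M n)
            {\<omega> \<in> space (M n). Y n \<omega> \<in> (\<Union>k\<in>K. ball k \<delta>)}) \<ge> ennreal (1 - \<epsilon>)))"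

section \<open>Conditional weak convergence in outer probability\<close>

definition BL1 :: "('m::metric_space \<Rightarrow> real) set" where
  "BL1 = {h. range h \<subseteq> {-1..1} \<and> 1-lipschitz_on UNIV h}"

definition cond_outer_exp_version ::
  "'a measure \<Rightarrow> 'a measure \<Rightarrow> ('a \<Rightarrow> real) \<Rightarrow> ('a \<Rightarrow> real) \<Rightarrow> bool" where
  "cond_outer_exp_version M F f c \<longleftrightarrow>
     c \<in> borel_measurable F \<and>
     (\<exists>g. least_measurable_majorant M f g \<and> (AE \<omega> in M. c \<omega> = real_cond_exp M F g \<omega>))"

text \<open>Conditional expectations are unique only up to null sets, whereas the supremum over
  \<open>BL1\<close> is uncountable and depends on the versions. As usual, the supremum refers to a suitable
  choice of versions \<open>c n h\<close>: if there is one for which the supremum converges to zero, then the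
  essential supremum, which does not depend on the versions, does so too, and conversely.\<close>

definition cond_weakly_converges ::
  "(nat \<Rightarrow> 'a measure) \<Rightarrow> (nat \<Rightarrow> 'a measure) \<Rightarrow> (nat \<Rightarrow> 'a \<Rightarrow> 'm::metric_space) \<Rightarrow>
   'p measure \<Rightarrow> ('p \<Rightarrow> 'm) \<Rightarrow> bool" where
  "cond_weakly_converges M F Y N Y0 \<longleftrightarrow>
     Y0 \<in> borel_measurable N \<and>
     (\<exists>c. (\<forall>n. \<forall>h\<in>BL1. cond_outer_exp_version (M n) (F n) (\<lambda>\<omega>. h (Y n \<omega>)) (c n h)) \<and>
          tendsto_zero_outer_prob M
            (\<lambda>n \<omega>. SUP h\<in>BL1. ereal \<bar>c n h \<omega> - integral\<^sup>L N (\<lambda>\<omega>'. h (Y0 \<omega>'))\<bar>))"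

section \<open>Hadamard differentiability\<close>

definition continuous_linear_on ::
  "'b::real_normed_vector set \<Rightarrow> ('b \<Rightarrow> 'e::real_normed_vector) \<Rightarrow> bool" where
  "continuous_linear_on V L \<longleftrightarrow>
     (\<forall>x\<in>V. \<forall>y\<in>V. L (x + y) = L x + L y) \<and> (\<forall>a. \<forall>x\<in>V. L (a *\<^sub>R x) = a *\<^sub>R L x) \<and>
     continuous_on V L"

definition uniformly_hadamard_derivative ::
  "('b::real_normed_vector \<Rightarrow> 'e::real_normed_vector) \<Rightarrow> 'b set \<Rightarrow> 'b \<Rightarrow> 'b set \<Rightarrow> ('b \<Rightarrow> 'e) \<Rightarrow> bool"
where
  "uniformly_hadamard_derivative \<phi> B b B0 \<phi>' \<longleftrightarrow>
     b \<in> B \<and> continuous_linear_on (span B0) \<phi>' \<and>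
     (\<forall>t bs hs h. (\<forall>n. t n \<noteq> 0 \<and> bs n \<in> B \<and> bs n + t n *\<^sub>R hs n \<in> B) \<and>
        t \<longlonglongrightarrow> (0::real) \<and> bs \<longlonglongrightarrow> b \<and> hs \<longlonglongrightarrow> h \<and> h \<in> B0 \<longrightarrow>
        (\<lambda>n. inverse (t n) *\<^sub>R (\<phi> (bs n + t n *\<^sub>R hs n) - \<phi> (bs n))) \<longlonglongrightarrow> \<phi>' h)"

definition hadamard_derivative ::
  "('b::real_normed_vector \<Rightarrow> 'e::real_normed_vector) \<Rightarrow> 'b set \<Rightarrow> 'b \<Rightarrow> 'b set \<Rightarrow> ('b \<Rightarrow> 'e) \<Rightarrow> bool"
where
  "hadamard_derivative \<phi> B b B0 \<phi>' \<longleftrightarrow>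
     b \<in> B \<and> continuous_linear_on (span B0) \<phi>' \<and>
     (\<forall>t hs h. (\<forall>n. t n \<noteq> 0 \<and> b + t n *\<^sub>R hs n \<in> B) \<and>
        t \<longlonglongrightarrow> (0::real) \<and> hs \<longlonglongrightarrow> h \<and> h \<in> B0 \<longrightarrow>
        (\<lambda>n. inverse (t n) *\<^sub>R (\<phi> (b + t n *\<^sub>R hs n) - \<phi> b)) \<longlonglongrightarrow> \<phi>' h)"

section \<open>Quantiles\<close>

text \<open>Quantiles need not be unique: \<open>t\<close> is \<^emph>\<open>a\<close> \<open>p\<close>-quantile. The infimum of all \<open>t\<close> with
  \<open>p \<le> measure \<mu> {..t}\<close> is one of them.\<close>

definition is_quantile :: "real measure \<Rightarrow> real \<Rightarrow> real \<Rightarrow> bool" where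
  "is_quantile \<mu> p t \<longleftrightarrow> measure \<mu> {..<t} \<le> p \<and> p \<le> measure \<mu> {..t}"

section \<open>The bootstrap setting\<close>

text \<open>The measure \<open>H\<close> also carries the sample space and its sigma-algebra. A sample of size \<open>n\<close> is
  an extensional function on \<open>{..<n}\<close>.\<close>

abbreviation sample_space :: "'x measure \<Rightarrow> nat \<Rightarrow> (nat \<Rightarrow> 'x) measure" where
  "sample_space H n \<equiv> Pi\<^sub>M {..<n} (\<lambda>_. H)"

definition boot_space :: "'x measure \<Rightarrow> 'z measure \<Rightarrow> nat \<Rightarrow> ((nat \<Rightarrow> 'x) \<times> 'z) measure" where
  "boot_space H Q n = sample_space H n \<Otimes>\<^sub>M Q"

text \<open>The sigma-algebra generated by the observations, on the product space.\<close>

definition sample_algebra :: "'x measure \<Rightarrow> 'z measure \<Rightarrow> nat \<Rightarrow> ((nat \<Rightarrow> 'x) \<times> 'z) measure" where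
  "sample_algebra H Q n = vimage_algebra (space (boot_space H Q n)) fst (sample_space H n)"

text \<open>The empirical distribution is the image of the uniform distribution on the indices.\<close>

definition empirical :: "'x measure \<Rightarrow> nat \<Rightarrow> (nat \<Rightarrow> 'x) \<Rightarrow> 'x measure" where
  "empirical A n x = distr (uniform_count_measure {..<n}) A x"

lemma measure_empirical:
  assumes "x \<in> space (sample_space A n)" "n > 0" "B \<in> sets A"
  shows "measure (empirical A n x) B = (\<Sum>i<n. indicator B (x i)) / real n"
proof -
  have m: "x \<in> measurable (uniform_count_measure {..<n}) A"
    using assms(1) by (auto simp: space_PiM measurable_def sets_uniform_count_measure
        space_uniform_count_measure PiE_def Pi_def)
  have "measure (empirical A n x) B = measure (uniform_count_measure {..<n}) (x -` B \<inter> {..<n})"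
    unfolding empirical_def using m assms(3)
    by (simp add: measure_distr space_uniform_count_measure)
  also have "\<dots> = real (card (x -` B \<inter> {..<n})) / real n"
    by (simp add: measure_uniform_count_measure)
  also have "real (card (x -` B \<inter> {..<n})) = (\<Sum>i<n. indicator B (x i))"
    by (simp add: indicator_def sum.If_cases Int_def conj_commute vimage_def)
  finally show ?thesis .
qed

text \<open>\<open>Xs n i (x, z)\<close> is the \<open>i\<close>-th bootstrap value, \<open>R n x\<close> the distribution resampled from.\<close>

definition bootstrap_scheme ::
  "'x measure \<Rightarrow> 'z measure \<Rightarrow> (nat \<Rightarrow> (nat \<Rightarrow> 'x) \<Rightarrow> 'x measure) \<Rightarrow>
   (nat \<Rightarrow> nat \<Rightarrow> (nat \<Rightarrow> 'x) \<times> 'z \<Rightarrow> 'x) \<Rightarrow> bool" where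
  "bootstrap_scheme H Q R Xs \<longleftrightarrow>
     prob_space H \<and> prob_space Q \<and>
     (\<forall>n>0. \<forall>i<n. Xs n i \<in> measurable (boot_space H Q n) H) \<and>
     (\<forall>n>0. \<forall>x\<in>space (sample_space H n).
        prob_space (R n x) \<and> sets (R n x) = sets H \<and>
        prob_space.indep_vars Q (\<lambda>_. H) (\<lambda>i z. Xs n i (x, z)) {..<n} \<and>
        (\<forall>i<n. distr Q H (\<lambda>z. Xs n i (x, z)) = R n x))"

definition boot_sample ::
  "(nat \<Rightarrow> nat \<Rightarrow> (nat \<Rightarrow> 'x) \<times> 'z \<Rightarrow> 'x) \<Rightarrow> nat \<Rightarrow> (nat \<Rightarrow> 'x) \<times> 'z \<Rightarrow> nat \<Rightarrow> 'x" where
  "boot_sample Xs n \<omega> = (\<lambda>i\<in>{..<n}. Xs n i \<omega>)"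

text \<open>In the following definitions \<open>\<iota>\<close> is the embedding of the probability measures into the
  normed space, and \<open>\<theta>s n xs x\<close> is the bootstrapped statistic at bootstrap sample \<open>xs\<close> and
  observations \<open>x\<close>.\<close>

definition test_stat ::
  "('d::real_normed_vector \<times> 'u \<Rightarrow> 'e::real_normed_vector) \<Rightarrow> ('x measure \<Rightarrow> 'd) \<Rightarrow> 'x measure \<Rightarrow>
   (nat \<Rightarrow> (nat \<Rightarrow> 'x) \<Rightarrow> 'u) \<Rightarrow> nat \<Rightarrow> (nat \<Rightarrow> 'x) \<times> 'z \<Rightarrow> real" where
  "test_stat \<phi> \<iota> A \<theta>hat n \<omega> =
     sqrt (real n) * norm (\<phi> (\<iota> (empirical A n (fst \<omega>)), \<theta>hat n (fst \<omega>)))"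

definition boot_stat ::
  "('d::real_normed_vector \<times> 'u \<Rightarrow> 'e::real_normed_vector) \<Rightarrow> ('x measure \<Rightarrow> 'd) \<Rightarrow> 'x measure \<Rightarrow>
   (nat \<Rightarrow> (nat \<Rightarrow> 'x) \<Rightarrow> 'u) \<Rightarrow> (nat \<Rightarrow> (nat \<Rightarrow> 'x) \<Rightarrow> (nat \<Rightarrow> 'x) \<Rightarrow> 'u) \<Rightarrow>
   (nat \<Rightarrow> (nat \<Rightarrow> 'x) \<Rightarrow> 'x measure) \<Rightarrow> (nat \<Rightarrow> nat \<Rightarrow> (nat \<Rightarrow> 'x) \<times> 'z \<Rightarrow> 'x) \<Rightarrow>
   nat \<Rightarrow> (nat \<Rightarrow> 'x) \<times> 'z \<Rightarrow> real" where
  "boot_stat \<phi> \<iota> A \<theta>hat \<theta>s R Xs n \<omega> =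
     sqrt (real n) *
     norm (\<phi> (\<iota> (empirical A n (boot_sample Xs n \<omega>)), \<theta>s n (boot_sample Xs n \<omega>) (fst \<omega>))
         - \<phi> (\<iota> (R n (fst \<omega>)), \<theta>hat n (fst \<omega>)))"

text \<open>\<open>\<xi> n x\<close> is, measurably in the observations \<open>x\<close>, a \<open>p\<close>-quantile of the conditional
  distribution of \<open>Ts n\<close> given \<open>x\<close>, that is, of the law of \<open>Ts n (x, \<cdot>)\<close> under \<open>Q\<close>.\<close>

definition cond_quantile ::
  "'x measure \<Rightarrow> 'z measure \<Rightarrow> (nat \<Rightarrow> (nat \<Rightarrow> 'x) \<times> 'z \<Rightarrow> real) \<Rightarrow> real \<Rightarrow>
   (nat \<Rightarrow> (nat \<Rightarrow> 'x) \<Rightarrow> real) \<Rightarrow> bool" where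
  "cond_quantile H Q Ts p \<xi> \<longleftrightarrow>
     (\<forall>n>0. \<xi> n \<in> borel_measurable (sample_space H n) \<and>
        (\<forall>x\<in>space (sample_space H n).
           (\<lambda>z. Ts n (x, z)) \<in> borel_measurable Q \<and>
           is_quantile (distr Q borel (\<lambda>z. Ts n (x, z))) p (\<xi> n x)))"

end

theory Submission
  imports Defs
begin

text \<open>Write \<open>S\<close> for \<open>D0 \<times> UNIV\<close>. Both limit theorems rest on the same picture. The statistic is \<open>G\<^sub>n(Y\<^sub>n)\<close>
  (for \<open>T\<^sub>n\<close>, if \<open>\<phi>\<close> vanishes at the true parameter), where \<open>Y\<^sub>n\<close> is the normalized (bootstrap) error and \<open>G\<^sub>n(y)\<close> is the norm of the increment of
  \<open>\<phi>\<close> at its base point in direction \<open>y / sqrt n\<close>, blown up by \<open>sqrt n\<close>. Differentiability along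
  sequences means that \<open>G\<^sub>n\<close> is, for large \<open>n\<close>, uniformly close to \<open>g = norm \<circ> \<phi>'\<close> on a
  neighbourhood of any given compact subset of \<open>S\<close>
  (\<open>difference_quotient_uniform_on_compact\<close>), and the limit law lives on such a compact set up to
  any \<open>\<epsilon>\<close>, because tight Borel laws on metric spaces are inner regular
  (\<open>tight_random_element_compact_in\<close>).

  For a test function \<open>h\<close>, extend \<open>h \<circ> g\<close> from the compact set \<open>K\<close> to a bounded Lipschitz function
  \<open>f\<close> on the whole space by an infimal convolution. Then \<open>h \<circ> G\<^sub>n\<close> differs from \<open>f\<close> by at most
  \<open>\<epsilon>\<close> near \<open>K\<close>, and farther away by a multiple of a Lipschitz function \<open>\<psi>\<close> which vanishes on
  \<open>K\<close>. So outer expectations of \<open>h (G\<^sub>n(Y\<^sub>n))\<close> are controlled by those of \<open>f(Y\<^sub>n)\<close> and \<open>\<psi>(Y\<^sub>n)\<close>,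
  whose limits are known. The Lipschitz constants depend on \<open>K\<close> and \<open>\<epsilon>\<close> only, hence the argument
  is uniform over \<open>h \<in> BL1\<close> and applies conditionally as well: \<open>weakly_converges_mapping\<close> and
  \<open>cond_weakly_converges_mapping\<close>. In the conditional case \<open>G\<^sub>n\<close> depends on the observations
  through the base point \<open>(R\<^sub>n, \<theta>hat\<^sub>n)\<close>, and it may fail to be close to \<open>g\<close> on an event of small
  outer probability. Either assumption on the base point supplies this: uniform differentiability
  at once (\<open>increments_approximated_uniformly\<close>), and asymptotic tightness by writing the increment
  at the base point as a difference of two increments at the limit point and using the linearity of
  the derivative (\<open>increments_approximated_tight\<close>).

  For the tests, the conditional law of the bootstrap statistic converges in outer probability, so
  its quantiles are eventually squeezed between any two levels at which the limit distribution
  function lies strictly on opposite sides of \<open>1 - \<alpha>\<close>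
  (\<open>cond_quantile_lower_bound\<close>, \<open>cond_quantile_upper_bound\<close>). As no \<open>1 - \<alpha>\<close> quantile of the limit
  law is an atom, its distribution function is arbitrarily close to \<open>1 - \<alpha>\<close> at suitable such levels
  (\<open>ex_cdf_below_quantile\<close>, \<open>ex_cdf_above_quantile\<close>), which gives the asymptotic level
  (\<open>bootstrap_test_level\<close>). Under the alternative the quantiles stay bounded while the statistic
  diverges (\<open>bootstrap_test_power\<close>).\<close>

section \<open>Compact sets inside the range of a tight random element\<close>

text \<open>The sets that can be approximated in this way form a sigma-algebra, and open sets belong to it
  since in a metric space they are increasing limits of closed sets.\<close>

lemma closed_regular_finite_borel:
  fixes \<mu> :: "'m::metric_space measure"
  assumes "finite_measure \<mu>" and sets_\<mu>: "sets \<mu> = sets borel"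
    and "A \<in> sets borel" and "0 < \<epsilon>"
  shows "\<exists>C U. closed C \<and> open U \<and> C \<subseteq> A \<and> A \<subseteq> U \<and> measure \<mu> (U - C) < \<epsilon>"
proof -
  interpret finite_measure \<mu> by fact
  have cl[simp]: "C \<in> sets \<mu>" if "closed C" for C using that by (simp add: sets_\<mu>)
  have op[simp]: "U \<in> sets \<mu>" if "open U" for U using that by (simp add: sets_\<mu>)
  have "A \<in> sigma_sets UNIV {S. open S}" using assms(3) by (simp add: borel_def)
  then have "\<forall>\<epsilon>>0. \<exists>C U. closed C \<and> open U \<and> C \<subseteq> A \<and> A \<subseteq> U \<and> measure \<mu> (U - C) < \<epsilon>"
  proof (induction A rule: sigma_sets.induct)
    case (Basic V)
    then have V: "open V" by simp
    show ?case
    proof (cases "V = UNIV")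
      case True
      then show ?thesis by (auto intro!: exI[of _ UNIV])
    next
      case False
      then have ne: "- V \<noteq> {}" by auto
      define C where "C n = {x. infdist x (- V) \<ge> 1 / real (Suc n)}" for n
      have clC: "closed (C n)" for n
        unfolding C_def by (intro closed_Collect_le continuous_intros)
      have CV: "C n \<subseteq> V" for n
      proof
        fix x assume "x \<in> C n"
        moreover have "0 < 1 / real (Suc n)" by simp
        ultimately have "infdist x (- V) \<noteq> 0" unfolding C_def by (metis mem_Collect_eq not_le)
        then show "x \<in> V" using infdist_zero[of x "- V"] by (metis ComplI)
      qed
      have inc: "decseq (\<lambda>n. V - C n)"
      proof (rule decseq_SucI)
        fix n show "V - C (Suc n) \<subseteq> V - C n"
        proof -
          have "1 / real (Suc (Suc n)) \<le> 1 / real (Suc n)" by (intro divide_left_mono) auto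
          then have "C n \<subseteq> C (Suc n)" unfolding C_def by (intro Collect_mono impI) (rule order_trans)
          then show ?thesis by blast
        qed
      qed
      have un: "(\<Inter>n. V - C n) = {}"
      proof -
        { fix x assume "x \<in> V"
          then have "infdist x (- V) > 0"
            using V ne in_closed_iff_infdist_zero[of "- V" x] infdist_nonneg[of x "- V"] by (auto simp: closed_def)
          then obtain n where "1 / real (Suc n) < infdist x (- V)"
            by (meson nat_approx_posE)
          then have "x \<in> C n" by (simp add: C_def)
          then have "\<exists>n. x \<in> C n" by blast }
        then show ?thesis by auto
      qed
      have "(\<lambda>n. measure \<mu> (V - C n)) \<longlonglongrightarrow> measure \<mu> (\<Inter>n. V - C n)"
        by (rule finite_Lim_measure_decseq) (use inc V clC in auto)
      then have lim: "(\<lambda>n. measure \<mu> (V - C n)) \<longlonglongrightarrow> 0" unfolding un by simp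
      show ?thesis
      proof (intro allI impI)
        fix e :: real assume "e > 0"
        then obtain n where "measure \<mu> (V - C n) < e"
          using order_tendstoD(2)[OF lim] by (auto simp: eventually_sequentially)
        then show "\<exists>C U. closed C \<and> open U \<and> C \<subseteq> V \<and> V \<subseteq> U \<and> measure \<mu> (U - C) < e"
          using clC CV V by blast
      qed
    qed
  next
    case Empty
    then show ?case by (auto intro!: exI[of _ "{}"])
  next
    case (Compl A)
    show ?case
    proof (intro allI impI)
      fix e :: real assume "e > 0"
      then obtain C U where "closed C" "open U" "C \<subseteq> A" "A \<subseteq> U" "measure \<mu> (U - C) < e"
        using Compl.IH by meson
      moreover have "- C - (- U) = U - C" by auto
      ultimately show "\<exists>C U. closed C \<and> open U \<and> C \<subseteq> UNIV - A \<and> UNIV - A \<subseteq> U \<and> measure \<mu> (U - C) < e"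
        by (intro exI[of _ "- U"] exI[of _ "- C"]) auto
    qed
  next
    case (Union A)
    show ?case
    proof (intro allI impI)
      fix e :: real assume e: "e > 0"
      have "\<forall>i. \<exists>C U. closed C \<and> open U \<and> C \<subseteq> A i \<and> A i \<subseteq> U \<and> measure \<mu> (U - C) < e / 2 * (1/2)^Suc i"
      proof
        fix i
        have "0 < e / 2 * (1/2)^Suc i" using e by simp
        then show "\<exists>C U. closed C \<and> open U \<and> C \<subseteq> A i \<and> A i \<subseteq> U \<and> measure \<mu> (U - C) < e / 2 * (1/2)^Suc i"
          using Union.IH[of i] by meson
      qed
      then obtain C U where CU: "\<And>i. closed (C i)" "\<And>i. open (U i)" "\<And>i. C i \<subseteq> A i" "\<And>i. A i \<subseteq> U i"
          "\<And>i. measure \<mu> (U i - C i) < e / 2 * (1/2)^Suc i"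
        by metis
      have le: "measure \<mu> (U i - C i) \<le> e / 2 * (1/2)^Suc i" for i
        using CU(5)[of i] by (rule less_imp_le)
      \<comment> \<open>Countable unions of closed sets are not closed, so finitely many of the \<open>C i\<close> are kept.\<close>
      define D where "D n = (\<Union>i\<in>{..n}. C i)" for n
      define W where "W = (\<Union>i. U i)"
      have W[simp]: "open W" using CU by (auto simp: W_def)
      have D[simp]: "closed (D n)" for n using CU by (auto simp: D_def)
      have sm: "summable (\<lambda>i. e / 2 * (1/2)^Suc i)"
        by (intro summable_mult) simp
      have smm: "summable (\<lambda>i. measure \<mu> (U i - C i))"
        by (rule summable_comparison_test'[OF sm, of 0]) (simp only: real_norm_def abs_of_nonneg[OF measure_nonneg] le)
      have [simp]: "(\<Union>i. C i) \<in> sets \<mu>" using cl[OF CU(1)] by blast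
      have UC[simp]: "(\<Union>i. U i - C i) \<in> sets \<mu>" using cl[OF CU(1)] op[OF CU(2)] by blast
      have "measure \<mu> (W - (\<Union>i. C i)) \<le> measure \<mu> (\<Union>i. U i - C i)"
        by (intro finite_measure_mono UC) (unfold W_def, blast)
      also have "\<dots> \<le> (\<Sum>i. measure \<mu> (U i - C i))"
        proof (rule finite_measure_subadditive_countably)
        show "range (\<lambda>i. U i - C i) \<subseteq> sets \<mu>" using cl[OF CU(1)] op[OF CU(2)] by blast
      qed (rule smm)
      also have "\<dots> \<le> (\<Sum>i. e / 2 * (1/2)^Suc i)"
        by (rule suminf_le[OF le smm sm])
      also have "\<dots> = e / 2 * 1"
        by (rule sums_unique[symmetric]) (intro sums_mult power_half_series)
      finally have b1: "measure \<mu> (W - (\<Union>i. C i)) < e" using e by simp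
      have "(\<lambda>n. measure \<mu> (W - D n)) \<longlonglongrightarrow> measure \<mu> (\<Inter>n. W - D n)"
        by (rule finite_Lim_measure_decseq) (auto simp: decseq_def CU, auto simp: D_def)
      moreover have "(\<Inter>n. W - D n) = W - (\<Union>i. C i)" by (auto simp: D_def)
      ultimately have "\<exists>n. measure \<mu> (W - D n) < e"
        using order_tendstoD(2)[of "\<lambda>n. measure \<mu> (W - D n)" "measure \<mu> (W - (\<Union>i. C i))" sequentially e] b1
        unfolding eventually_sequentially by (metis order_refl)
      then obtain n where "measure \<mu> (W - D n) < e" by blast
      moreover have "D n \<subseteq> (\<Union>i. A i)" "(\<Union>i. A i) \<subseteq> W" using CU(3,4) unfolding D_def W_def by blast+
      ultimately show "\<exists>C U. closed C \<and> open U \<and> C \<subseteq> \<Union> (range A) \<and> \<Union> (range A) \<subseteq> U \<and> measure \<mu> (U - C) < e"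
        by (intro exI[of _ "D n"] exI[of _ W]) auto
    qed
  qed
  with \<open>0 < \<epsilon>\<close> show ?thesis by blast
qed

text \<open>Differentiability tangentially to \<open>S\<close> only speaks about directions in \<open>S\<close>, so the compact
  sets that carry most of the limit law have to be found inside \<open>S\<close>. Intersecting a compact set
  with a closed subset of \<open>S\<close> of nearly full measure does this.\<close>

lemma tight_random_element_compact_in:
  fixes Y :: "'p \<Rightarrow> 'm::metric_space"
  assumes "prob_space N" "tight_random_element N Y" and S: "S \<in> sets borel" "\<And>w. w \<in> space N \<Longrightarrow> Y w \<in> S"
    and "0 < \<epsilon>"
  obtains K where "compact K" "K \<subseteq> S" "measure N {w \<in> space N. Y w \<notin> K} \<le> \<epsilon>"
proof -
  interpret N: prob_space N by fact
  have Y[measurable]: "Y \<in> borel_measurable N" using assms by (simp add: tight_random_element_def)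
  interpret D: prob_space "distr N borel Y" by (rule N.prob_space_distr) simp
  obtain K0 where K0: "compact K0" "measure N {w \<in> space N. Y w \<in> K0} \<ge> 1 - \<epsilon> / 2"
    using assms(2) \<open>0 < \<epsilon>\<close> unfolding tight_random_element_def by (meson half_gt_zero)
  obtain C U where CU: "closed C" "open U" "C \<subseteq> S" "S \<subseteq> U" "measure (distr N borel Y) (U - C) < \<epsilon> / 2"
    using closed_regular_finite_borel[of "distr N borel Y" S "\<epsilon> / 2"] S(1) \<open>0 < \<epsilon>\<close> D.finite_measure_axioms by auto
  have [measurable]: "K0 \<in> sets borel" "C \<in> sets borel" "U \<in> sets borel"
    using K0(1) CU by (auto simp: compact_imp_closed)
  have "{w \<in> space N. Y w \<notin> K0 \<inter> C} \<subseteq> {w \<in> space N. Y w \<notin> K0} \<union> (Y -` (U - C) \<inter> space N)"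
    using S(2) CU(4) by auto
  then have "measure N {w \<in> space N. Y w \<notin> K0 \<inter> C} \<le> measure N ({w \<in> space N. Y w \<notin> K0} \<union> (Y -` (U - C) \<inter> space N))"
    by (intro N.finite_measure_mono) auto
  also have "\<dots> \<le> measure N {w \<in> space N. Y w \<notin> K0} + measure N (Y -` (U - C) \<inter> space N)"
    by (intro measure_Un_le) auto
  also have "measure N {w \<in> space N. Y w \<notin> K0} = 1 - measure N {w \<in> space N. Y w \<in> K0}"
    by (rule N.prob_neg) simp
  also have "measure N (Y -` (U - C) \<inter> space N) < \<epsilon> / 2"
    using CU(5) by (simp add: measure_distr)
  finally have "measure N {w \<in> space N. Y w \<notin> K0 \<inter> C} \<le> \<epsilon>" using K0(2) by simp
  moreover have "compact (K0 \<inter> C)" using K0 CU by (simp add: compact_Int_closed)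
  ultimately show thesis using that CU(3) by blast
qed

section \<open>Differentiability on compact sets\<close>

text \<open>A failure along a sequence of increments \<open>t\<close>, base points and directions could be passed, by
  compactness of \<open>K\<close>, to a subsequence whose directions converge inside \<open>S\<close>; there the difference
  quotients converge by \<open>seq\<close>. The set \<open>A\<close> of admissible base points covers ordinary
  (\<open>A = {b}\<close>) and uniform (\<open>A = UNIV\<close>) differentiability.\<close>

lemma difference_quotient_uniform_on_compact:
  fixes \<phi> :: "'b::real_normed_vector \<Rightarrow> 'e::real_normed_vector"
  assumes seq: "\<And>t bs hs h. (\<And>n. t n \<noteq> 0) \<Longrightarrow> (\<And>n. bs n \<in> A) \<Longrightarrow> t \<longlonglongrightarrow> (0::real) \<Longrightarrow> bs \<longlonglongrightarrow> b \<Longrightarrow>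
      hs \<longlonglongrightarrow> h \<Longrightarrow> h \<in> S \<Longrightarrow> (\<lambda>n. inverse (t n) *\<^sub>R (\<phi> (bs n + t n *\<^sub>R hs n) - \<phi> (bs n))) \<longlonglongrightarrow> \<phi>' h"
    and cont: "continuous_on S \<phi>'" and K: "compact K" "K \<subseteq> S" and "0 < \<epsilon>"
  obtains \<delta> where "0 < \<delta>"
    "\<And>t b' k y. 0 < \<bar>t\<bar> \<Longrightarrow> \<bar>t\<bar> < \<delta> \<Longrightarrow> b' \<in> A \<Longrightarrow> dist b' b < \<delta> \<Longrightarrow> k \<in> K \<Longrightarrow> dist y k < \<delta> \<Longrightarrow>
      norm (inverse t *\<^sub>R (\<phi> (b' + t *\<^sub>R y) - \<phi> b') - \<phi>' k) < \<epsilon>"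
proof -
  define bad where "bad \<delta> t b' k y \<longleftrightarrow> 0 < \<bar>t\<bar> \<and> \<bar>t\<bar> < \<delta> \<and> b' \<in> A \<and> dist b' b < \<delta> \<and> k \<in> K \<and> dist y k < \<delta> \<and>
      \<not> norm (inverse t *\<^sub>R (\<phi> (b' + t *\<^sub>R y) - \<phi> b') - \<phi>' k) < \<epsilon>" for \<delta> t b' k y
  have "\<exists>\<delta>>0. \<forall>t b' k y. \<not> bad \<delta> t b' k y"
  proof (rule ccontr)
    assume "\<not> (\<exists>\<delta>>0. \<forall>t b' k y. \<not> bad \<delta> t b' k y)"
    then have "\<exists>t b' k y. bad (inverse (real (Suc n))) t b' k y" for n
      by (metis inverse_positive_iff_positive of_nat_0_less_iff zero_less_Suc)
    then obtain t bs ks ys where bad: "\<And>n. bad (inverse (real (Suc n))) (t n) (bs n) (ks n) (ys n)" by metis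
    obtain k r where k: "k \<in> K" "strict_mono r" "(ks \<circ> r) \<longlonglongrightarrow> k"
      using K(1) bad unfolding compact_def bad_def by meson
    have B: "t n \<noteq> 0" "\<bar>t n\<bar> \<le> inverse (real (Suc n))" "bs n \<in> A" "dist (bs n) b \<le> inverse (real (Suc n))" "ks n \<in> K"
        "dist (ys n) (ks n) \<le> inverse (real (Suc n))"
        "\<not> norm (inverse (t n) *\<^sub>R (\<phi> (bs n + t n *\<^sub>R ys n) - \<phi> (bs n)) - \<phi>' (ks n)) < \<epsilon>" for n
      using bad[of n] unfolding bad_def by linarith+
    have to0: "f \<longlonglongrightarrow> 0" if "\<And>n. 0 \<le> f n" "\<And>n. f n \<le> inverse (real (Suc n))" for f :: "nat \<Rightarrow> real"
      by (rule tendsto_sandwich[OF _ _ tendsto_const LIMSEQ_inverse_real_of_nat]) (use that in \<open>simp_all del: of_nat_Suc\<close>)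
    have t0: "t \<longlonglongrightarrow> 0"
      by (rule tendsto_rabs_zero_cancel, rule to0[OF abs_ge_zero B(2)])
    have "(\<lambda>n. dist (bs n) b) \<longlonglongrightarrow> 0"
      by (rule to0[OF zero_le_dist B(4)])
    then have b0: "bs \<longlonglongrightarrow> b" by (rule tendsto_dist_iff[THEN iffD2])
    have "(\<lambda>n. dist (ys n) (ks n)) \<longlonglongrightarrow> 0"
      by (rule to0[OF zero_le_dist B(6)])
    from LIMSEQ_subseq_LIMSEQ[OF this k(2)]
    have "(\<lambda>n. norm (ys (r n) - ks (r n))) \<longlonglongrightarrow> 0" by (simp add: dist_norm o_def)
    then have "(\<lambda>n. (ys (r n) - ks (r n)) + ks (r n)) \<longlonglongrightarrow> 0 + k"
      by (intro tendsto_add k(3)[unfolded o_def]) (rule tendsto_norm_zero_cancel)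
    then have y0: "(\<lambda>n. ys (r n)) \<longlonglongrightarrow> k" by simp
    have "(\<lambda>n. inverse (t (r n)) *\<^sub>R (\<phi> (bs (r n) + t (r n) *\<^sub>R ys (r n)) - \<phi> (bs (r n)))) \<longlonglongrightarrow> \<phi>' k"
      by (rule seq[of "\<lambda>n. t (r n)" "\<lambda>n. bs (r n)" "\<lambda>n. ys (r n)"])
        (use B k(1) y0 K(2) LIMSEQ_subseq_LIMSEQ[OF t0 k(2)] LIMSEQ_subseq_LIMSEQ[OF b0 k(2)] in \<open>auto simp: o_def\<close>)
    moreover have "(\<lambda>n. \<phi>' (ks (r n))) \<longlonglongrightarrow> \<phi>' k"
      by (rule continuous_on_tendsto_compose[OF cont k(3)[unfolded o_def]]) (use k(1) K(2) B(5) in \<open>auto intro!: always_eventually\<close>)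
    ultimately have "(\<lambda>n. norm (inverse (t (r n)) *\<^sub>R (\<phi> (bs (r n) + t (r n) *\<^sub>R ys (r n)) - \<phi> (bs (r n))) - \<phi>' (ks (r n))))
        \<longlonglongrightarrow> norm (\<phi>' k - \<phi>' k)" by (intro tendsto_norm tendsto_diff)
    from LIMSEQ_le_const[OF this, of \<epsilon>] show False
      using B(7) \<open>0 < \<epsilon>\<close> by (simp add: not_less)
  qed
  then show thesis using that unfolding bad_def by meson
qed

section \<open>Lipschitz approximation of functions on a compact set\<close>

text \<open>The infimal convolution of \<open>u\<close> with \<open>m\<close> times the distance, cut off at the level \<open>C\<close>. It
  is \<open>m\<close>-Lipschitz, and for large \<open>m\<close> almost agrees with \<open>u\<close> on \<open>K\<close>.\<close>

definition lipschitz_extension :: "real \<Rightarrow> 'm::metric_space set \<Rightarrow> ('m \<Rightarrow> real) \<Rightarrow> real \<Rightarrow> 'm \<Rightarrow> real" where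
  "lipschitz_extension C K u m y = min C (INF k\<in>K. u k + m * dist y k)"

lemma lipschitz_extension_bounds:
  assumes "K \<noteq> {}" and C: "\<And>k. k \<in> K \<Longrightarrow> \<bar>u k\<bar> \<le> C" and m: "0 \<le> m"
  shows "\<bar>lipschitz_extension C K u m y\<bar> \<le> C"
    and "\<bar>lipschitz_extension C K u m y - lipschitz_extension C K u m y'\<bar> \<le> m * dist y y'"
proof -
  have lb: "- C \<le> u k + m * dist z k" if "k \<in> K" for z k
    using C[OF that] m by (smt (verit) mult_nonneg_nonneg zero_le_dist)
  have bdd: "bdd_below ((\<lambda>k. u k + m * dist z k) ` K)" for z
    using lb by (auto intro!: bdd_belowI2[where m="-C"])
  have "- C \<le> (INF k\<in>K. u k + m * dist y k)"
    using assms(1) lb by (intro cINF_greatest) auto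
  then show "\<bar>lipschitz_extension C K u m y\<bar> \<le> C"
    using assms by (auto simp: lipschitz_extension_def abs_le_iff min_def) (smt (verit) ex_in_conv C)+
  have one: "(INF k\<in>K. u k + m * dist y k) \<le> (INF k\<in>K. u k + m * dist y' k) + m * dist y y'" for y y'
  proof -
    have "(INF k\<in>K. u k + m * dist y k) - m * dist y y' \<le> (INF k\<in>K. u k + m * dist y' k)"
    proof (rule cINF_greatest[OF assms(1)])
      fix k assume k: "k \<in> K"
      have "(INF k\<in>K. u k + m * dist y k) \<le> u k + m * dist y k"
        by (rule cINF_lower[OF bdd k])
      also have "\<dots> \<le> u k + m * (dist y y' + dist y' k)"
        using m by (intro add_left_mono mult_left_mono dist_triangle) auto
      finally show "(INF k\<in>K. u k + m * dist y k) - m * dist y y' \<le> u k + m * dist y' k" by (simp add: algebra_simps)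
    qed
    then show ?thesis by simp
  qed
  show "\<bar>lipschitz_extension C K u m y - lipschitz_extension C K u m y'\<bar> \<le> m * dist y y'"
    using one[of y y'] one[of y' y] mult_nonneg_nonneg[OF m zero_le_dist[of y y']]
    by (auto simp: lipschitz_extension_def dist_commute[of y' y] abs_if min_def)
qed

text \<open>How large \<open>m\<close> has to be depends on \<open>u\<close> through its bound and its modulus of continuity only.
  This gives one Lipschitz constant for a whole equicontinuous family.\<close>

lemma lipschitz_extension_approx:
  assumes C: "\<And>k. k \<in> K \<Longrightarrow> \<bar>u k\<bar> \<le> C" and "0 < \<delta>"
    and mod: "\<And>k k'. k \<in> K \<Longrightarrow> k' \<in> K \<Longrightarrow> dist k k' < \<delta> \<Longrightarrow> \<bar>u k - u k'\<bar> \<le> \<epsilon>"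
    and m: "2 * C / \<delta> \<le> m" and k: "k \<in> K" and "0 \<le> \<epsilon>"
  shows "\<bar>lipschitz_extension C K u m k - u k\<bar> \<le> \<epsilon>"
proof -
  have C0: "0 \<le> C" using C[OF k] by simp
  then have "0 \<le> 2 * C / \<delta>" using \<open>0 < \<delta>\<close> by simp
  then have m0: "0 \<le> m" using m by linarith
  have lb: "u k - \<epsilon> \<le> u k' + m * dist k k'" if k': "k' \<in> K" for k'
  proof (cases "dist k k' < \<delta>")
    case True
    then show ?thesis using mod[OF k k' True] m0 by (smt (verit) mult_nonneg_nonneg zero_le_dist)
  next
    case False
    have "2 * C = (2 * C / \<delta>) * \<delta>" using \<open>0 < \<delta>\<close> by simp
    also have "\<dots> \<le> m * dist k k'" using False m m0 \<open>0 < \<delta>\<close> C0 by (intro mult_mono) auto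
    finally show ?thesis using C[OF k] C[OF k'] \<open>0 \<le> \<epsilon>\<close> by linarith
  qed
  have "u k - \<epsilon> \<le> (INF k'\<in>K. u k' + m * dist k k')"
    using k lb by (intro cINF_greatest) auto
  moreover have "(INF k'\<in>K. u k' + m * dist k k') \<le> u k + m * dist k k"
    using k lb by (intro cINF_lower bdd_belowI2[where m="u k - \<epsilon>"]) auto
  ultimately show ?thesis using C[OF k] \<open>0 \<le> \<epsilon>\<close> by (auto simp: lipschitz_extension_def min_def)
qed

section \<open>Least measurable majorants and outer expectation\<close>

text \<open>Take measurable majorants with values in \<open>{- C..C}\<close> whose integrals tend to the infimum of all
  such integrals. Their pointwise infimum has minimal integral. A measurable function that
  majorizes \<open>f\<close> almost everywhere and is smaller than this infimum on a set of positive measure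
  would lead to a majorant with a smaller integral.\<close>

lemma ex_least_measurable_majorant:
  assumes "prob_space M" and bd: "\<And>x. x \<in> space M \<Longrightarrow> \<bar>f x\<bar> \<le> C"
  obtains g where "least_measurable_majorant M f g"
proof -
  interpret prob_space M by fact
  define G where "G = {g \<in> borel_measurable M. \<forall>x\<in>space M. f x \<le> g x \<and> \<bar>g x\<bar> \<le> C}"
  have int: "integrable M g" if "g \<in> G" for g
    using that by (intro integrable_const_bound[where B=C]) (auto simp: G_def)
  have fC: "- C \<le> f x" "f x \<le> C" "0 \<le> C" if "x \<in> space M" for x using bd[OF that] by linarith+
  have CG: "(\<lambda>_. C) \<in> G" using fC by (auto simp: G_def)
  have low: "- C \<le> integral\<^sup>L M g" if "g \<in> G" for g
  proof -
    have "integral\<^sup>L M (\<lambda>_. - C) \<le> integral\<^sup>L M g"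
    proof (rule integral_mono)
      fix x assume "x \<in> space M"
      then have "\<bar>g x\<bar> \<le> C" using that by (simp add: G_def)
      then show "- C \<le> g x" by linarith
    qed (use int[OF that] in simp_all)
    then show ?thesis by (simp add: prob_space)
  qed
  define I where "I = (INF g\<in>G. integral\<^sup>L M g)"
  have bdd: "bdd_below (integral\<^sup>L M ` G)" using low by (auto intro!: bdd_belowI2)
  have "\<exists>g\<in>G. integral\<^sup>L M g < I + inverse (real (Suc n))" for n
    using cINF_less_iff[OF _ bdd, of "I + inverse (real (Suc n))"] CG unfolding I_def by auto
  then obtain s where s: "\<And>n. s n \<in> G" "\<And>n. integral\<^sup>L M (s n) < I + inverse (real (Suc n))" by metis
  have [measurable]: "s n \<in> borel_measurable M" for n using s(1)[of n] by (simp add: G_def)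
  have sb: "f x \<le> s n x" "\<bar>s n x\<bar> \<le> C" if "x \<in> space M" for x n using s(1)[of n] that by (auto simp: G_def)
  define g where "g x = (INF n. s n x)" for x
  have bdds: "bdd_below (range (\<lambda>n. s n x))" if "x \<in> space M" for x
    using sb(1)[OF that] by (auto intro!: bdd_belowI2[where m="f x"])
  have g_le: "g x \<le> s n x" if "x \<in> space M" for x n
    unfolding g_def by (rule cINF_lower[OF bdds[OF that]]) simp
  have f_le: "f x \<le> g x" if "x \<in> space M" for x
    unfolding g_def by (rule cINF_greatest) (use sb(1)[OF that] in auto)
  have gm: "g \<in> borel_measurable M"
    unfolding g_def by (rule borel_measurable_cINF_real) (auto simp: bdds)
  have gG: "g \<in> G"
  proof -
    have "f x \<le> g x" "\<bar>g x\<bar> \<le> C" if "x \<in> space M" for x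
      using f_le[OF that] g_le[OF that, of 0] sb(2)[OF that, of 0] fC[OF that] by linarith+
    then show ?thesis using gm by (simp add: G_def)
  qed
  have gI: "integral\<^sup>L M g = I"
  proof (rule antisym)
    show "I \<le> integral\<^sup>L M g" unfolding I_def by (rule cINF_lower[OF bdd gG])
    have "integral\<^sup>L M g \<le> I + inverse (real (Suc n))" for n
      using integral_mono[OF int[OF gG] int[OF s(1)[of n]] g_le] s(2)[of n] by linarith
    moreover have "(\<lambda>n. I + inverse (real (Suc n))) \<longlonglongrightarrow> I"
      using tendsto_add[OF tendsto_const[of I] LIMSEQ_inverse_real_of_nat] by simp
    ultimately show "integral\<^sup>L M g \<le> I" by (intro LIMSEQ_le_const) auto
  qed
  have "least_measurable_majorant M f g"
    unfolding least_measurable_majorant_def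
  proof (intro conjI ballI impI gm f_le)
    fix u assume u[measurable]: "u \<in> borel_measurable M" and fu: "AE x in M. f x \<le> u x"
    from fu obtain N where N: "{x \<in> space M. \<not> f x \<le> u x} \<subseteq> N" "emeasure M N = 0" "N \<in> sets M"
      by (rule AE_E)
    note [measurable] = N(3) gm
    \<comment> \<open>Off the null set \<open>N\<close> this is the smaller of \<open>g\<close> and \<open>u\<close>, and it majorizes \<open>f\<close> everywhere.\<close>
    define v where "v x = (if x \<in> N then g x else min (g x) (u x))" for x
    have "v \<in> G"
    proof -
      have [measurable]: "v \<in> borel_measurable M" unfolding v_def by measurable
      have "f x \<le> v x" "\<bar>v x\<bar> \<le> C" if "x \<in> space M" for x
      proof -
        have "\<bar>g x\<bar> \<le> C" using gG that by (simp add: G_def)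
        moreover have "x \<in> N \<or> f x \<le> u x" using N(1) that by blast
        ultimately show "f x \<le> v x" "\<bar>v x\<bar> \<le> C"
          using f_le[OF that] fC[OF that] by (auto simp: v_def min_def)
      qed
      then show ?thesis by (simp add: G_def)
    qed
    then have "I \<le> integral\<^sup>L M v" unfolding I_def by (intro cINF_lower[OF bdd])
    then have "integral\<^sup>L M (\<lambda>x. g x - v x) \<le> 0" using gI int gG \<open>v \<in> G\<close> by simp
    moreover have nn: "AE x in M. 0 \<le> g x - v x" by (auto simp: v_def)
    moreover have gv: "integrable M (\<lambda>x. g x - v x)" using int gG \<open>v \<in> G\<close> by simp
    ultimately have "AE x in M. g x - v x = 0"
      using integral_nonneg_eq_0_iff_AE[OF gv nn] integral_nonneg_AE[OF nn] by linarith
    moreover have "AE x in M. x \<notin> N" using N by (intro AE_not_in) auto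
    ultimately show "AE x in M. g x \<le> u x" by eventually_elim (auto simp: v_def)
  qed
  then show thesis by (rule that)
qed

lemma least_measurable_majorantD:
  assumes "prob_space M" "least_measurable_majorant M f g" and bd: "\<And>x. x \<in> space M \<Longrightarrow> \<bar>f x\<bar> \<le> C"
  shows "g \<in> borel_measurable M" and "\<And>x. x \<in> space M \<Longrightarrow> f x \<le> g x"
    and "AE x in M. \<bar>g x\<bar> \<le> C" and "integrable M g"
proof -
  interpret prob_space M by fact
  show g[measurable]: "g \<in> borel_measurable M" and fg: "\<And>x. x \<in> space M \<Longrightarrow> f x \<le> g x"
    using assms(2) by (auto simp: least_measurable_majorant_def)
  have "AE x in M. f x \<le> C" by (rule AE_I2) (use bd in \<open>auto simp: abs_le_iff\<close>)
  then have "AE x in M. g x \<le> C"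
    using assms(2) unfolding least_measurable_majorant_def by auto
  moreover have "AE x in M. - C \<le> g x" by (rule AE_I2) (use bd fg in fastforce)
  ultimately show "AE x in M. \<bar>g x\<bar> \<le> C" by eventually_elim (simp add: abs_le_iff)
  then show "integrable M g" by (intro integrable_const_bound[where B=C]) auto
qed

lemma outer_expectation_eq_integral:
  assumes "prob_space M" "least_measurable_majorant M f g" and bd: "\<And>x. x \<in> space M \<Longrightarrow> \<bar>f x\<bar> \<le> C"
  shows "outer_expectation M f = integral\<^sup>L M g"
proof -
  note D = least_measurable_majorantD[OF assms]
  have "integral\<^sup>L M g \<le> integral\<^sup>L M u" if "integrable M u" "\<forall>x\<in>space M. f x \<le> u x" for u
  proof (rule integral_mono_AE[OF D(4) that(1)])
    have "AE x in M. f x \<le> u x" using that by (intro AE_I2) auto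
    then show "AE x in M. g x \<le> u x"
      using assms(2) that(1) unfolding least_measurable_majorant_def by auto
  qed
  then show ?thesis
    unfolding outer_expectation_def
    by (intro cInf_eq_minimum) (use D in auto)
qed

text \<open>Subadditivity of the least majorant, in the form used for comparing test functions: the constant
  \<open>c\<close> is the error of approximation near a compact set, \<open>f2\<close> measures the distance from it, and
  \<open>B\<close> is an exceptional event.\<close>

lemma least_measurable_majorant_le_combination:
  assumes maj: "least_measurable_majorant M f g" "least_measurable_majorant M f1 g1" "least_measurable_majorant M f2 g2"
    and "B \<in> sets M" and "0 \<le> a1" "0 \<le> a2"
    and le: "\<And>x. x \<in> space M \<Longrightarrow> f x \<le> a1 * f1 x + c + a2 * f2 x + b * indicator B x"
  shows "AE x in M. g x \<le> a1 * g1 x + c + a2 * g2 x + b * indicator B x"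
proof -
  have [measurable]: "g1 \<in> borel_measurable M" "g2 \<in> borel_measurable M" "B \<in> sets M"
    using assms by (auto simp: least_measurable_majorant_def)
  have "f x \<le> a1 * g1 x + c + a2 * g2 x + b * indicator B x" if x: "x \<in> space M" for x
  proof -
    have "a1 * f1 x \<le> a1 * g1 x" "a2 * f2 x \<le> a2 * g2 x"
      using maj x assms by (auto simp: least_measurable_majorant_def intro!: mult_left_mono)
    then show ?thesis using le[OF x] by linarith
  qed
  then have "AE x in M. f x \<le> a1 * g1 x + c + a2 * g2 x + b * indicator B x" by (intro AE_I2)
  then show ?thesis using maj(1) unfolding least_measurable_majorant_def by auto
qed

lemma outer_expectation_le_combination:
  assumes "prob_space M"
    and bd: "\<And>x. x \<in> space M \<Longrightarrow> \<bar>f x\<bar> \<le> C" "\<And>x. x \<in> space M \<Longrightarrow> \<bar>f1 x\<bar> \<le> C1" "\<And>x. x \<in> space M \<Longrightarrow> \<bar>f2 x\<bar> \<le> C2"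
    and a: "0 \<le> a"
    and le: "\<And>x. x \<in> space M \<Longrightarrow> f x \<le> f1 x + c + a * f2 x"
  shows "outer_expectation M f \<le> outer_expectation M f1 + c + a * outer_expectation M f2"
proof -
  interpret prob_space M by fact
  obtain g where g: "least_measurable_majorant M f g"
    by (rule ex_least_measurable_majorant[OF assms(1), of f C, OF bd(1)])
  obtain g1 where g1: "least_measurable_majorant M f1 g1"
    by (rule ex_least_measurable_majorant[OF assms(1), of f1 C1, OF bd(2)])
  obtain g2 where g2: "least_measurable_majorant M f2 g2"
    by (rule ex_least_measurable_majorant[OF assms(1), of f2 C2, OF bd(3)])
  note D = least_measurable_majorantD[OF assms(1) g, of C, OF bd(1)] least_measurable_majorantD[OF assms(1) g1, of C1, OF bd(2)]
    least_measurable_majorantD[OF assms(1) g2, of C2, OF bd(3)]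
  have "AE x in M. g x \<le> g1 x + c + a * g2 x"
    using least_measurable_majorant_le_combination[OF g g1 g2, of "{}" 1 a c 0] le a by simp
  then have "integral\<^sup>L M g \<le> integral\<^sup>L M (\<lambda>x. g1 x + c + a * g2 x)"
    by (intro integral_mono_AE) (use D in auto)
  also have "\<dots> = integral\<^sup>L M g1 + c + a * integral\<^sup>L M g2"
    using D by (simp add: prob_space)
  finally show ?thesis
    using outer_expectation_eq_integral[OF assms(1) g, of C, OF bd(1)] outer_expectation_eq_integral[OF assms(1) g1, of C1, OF bd(2)]
      outer_expectation_eq_integral[OF assms(1) g2, of C2, OF bd(3)] by simp
qed

text \<open>Markov's inequality for the least measurable majorant of \<open>f\<close>.\<close>

lemma outer_measure_le_outer_expectation:
  assumes "prob_space M" and bd: "\<And>x. x \<in> space M \<Longrightarrow> 0 \<le> f x \<and> f x \<le> C"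
    and A: "A \<subseteq> {x \<in> space M. 1 \<le> f x}"
  shows "outer_measure_of M A \<le> ennreal (outer_expectation M f)"
proof -
  interpret prob_space M by fact
  have bd': "\<bar>f x\<bar> \<le> C" if "x \<in> space M" for x using bd[OF that] by simp
  obtain g where g: "least_measurable_majorant M f g"
    using ex_least_measurable_majorant[OF assms(1), of f C] bd' by blast
  note D = least_measurable_majorantD[OF assms(1) g bd']
  note [measurable] = D(1)
  have "outer_measure_of M A \<le> outer_measure_of M {x \<in> space M. 1 \<le> g x}"
    using A D(2) by (intro outer_measure_of_mono) fastforce
  also have "\<dots> = emeasure M {x \<in> space M. 1 \<le> g x}"
    by (rule outer_measure_of_eq) simp
  also have "\<dots> = (\<integral>\<^sup>+x. indicator {x \<in> space M. 1 \<le> g x} x \<partial>M)" by simp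
  also have "\<dots> \<le> (\<integral>\<^sup>+x. ennreal (g x) \<partial>M)"
    by (intro nn_integral_mono) (auto simp: indicator_def ennreal_1[symmetric] simp del: ennreal_1)
  also have "\<dots> = ennreal (integral\<^sup>L M g)"
    proof (intro nn_integral_eq_integral D(4) AE_I2)
    fix x assume "x \<in> space M"
    then show "0 \<le> g x" using D(2)[of x] bd[of x] bd' by linarith
  qed
  finally show ?thesis using outer_expectation_eq_integral[OF assms(1) g bd'] by simp
qed

lemma inner_measure_of_eq_compl:
  assumes "prob_space M" "A \<subseteq> space M"
  shows "inner_measure_of M A = 1 - outer_measure_of M (space M - A)"
proof (rule antisym)
  interpret prob_space M by fact
  show "inner_measure_of M A \<le> 1 - outer_measure_of M (space M - A)"
    unfolding inner_measure_of_def
  proof (rule SUP_least, clarify)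
    fix B assume B: "B \<in> sets M" "B \<subseteq> A"
    have "outer_measure_of M (space M - A) \<le> outer_measure_of M (space M - B)"
      using B by (intro outer_measure_of_mono) auto
    also have "\<dots> = emeasure M (space M - B)" using B by simp
    also have "\<dots> = 1 - emeasure M B" using B by (simp add: emeasure_compl emeasure_space_1)
    finally have "1 - (1 - emeasure M B) \<le> 1 - outer_measure_of M (space M - A)"
      by (rule ennreal_minus_mono[OF order_refl])
    moreover have "1 - (1 - emeasure M B) = emeasure M B"
      by (simp add: emeasure_eq_measure ennreal_minus ennreal_1[symmetric] del: ennreal_1)
    ultimately show "emeasure M B \<le> 1 - outer_measure_of M (space M - A)" by simp
  qed
  obtain E where E: "E \<in> sets M" "space M - A \<subseteq> E" "outer_measure_of M (space M - A) = emeasure M E"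
    using outer_measure_of_attain[of "space M - A" M] by auto
  have "1 - emeasure M E = emeasure M (space M - E)" using E by (simp add: emeasure_compl emeasure_space_1)
  also have "\<dots> \<le> inner_measure_of M A"
    unfolding inner_measure_of_def by (rule SUP_upper) (use E assms in auto)
  finally show "1 - outer_measure_of M (space M - A) \<le> inner_measure_of M A" using E by simp
qed

lemma outer_measure_of_Un_le:
  assumes "A \<subseteq> space M" "B \<subseteq> space M"
  shows "outer_measure_of M (A \<union> B) \<le> outer_measure_of M A + outer_measure_of M B"
proof -
  obtain E F where E: "E \<in> sets M" "A \<subseteq> E" "outer_measure_of M A = emeasure M E"
     and F: "F \<in> sets M" "B \<subseteq> F" "outer_measure_of M B = emeasure M F"
    using outer_measure_of_attain[of A M] outer_measure_of_attain[of B M] assms by metis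
  have "outer_measure_of M (A \<union> B) \<le> outer_measure_of M (E \<union> F)"
    using E F by (intro outer_measure_of_mono) auto
  also have "\<dots> = emeasure M (E \<union> F)" using E F by simp
  also have "\<dots> \<le> emeasure M E + emeasure M F" using E F by (intro emeasure_subadditive)
  finally show ?thesis using E F by simp
qed

section \<open>Weak convergence under asymptotically continuous maps\<close>

text \<open>A Lipschitz upper bound for the indicator of the points at distance at least \<open>\<delta>\<close> from \<open>K\<close>.\<close>

definition near_indicator :: "'m::metric_space set \<Rightarrow> real \<Rightarrow> 'm \<Rightarrow> real" where
  "near_indicator K \<delta> y = min 1 (infdist y K / \<delta>)"

lemma near_indicator_bounds:
  assumes "0 < \<delta>"
  shows "0 \<le> near_indicator K \<delta> y" "near_indicator K \<delta> y \<le> 1"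
    and "y \<in> K \<Longrightarrow> near_indicator K \<delta> y = 0"
    and "\<bar>near_indicator K \<delta> y - near_indicator K \<delta> y'\<bar> \<le> 1 / \<delta> * dist y y'"
proof -
  show "0 \<le> near_indicator K \<delta> y" "near_indicator K \<delta> y \<le> 1"
    and "y \<in> K \<Longrightarrow> near_indicator K \<delta> y = 0"
    using assms by (auto simp: near_indicator_def infdist_nonneg)
  have "\<bar>infdist y K / \<delta> - infdist y' K / \<delta>\<bar> = \<bar>infdist y K - infdist y' K\<bar> / \<delta>"
    using assms by (simp add: diff_divide_distrib[symmetric])
  also have "\<dots> \<le> dist y y' / \<delta>"
    using assms by (intro divide_right_mono infdist_triangle_abs) auto
  finally show "\<bar>near_indicator K \<delta> y - near_indicator K \<delta> y'\<bar> \<le> 1 / \<delta> * dist y y'"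
    by (auto simp: near_indicator_def min_def)
qed

lemma continuous_on_if_lipschitz:
  fixes f :: "'m::metric_space \<Rightarrow> real"
  assumes "\<And>y y'. \<bar>f y - f y'\<bar> \<le> L * dist y y'"
  shows "continuous_on A f"
proof (rule lipschitz_on_continuous_on)
  show "(max 0 L)-lipschitz_on A f"
  proof (rule lipschitz_onI)
    fix y y'
    have "\<bar>f y - f y'\<bar> \<le> L * dist y y'" by (rule assms)
    also have "\<dots> \<le> max 0 L * dist y y'" by (intro mult_right_mono) auto
    finally show "dist (f y) (f y') \<le> max 0 L * dist y y'" by (simp add: dist_real_def)
  qed simp
qed

lemma BL1_divide:
  fixes f :: "'m::metric_space \<Rightarrow> real"
  assumes "\<And>y. \<bar>f y\<bar> \<le> 1" "\<And>y y'. \<bar>f y - f y'\<bar> \<le> L * dist y y'" "L \<le> m" "1 \<le> m"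
  shows "(\<lambda>y. f y / m) \<in> BL1"
proof -
  have "\<bar>f y / m\<bar> \<le> 1" for y
    using assms(1)[of y] assms(4) by (auto simp: abs_divide divide_le_eq)
  then have "- 1 \<le> f y / m" "f y / m \<le> 1" for y
    by (metis abs_le_iff minus_le_iff, metis abs_le_iff)
  moreover have "1-lipschitz_on UNIV (\<lambda>y. f y / m)"
  proof (rule lipschitz_onI)
    fix y y'
    have "\<bar>f y - f y'\<bar> \<le> m * dist y y'"
      by (rule order_trans[OF assms(2)]) (use assms(3) in \<open>intro mult_right_mono, auto\<close>)
    then show "dist (f y / m) (f y' / m) \<le> 1 * dist y y'"
      using assms(4) by (simp add: dist_real_def diff_divide_distrib[symmetric] abs_divide divide_le_eq mult.commute)
  qed simp
  ultimately show ?thesis by (auto simp: BL1_def)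
qed

lemma BL1_D:
  assumes "h \<in> BL1"
  shows "\<bar>h y\<bar> \<le> 1" "\<bar>h y - h y'\<bar> \<le> dist y y'" "h \<in> borel_measurable borel"
proof -
  have r: "range h \<subseteq> {-1..1}" and l: "1-lipschitz_on UNIV h" using assms by (auto simp: BL1_def)
  then have "h y \<in> {-1..1}" by blast
  then show "\<bar>h y\<bar> \<le> 1" by (simp add: abs_le_iff)
  show "\<bar>h y - h y'\<bar> \<le> dist y y'" using lipschitz_onD[OF l, of y y'] by (simp add: dist_real_def)
  show "h \<in> borel_measurable borel" using l by (intro borel_measurable_continuous_onI lipschitz_on_continuous_on)
qed

text \<open>The pointwise comparison behind both mapping theorems. The number \<open>v\<close> plays the role of the test
  function at the perturbed statistic with argument \<open>y\<close>. Near \<open>K\<close> it is compared with \<open>u\<close> at a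
  close point of \<open>K\<close>; elsewhere the trivial bound \<open>2 * C\<close> is charged to \<open>near_indicator\<close>.\<close>

lemma approx_by_lipschitz_extension:
  assumes K: "K \<noteq> {}" and C: "\<And>k. k \<in> K \<Longrightarrow> \<bar>u k\<bar> \<le> C" and v: "\<bar>v\<bar> \<le> C"
    and "0 < \<delta>0" and mod: "\<And>k k'. k \<in> K \<Longrightarrow> k' \<in> K \<Longrightarrow> dist k k' < \<delta>0 \<Longrightarrow> \<bar>u k - u k'\<bar> \<le> \<epsilon>"
    and m: "2 * C / \<delta>0 \<le> m" "0 \<le> m" and "0 \<le> \<epsilon>" "0 < \<delta>" "m * \<delta> \<le> \<epsilon>"
    and near: "\<And>k. k \<in> K \<Longrightarrow> dist y k < \<delta> \<Longrightarrow> \<bar>v - u k\<bar> \<le> \<epsilon>"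
  shows "\<bar>v - lipschitz_extension C K u m y\<bar> \<le> 3 * \<epsilon> + 2 * C * near_indicator K \<delta> y"
proof (cases "infdist y K < \<delta>")
  case True
  then obtain k where k: "k \<in> K" "dist y k < \<delta>"
    using K by (auto simp: infdist_def cInf_less_iff)
  have "\<bar>lipschitz_extension C K u m y - lipschitz_extension C K u m k\<bar> \<le> m * dist y k"
    by (rule lipschitz_extension_bounds(2)[OF K C m(2)])
  also have "\<dots> \<le> m * \<delta>" using k m by (intro mult_left_mono) auto
  also have "\<dots> \<le> \<epsilon>" by fact
  finally have 1: "\<bar>lipschitz_extension C K u m y - lipschitz_extension C K u m k\<bar> \<le> \<epsilon>" .
  have 2: "\<bar>lipschitz_extension C K u m k - u k\<bar> \<le> \<epsilon>"
    by (rule lipschitz_extension_approx[OF C \<open>0 < \<delta>0\<close> mod m(1) k(1) \<open>0 \<le> \<epsilon>\<close>])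
  have "0 \<le> 2 * C * near_indicator K \<delta> y"
    using v near_indicator_bounds(1)[OF \<open>0 < \<delta>\<close>, of K y] by (intro mult_nonneg_nonneg) auto
  then show ?thesis using 1 2 near[OF k] by linarith
next
  case False
  then have "near_indicator K \<delta> y = 1" using \<open>0 < \<delta>\<close> by (simp add: near_indicator_def)
  moreover have "\<bar>lipschitz_extension C K u m y\<bar> \<le> C" by (rule lipschitz_extension_bounds(1)[OF K C m(2)])
  ultimately show ?thesis using v \<open>0 \<le> \<epsilon>\<close> by simp
qed

lemma integral_diff_le_off_set:
  assumes "prob_space N" and [measurable]: "f1 \<in> borel_measurable N" "f2 \<in> borel_measurable N" "A \<in> sets N"
    and bd: "\<And>w. w \<in> space N \<Longrightarrow> \<bar>f1 w\<bar> \<le> C" "\<And>w. w \<in> space N \<Longrightarrow> \<bar>f2 w\<bar> \<le> C"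
    and close: "\<And>w. w \<in> space N - A \<Longrightarrow> \<bar>f1 w - f2 w\<bar> \<le> \<epsilon>" and "0 \<le> \<epsilon>"
  shows "\<bar>integral\<^sup>L N f1 - integral\<^sup>L N f2\<bar> \<le> \<epsilon> + 2 * C * measure N A"
proof -
  interpret prob_space N by fact
  have i: "integrable N f1" "integrable N f2"
    by (intro integrable_const_bound[where B=C] AE_I2; use bd in simp)+
  have le: "\<bar>f1 w - f2 w\<bar> \<le> \<epsilon> + 2 * C * indicator A w" if "w \<in> space N" for w
    using bd(1)[OF that] bd(2)[OF that] close[of w] that \<open>0 \<le> \<epsilon>\<close> by (cases "w \<in> A") auto
  have "\<bar>integral\<^sup>L N f1 - integral\<^sup>L N f2\<bar> = \<bar>integral\<^sup>L N (\<lambda>w. f1 w - f2 w)\<bar>" using i by simp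
  also have "\<dots> \<le> integral\<^sup>L N (\<lambda>w. \<bar>f1 w - f2 w\<bar>)" by (rule integral_abs_bound)
  also have "\<dots> \<le> integral\<^sup>L N (\<lambda>w. \<epsilon> + 2 * C * indicator A w)"
    by (intro integral_mono le) (use i in \<open>auto intro!: integrable_mult_right integrable_real_indicator simp: emeasure_eq_measure\<close>)
  also have "\<dots> = \<epsilon> + 2 * C * measure N A"
    by (simp add: prob_space emeasure_eq_measure)
  finally show ?thesis .
qed

lemma integral_near_indicator_le:
  assumes "prob_space N" and [measurable]: "Y0 \<in> borel_measurable N" and "compact K" "0 < \<delta>"
  shows "integral\<^sup>L N (\<lambda>w. near_indicator K \<delta> (Y0 w)) \<le> measure N {w \<in> space N. Y0 w \<notin> K}"
proof -
  interpret prob_space N by fact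
  have [measurable]: "K \<in> sets borel" using \<open>compact K\<close> by (simp add: compact_imp_closed)
  have [measurable]: "near_indicator K \<delta> \<in> borel_measurable borel"
    by (intro borel_measurable_continuous_onI continuous_on_if_lipschitz[OF near_indicator_bounds(4)[OF \<open>0 < \<delta>\<close>]])
  let ?A = "{w \<in> space N. Y0 w \<notin> K}"
  have "integral\<^sup>L N (\<lambda>w. near_indicator K \<delta> (Y0 w)) \<le> integral\<^sup>L N (indicator ?A)"
  proof (rule integral_mono)
    show "integrable N (\<lambda>w. near_indicator K \<delta> (Y0 w))"
      by (intro integrable_const_bound[where B=1] AE_I2) (simp_all add: near_indicator_bounds(1,2)[OF \<open>0 < \<delta>\<close>])
    show "integrable N (indicat_real ?A)" by (intro integrable_real_indicator) (auto simp: emeasure_eq_measure)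
    show "near_indicator K \<delta> (Y0 w) \<le> indicator ?A w" if "w \<in> space N" for w
      using near_indicator_bounds(2,3)[OF \<open>0 < \<delta>\<close>, where K=K and y="Y0 w"] that by (cases "Y0 w \<in> K") auto
  qed
  then show ?thesis by (simp add: emeasure_eq_measure)
qed

text \<open>An extended continuous mapping theorem. Instead of one continuous map there is a sequence \<open>G\<close>
  that approaches \<open>g\<close> only near compact subsets of a set \<open>S\<close> carrying the limit. The maps
  \<open>G n\<close> and the variables \<open>Y n\<close> may be nonmeasurable, whence the pointwise bounds between test
  functions, which pass to outer expectations.\<close>

theorem weakly_converges_mapping:
  fixes Y :: "nat \<Rightarrow> 'a \<Rightarrow> 'm::metric_space" and g :: "'m \<Rightarrow> real"
  assumes M: "\<And>n. prob_space (M n)" and N: "prob_space N"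
    and conv: "weakly_converges M Y N Y0"
    and tight: "\<And>\<epsilon>. 0 < \<epsilon> \<Longrightarrow> \<exists>K. compact K \<and> K \<subseteq> S \<and> measure N {w \<in> space N. Y0 w \<notin> K} \<le> \<epsilon>"
    and cont: "continuous_on S g" and gm[measurable]: "(\<lambda>w. g (Y0 w)) \<in> borel_measurable N"
    and G: "\<And>K \<epsilon>. compact K \<Longrightarrow> K \<subseteq> S \<Longrightarrow> 0 < \<epsilon> \<Longrightarrow>
      \<exists>\<delta>>0. \<forall>\<^sub>F n in sequentially. \<forall>k\<in>K. \<forall>y. dist y k < \<delta> \<longrightarrow> \<bar>G n y - g k\<bar> \<le> \<epsilon>"
  shows "weakly_converges M (\<lambda>n \<omega>. G n (Y n \<omega>)) N (\<lambda>w. g (Y0 w))"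
  unfolding weakly_converges_def
proof (intro conjI gm allI impI)
  fix h :: "real \<Rightarrow> real" assume h: "continuous_on UNIV h \<and> bounded (range h)"
  interpret N: prob_space N by (rule N)
  have Y0[measurable]: "Y0 \<in> borel_measurable N" using conv by (simp add: weakly_converges_def)
  have [measurable]: "h \<in> borel_measurable borel" using h by (intro borel_measurable_continuous_onI) simp
  obtain C0 where "\<And>r. \<bar>h r\<bar> \<le> C0" using h unfolding bounded_iff by auto
  then obtain C where C1: "1 \<le> C" and C: "\<And>r. \<bar>h r\<bar> \<le> C" by (meson le_max_iff_disj order_trans max.cobounded2 max.cobounded1)
  show "(\<lambda>n. outer_expectation (M n) (\<lambda>\<omega>. h (G n (Y n \<omega>)))) \<longlonglongrightarrow> integral\<^sup>L N (\<lambda>w. h (g (Y0 w)))"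
  proof (rule LIMSEQ_I, goal_cases)
    case (1 e)
    \<comment> \<open>The errors below add up to \<open>11 * C * \<epsilon>\<close>; \<open>\<epsilon> < 1\<close> makes the compact set nonempty.\<close>
    define \<epsilon> where "\<epsilon> = min (1/2) (e / (12 * C))"
    have \<epsilon>: "0 < \<epsilon>" "\<epsilon> < 1" "11 * C * \<epsilon> < e"
    proof -
      show "0 < \<epsilon>" "\<epsilon> < 1" using 1 C1 by (auto simp: \<epsilon>_def)
      have "11 * C * \<epsilon> \<le> 11 * C * (e / (12 * C))" using C1 by (intro mult_left_mono) (auto simp: \<epsilon>_def)
      also have "\<dots> < e" using C1 1 by simp
      finally show "11 * C * \<epsilon> < e" .
    qed
    obtain K where K: "compact K" "K \<subseteq> S" "measure N {w \<in> space N. Y0 w \<notin> K} \<le> \<epsilon>" using tight \<epsilon>(1) by blast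
    have K0: "K \<noteq> {}"
    proof
      assume "K = {}"
      then have "measure N {w \<in> space N. Y0 w \<notin> K} = 1" by (simp add: N.prob_space)
      then show False using K(3) \<epsilon>(2) by simp
    qed
    have cgK: "continuous_on K g" using cont K(2) continuous_on_subset by blast
    have "uniformly_continuous_on K (\<lambda>k. h (g k))"
      by (intro compact_uniformly_continuous continuous_on_compose2[OF _ cgK] K(1)) (use h in auto)
    then obtain \<delta>0 where \<delta>0: "0 < \<delta>0" "\<And>k k'. k \<in> K \<Longrightarrow> k' \<in> K \<Longrightarrow> dist k k' < \<delta>0 \<Longrightarrow> \<bar>h (g k) - h (g k')\<bar> \<le> \<epsilon>"
      unfolding uniformly_continuous_on_def dist_real_def using \<epsilon>(1) by (meson less_imp_le)
    obtain R where R: "\<And>k. k \<in> K \<Longrightarrow> \<bar>g k\<bar> \<le> R"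
      using compact_imp_bounded[OF compact_continuous_image[OF cgK K(1)]] unfolding bounded_iff by auto
    \<comment> \<open>A bounded continuous function is uniformly continuous on compact intervals only; values close to
    \<open>g ` K\<close> stay in this one.\<close>
    have "uniformly_continuous_on {- R - 1..R + 1} h"
      by (intro compact_uniformly_continuous) (use h continuous_on_subset in auto)
    then obtain \<delta>1 where \<delta>1: "0 < \<delta>1" "\<And>r s. r \<in> {- R - 1..R + 1} \<Longrightarrow> s \<in> {- R - 1..R + 1} \<Longrightarrow> dist s r < \<delta>1 \<Longrightarrow> dist (h s) (h r) < \<epsilon>"
      unfolding uniformly_continuous_on_def using \<epsilon>(1) by meson
    have "0 < min 1 (\<delta>1 / 2)" using \<delta>1 by simp
    from G[OF K(1,2) this] obtain \<delta>2 where \<delta>2: "0 < \<delta>2"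
      "\<forall>\<^sub>F n in sequentially. \<forall>k\<in>K. \<forall>y. dist y k < \<delta>2 \<longrightarrow> \<bar>G n y - g k\<bar> \<le> min 1 (\<delta>1 / 2)" by blast
    define m where "m = 2 * C / \<delta>0 + 1"
    have m: "2 * C / \<delta>0 \<le> m" "0 < m" using C1 \<delta>0(1) by (auto simp: m_def add_pos_pos)
    define \<delta> where "\<delta> = min \<delta>2 (\<epsilon> / m)"
    have \<delta>: "0 < \<delta>" "\<delta> \<le> \<delta>2" "m * \<delta> \<le> \<epsilon>"
    proof -
      show "0 < \<delta>" "\<delta> \<le> \<delta>2" using \<delta>2 \<epsilon> m by (auto simp: \<delta>_def)
      have "m * \<delta> \<le> m * (\<epsilon> / m)" using m by (intro mult_left_mono) (auto simp: \<delta>_def)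
      then show "m * \<delta> \<le> \<epsilon>" using m by simp
    qed
    define f where "f = lipschitz_extension C K (\<lambda>k. h (g k)) m"
    define \<psi> where "\<psi> = near_indicator K \<delta>"
    have fC: "\<bar>f y\<bar> \<le> C" for y unfolding f_def by (rule lipschitz_extension_bounds(1)[OF K0 C less_imp_le[OF m(2)]])
    have fc: "continuous_on UNIV f"
      unfolding f_def by (rule continuous_on_if_lipschitz, rule lipschitz_extension_bounds(2)[OF K0 C less_imp_le[OF m(2)]])
    have \<psi>1: "0 \<le> \<psi> y" "\<psi> y \<le> 1" "y \<in> K \<Longrightarrow> \<psi> y = 0" for y unfolding \<psi>_def using near_indicator_bounds[OF \<delta>(1)] by auto
    have \<psi>c: "continuous_on UNIV \<psi>"
      unfolding \<psi>_def by (rule continuous_on_if_lipschitz, rule near_indicator_bounds(4)[OF \<delta>(1)])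
    have [measurable]: "f \<in> borel_measurable borel" "\<psi> \<in> borel_measurable borel"
      using fc \<psi>c by (auto intro: borel_measurable_continuous_onI)
    have [measurable]: "K \<in> sets borel" using K(1) by (simp add: compact_imp_closed)
    have "bounded (range f)" unfolding bounded_iff using fC by auto
    then have lf: "(\<lambda>n. outer_expectation (M n) (\<lambda>\<omega>. f (Y n \<omega>))) \<longlonglongrightarrow> integral\<^sup>L N (\<lambda>w. f (Y0 w))"
      using conv fc unfolding weakly_converges_def by blast
    have "bounded (range \<psi>)" unfolding bounded_iff using \<psi>1 by (auto intro!: exI[of _ 1])
    then have l\<psi>: "(\<lambda>n. outer_expectation (M n) (\<lambda>\<omega>. \<psi> (Y n \<omega>))) \<longlonglongrightarrow> integral\<^sup>L N (\<lambda>w. \<psi> (Y0 w))"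
      using conv \<psi>c unfolding weakly_converges_def by blast
    have \<psi>N: "integral\<^sup>L N (\<lambda>w. \<psi> (Y0 w)) \<le> \<epsilon>"
      using integral_near_indicator_le[OF N Y0 K(1) \<delta>(1)] K(3) by (simp add: \<psi>_def)
    have "\<bar>integral\<^sup>L N (\<lambda>w. f (Y0 w)) - integral\<^sup>L N (\<lambda>w. h (g (Y0 w)))\<bar> \<le> \<epsilon> + 2 * C * measure N {w \<in> space N. Y0 w \<notin> K}"
    proof (rule integral_diff_le_off_set[OF N])
      fix w assume w: "w \<in> space N - {w \<in> space N. Y0 w \<notin> K}"
      then show "\<bar>f (Y0 w) - h (g (Y0 w))\<bar> \<le> \<epsilon>"
        unfolding f_def by (intro lipschitz_extension_approx[OF C \<delta>0 m(1)]) (use \<epsilon> in auto)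
    qed (use fC C \<epsilon> in \<open>auto simp: less_imp_le\<close>)
    also have "\<dots> \<le> \<epsilon> + 2 * C * \<epsilon>" using K(3) C1 by (intro add_left_mono mult_left_mono) auto
    finally have fN: "\<bar>integral\<^sup>L N (\<lambda>w. f (Y0 w)) - integral\<^sup>L N (\<lambda>w. h (g (Y0 w)))\<bar> \<le> \<epsilon> + 2 * C * \<epsilon>" .
    have ev1: "\<forall>\<^sub>F n in sequentially. \<bar>outer_expectation (M n) (\<lambda>\<omega>. f (Y n \<omega>)) - integral\<^sup>L N (\<lambda>w. f (Y0 w))\<bar> < \<epsilon>"
      using tendstoD[OF lf \<epsilon>(1)] by (simp add: dist_real_def)
    have ev2: "\<forall>\<^sub>F n in sequentially. outer_expectation (M n) (\<lambda>\<omega>. \<psi> (Y n \<omega>)) < 2 * \<epsilon>"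
      using order_tendstoD(2)[OF l\<psi>] \<psi>N \<epsilon>(1) by simp
    have "\<forall>\<^sub>F n in sequentially. \<bar>outer_expectation (M n) (\<lambda>\<omega>. h (G n (Y n \<omega>))) - integral\<^sup>L N (\<lambda>w. h (g (Y0 w)))\<bar> < e"
      using ev1 ev2 \<delta>2(2)
    proof eventually_elim
      case (elim n)
      have close: "\<bar>h (G n y) - f y\<bar> \<le> 3 * \<epsilon> + 2 * C * \<psi> y" for y
        unfolding f_def \<psi>_def
      proof (rule approx_by_lipschitz_extension[OF K0 C C \<delta>0 m(1) _ _ \<delta>(1,3)])
        fix k assume k: "k \<in> K" "dist y k < \<delta>"
        then have "\<bar>G n y - g k\<bar> \<le> min 1 (\<delta>1 / 2)" using elim(3) \<delta>(2) by auto
        then have "dist (h (G n y)) (h (g k)) < \<epsilon>"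
          using R[OF k(1)] \<delta>1(1) by (intro \<delta>1(2)) (auto simp: dist_real_def)
        then show "\<bar>h (G n y) - h (g k)\<bar> \<le> \<epsilon>" by (simp add: dist_real_def)
      qed (use m \<epsilon> in auto)
      have c2: "0 \<le> 2 * C" using C1 by simp
      have \<psi>a: "\<bar>\<psi> y\<bar> \<le> 1" for y using \<psi>1[of y] by simp
      have "outer_expectation (M n) (\<lambda>\<omega>. h (G n (Y n \<omega>)))
          \<le> outer_expectation (M n) (\<lambda>\<omega>. f (Y n \<omega>)) + 3 * \<epsilon> + 2 * C * outer_expectation (M n) (\<lambda>\<omega>. \<psi> (Y n \<omega>))"
      proof (rule outer_expectation_le_combination[OF M C fC \<psi>a c2])
        fix x show "h (G n (Y n x)) \<le> f (Y n x) + 3 * \<epsilon> + 2 * C * \<psi> (Y n x)" using close[of "Y n x"] by linarith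
      qed
      moreover have "outer_expectation (M n) (\<lambda>\<omega>. f (Y n \<omega>))
          \<le> outer_expectation (M n) (\<lambda>\<omega>. h (G n (Y n \<omega>))) + 3 * \<epsilon> + 2 * C * outer_expectation (M n) (\<lambda>\<omega>. \<psi> (Y n \<omega>))"
      proof (rule outer_expectation_le_combination[OF M fC C \<psi>a c2])
        fix x show "f (Y n x) \<le> h (G n (Y n x)) + 3 * \<epsilon> + 2 * C * \<psi> (Y n x)" using close[of "Y n x"] by linarith
      qed
      moreover have "2 * C * outer_expectation (M n) (\<lambda>\<omega>. \<psi> (Y n \<omega>)) \<le> 2 * C * (2 * \<epsilon>)"
        using elim(2) C1 by (intro mult_left_mono) auto
      ultimately have "\<bar>outer_expectation (M n) (\<lambda>\<omega>. h (G n (Y n \<omega>))) - integral\<^sup>L N (\<lambda>w. h (g (Y0 w)))\<bar>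
          \<le> 3 * \<epsilon> + 2 * C * (2 * \<epsilon>) + \<epsilon> + (\<epsilon> + 2 * C * \<epsilon>)"
        using elim(1) fN by linarith
      also have "\<dots> \<le> 11 * C * \<epsilon>"
      proof -
        have "\<epsilon> \<le> C * \<epsilon>" using C1 \<epsilon>(1) by simp
        then show ?thesis by simp
      qed
      also have "\<dots> < e" by (rule \<epsilon>(3))
      finally show ?case .
    qed
    then show ?case by (simp add: eventually_sequentially)
  qed
qed

section \<open>Conditional weak convergence under asymptotically continuous maps\<close>

lemma sigma_finite_subalgebraI:
  assumes "prob_space M" "subalgebra M F"
  shows "sigma_finite_subalgebra M F"
  using assms by (intro finite_measure_subalgebra_is_sigma_finite finite_measure_subalgebra.intro
      finite_measure_subalgebra_axioms.intro) (auto simp: prob_space_def)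

lemma ex_cond_outer_exp_version:
  assumes "prob_space M" "\<And>x. x \<in> space M \<Longrightarrow> \<bar>f x\<bar> \<le> C"
  obtains c where "cond_outer_exp_version M F f c"
proof -
  obtain g where "least_measurable_majorant M f g"
    by (rule ex_least_measurable_majorant[OF assms(1), of f C, OF assms(2)])
  then have "cond_outer_exp_version M F f (real_cond_exp M F g)"
    unfolding cond_outer_exp_version_def by auto
  then show thesis by (rule that)
qed

lemma cond_outer_exp_le_combination:
  assumes M: "prob_space M" "subalgebra M F"
    and v: "cond_outer_exp_version M F f c" "cond_outer_exp_version M F f1 c1" "cond_outer_exp_version M F f2 c2"
    and bd: "\<And>x. x \<in> space M \<Longrightarrow> \<bar>f x\<bar> \<le> 1" "\<And>x. x \<in> space M \<Longrightarrow> \<bar>f1 x\<bar> \<le> 1" "\<And>x. x \<in> space M \<Longrightarrow> \<bar>f2 x\<bar> \<le> 1"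
    and "B \<in> sets M" and "0 \<le> a1" "0 \<le> a2"
    and le: "\<And>x. x \<in> space M \<Longrightarrow> f x \<le> a1 * f1 x + a + a2 * f2 x + b * indicator B x"
  shows "AE x in M. c x \<le> a1 * c1 x + a + a2 * c2 x + b * real_cond_exp M F (indicator B) x"
proof -
  interpret sigma_finite_subalgebra M F by (rule sigma_finite_subalgebraI[OF M])
  interpret prob_space M by fact
  obtain g g1 g2 where g: "least_measurable_majorant M f g" "AE x in M. c x = real_cond_exp M F g x"
    and g1: "least_measurable_majorant M f1 g1" "AE x in M. c1 x = real_cond_exp M F g1 x"
    and g2: "least_measurable_majorant M f2 g2" "AE x in M. c2 x = real_cond_exp M F g2 x"
    using v unfolding cond_outer_exp_version_def by blast
  have i: "integrable M g" "integrable M g1" "integrable M g2"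
    using least_measurable_majorantD(4)[OF M(1) g(1), of 1, OF bd(1)] least_measurable_majorantD(4)[OF M(1) g1(1), of 1, OF bd(2)]
      least_measurable_majorantD(4)[OF M(1) g2(1), of 1, OF bd(3)] by auto
  have iB: "integrable M (indicat_real B)" using \<open>B \<in> sets M\<close> by (simp add: emeasure_eq_measure)
  have "AE x in M. g x \<le> a1 * g1 x + a + a2 * g2 x + b * indicator B x"
    by (rule least_measurable_majorant_le_combination[OF g(1) g1(1) g2(1)]) fact+
  from real_cond_exp_mono[OF this i(1)]
  have mono: "AE x in M. real_cond_exp M F g x \<le> real_cond_exp M F (\<lambda>x. a1 * g1 x + a + a2 * g2 x + b * indicator B x) x"
    using i iB by simp
  have s1: "AE x in M. real_cond_exp M F (\<lambda>x. a1 * g1 x + a + a2 * g2 x + b * indicator B x) x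
      = real_cond_exp M F (\<lambda>x. a1 * g1 x + a + a2 * g2 x) x + real_cond_exp M F (\<lambda>x. b * indicator B x) x"
    by (rule real_cond_exp_add) (use i iB in simp_all)
  have s2: "AE x in M. real_cond_exp M F (\<lambda>x. a1 * g1 x + a + a2 * g2 x) x
      = real_cond_exp M F (\<lambda>x. a1 * g1 x + a) x + real_cond_exp M F (\<lambda>x. a2 * g2 x) x"
    by (rule real_cond_exp_add) (use i in simp_all)
  have s3: "AE x in M. real_cond_exp M F (\<lambda>x. a1 * g1 x + a) x
      = real_cond_exp M F (\<lambda>x. a1 * g1 x) x + real_cond_exp M F (\<lambda>x. a) x"
    by (rule real_cond_exp_add) (use i in simp_all)
  have s4: "AE x in M. real_cond_exp M F (\<lambda>x. a) x = a"
    by (rule real_cond_exp_F_meas) auto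
  note s5 = real_cond_exp_cmult[OF i(2), of a1] real_cond_exp_cmult[OF i(3), of a2] real_cond_exp_cmult[OF iB, of b]
  from mono s1 s2 s3 s4 s5 g(2) g1(2) g2(2) show ?thesis
    by eventually_elim simp
qed

text \<open>The exceptional event of small probability may depend on more than the conditioning
  sigma-algebra; Markov's inequality shows that its conditional probability is small with large
  probability. The absolute value is there because conditional expectations are nonnegative only
  up to a null set.\<close>

lemma real_cond_exp_indicator_tail:
  assumes M: "prob_space M" "subalgebra M F" and B: "B \<in> sets M" and "0 < r"
  shows "measure M {x \<in> space M. r \<le> \<bar>real_cond_exp M F (indicator B) x\<bar>} \<le> measure M B / r"
proof -
  interpret sigma_finite_subalgebra M F by (rule sigma_finite_subalgebraI[OF M])
  interpret prob_space M by fact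
  have iB: "integrable M (indicat_real B)" using B by (simp add: emeasure_eq_measure)
  have pos: "AE x in M. 0 \<le> real_cond_exp M F (indicator B) x"
    using iB B by (intro real_cond_exp_pos) auto
  have "measure M {x \<in> space M. r \<le> \<bar>real_cond_exp M F (indicator B) x\<bar>}
      \<le> (\<integral>x. \<bar>real_cond_exp M F (indicator B) x\<bar> \<partial>M) / r"
    by (rule integral_Markov_inequality_measure[where A="{}"])
      (use real_cond_exp_int(1)[OF iB] \<open>0 < r\<close> in auto)
  also have "(\<integral>x. \<bar>real_cond_exp M F (indicator B) x\<bar> \<partial>M) = integral\<^sup>L M (real_cond_exp M F (indicator B))"
    by (rule integral_cong_AE) (use pos in \<open>auto simp: borel_measurable_cond_exp2\<close>)
  also have "\<dots> = measure M B"
    using real_cond_exp_int(2)[OF iB] B by (simp add: emeasure_eq_measure)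
  finally show ?thesis .
qed

lemma ennreal_tendsto_zeroI:
  fixes f :: "nat \<Rightarrow> ennreal"
  assumes "\<And>\<tau>. 0 < \<tau> \<Longrightarrow> \<forall>\<^sub>F n in sequentially. f n \<le> ennreal \<tau>"
  shows "f \<longlonglongrightarrow> 0"
proof (rule order_tendstoI)
  fix a :: ennreal assume "0 < a"
  then obtain b where b: "0 < b" "b < a" using dense by blast
  then obtain \<tau> where \<tau>: "b = ennreal \<tau>" "0 \<le> \<tau>" by (cases b) (auto simp: top.not_eq_extremum)
  then have "0 < \<tau>" using b by (auto simp: less_le)
  from assms[OF this] show "\<forall>\<^sub>F n in sequentially. f n < a"
    by eventually_elim (use b \<tau> in auto)
qed simp

text \<open>A test function \<open>h \<in> BL1\<close> applied to the statistic is replaced by two test functions in \<open>BL1\<close>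
  of its argument, both rescaled by the same factor \<open>L\<close>. As \<open>h\<close> is \<open>1\<close>-Lipschitz, \<open>h \<circ> g\<close>
  inherits the modulus of continuity of \<open>g\<close> on \<open>K\<close>, so \<open>L\<close> does not depend on \<open>h\<close>. This is
  what makes the convergence uniform over \<open>BL1\<close>.\<close>

lemma lipschitz_test_functions:
  fixes g :: "'m::metric_space \<Rightarrow> real"
  assumes N: "prob_space N" and Y0[measurable]: "Y0 \<in> borel_measurable N"
    and gm[measurable]: "(\<lambda>w. g (Y0 w)) \<in> borel_measurable N"
    and K: "compact K" "continuous_on K g" "measure N {w \<in> space N. Y0 w \<notin> K} \<le> \<epsilon>"
    and \<epsilon>: "0 < \<epsilon>" "\<epsilon> < 1" and \<delta>1: "0 < \<delta>1"
  obtains L where "1 \<le> L"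
    "\<And>h. h \<in> BL1 \<Longrightarrow> \<exists>h1\<in>BL1. \<exists>h2\<in>BL1. (\<forall>y. \<bar>L * h1 y\<bar> \<le> 1) \<and> (\<forall>y. 0 \<le> h2 y) \<and>
      (\<forall>y v. (\<forall>k\<in>K. dist y k < \<delta>1 \<longrightarrow> \<bar>v - g k\<bar> \<le> \<epsilon>) \<longrightarrow> \<bar>h v - L * h1 y\<bar> \<le> 3 * \<epsilon> + 2 * L * h2 y) \<and>
      \<bar>L * integral\<^sup>L N (\<lambda>w. h1 (Y0 w)) - integral\<^sup>L N (\<lambda>w. h (g (Y0 w)))\<bar> \<le> 3 * \<epsilon> \<and>
      L * integral\<^sup>L N (\<lambda>w. h2 (Y0 w)) \<le> \<epsilon>"
proof -
  interpret N: prob_space N by (rule N)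
  have K0: "K \<noteq> {}"
  proof
    assume "K = {}"
    then have "measure N {w \<in> space N. Y0 w \<notin> K} = 1" by (simp add: N.prob_space)
    then show False using K(3) \<epsilon>(2) by simp
  qed
  have "uniformly_continuous_on K g" by (intro compact_uniformly_continuous K)
  then obtain \<delta>0 where \<delta>0: "0 < \<delta>0" "\<And>k k'. k \<in> K \<Longrightarrow> k' \<in> K \<Longrightarrow> dist k k' < \<delta>0 \<Longrightarrow> dist (g k) (g k') \<le> \<epsilon>"
    unfolding uniformly_continuous_on_def using \<epsilon>(1) by (meson less_imp_le)
  define m where "m = 2 * 1 / \<delta>0 + 1"
  have m: "2 * 1 / \<delta>0 \<le> m" "1 \<le> m" "0 \<le> m" "0 < m" using \<delta>0(1) by (auto simp: m_def add_pos_pos)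
  define \<delta> where "\<delta> = min \<delta>1 (\<epsilon> / m)"
  have \<delta>: "0 < \<delta>" "\<delta> \<le> \<delta>1" "m * \<delta> \<le> \<epsilon>"
  proof -
    show "0 < \<delta>" "\<delta> \<le> \<delta>1" using \<delta>1 \<epsilon> m by (auto simp: \<delta>_def)
    have "m * \<delta> \<le> m * (\<epsilon> / m)" using m by (intro mult_left_mono) (auto simp: \<delta>_def)
    then show "m * \<delta> \<le> \<epsilon>" using m by simp
  qed
  define L where "L = max m (1 / \<delta>)"
  have L: "1 \<le> L" "m \<le> L" "1 / \<delta> \<le> L" using m by (auto simp: L_def)
  have [measurable]: "K \<in> sets borel" using K(1) by (simp add: compact_imp_closed)
  define \<psi> where "\<psi> = near_indicator K \<delta>"
  have \<psi>1: "0 \<le> \<psi> y" "\<bar>\<psi> y\<bar> \<le> 1" for y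
    using near_indicator_bounds(1,2)[OF \<delta>(1), of K y] by (auto simp: \<psi>_def)
  have \<psi>BL: "(\<lambda>y. \<psi> y / L) \<in> BL1"
    using near_indicator_bounds(4)[OF \<delta>(1)] L by (intro BL1_divide[OF \<psi>1(2), where L="1 / \<delta>"]) (auto simp: \<psi>_def)
  show thesis
  proof (rule that[OF L(1)], goal_cases)
    case (1 h)
    note h = this
    note [measurable] = BL1_D(3)[OF h]
    have hmod: "\<bar>h (g k) - h (g k')\<bar> \<le> \<epsilon>" if "k \<in> K" "k' \<in> K" "dist k k' < \<delta>0" for k k'
      using BL1_D(2)[OF h, of "g k" "g k'"] \<delta>0(2)[OF that] by simp
    define f where "f = lipschitz_extension 1 K (\<lambda>k. h (g k)) m"
    have f1: "\<bar>f y\<bar> \<le> 1" for y unfolding f_def by (rule lipschitz_extension_bounds(1)[OF K0 BL1_D(1)[OF h] m(3)])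
    have fL: "\<bar>f y - f y'\<bar> \<le> m * dist y y'" for y y'
      unfolding f_def by (rule lipschitz_extension_bounds(2)[OF K0 BL1_D(1)[OF h] m(3)])
    have [measurable]: "f \<in> borel_measurable borel"
      by (intro borel_measurable_continuous_onI continuous_on_if_lipschitz[OF fL])
    have fBL: "(\<lambda>y. f y / L) \<in> BL1" by (rule BL1_divide[OF f1 fL L(2,1)])
    have "\<bar>h v - f y\<bar> \<le> 3 * \<epsilon> + 2 * 1 * \<psi> y" if v: "\<forall>k\<in>K. dist y k < \<delta>1 \<longrightarrow> \<bar>v - g k\<bar> \<le> \<epsilon>" for y v
      unfolding f_def \<psi>_def
    proof (rule approx_by_lipschitz_extension[OF K0 BL1_D(1)[OF h] BL1_D(1)[OF h] \<delta>0(1) hmod m(1) m(3) _ \<delta>(1,3)])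
      fix k assume k: "k \<in> K" "dist y k < \<delta>"
      then show "\<bar>h v - h (g k)\<bar> \<le> \<epsilon>" using v \<delta>(2) BL1_D(2)[OF h, of v "g k"] by (auto simp: dist_real_def)
    qed (use \<epsilon> in auto)
    moreover have "\<bar>integral\<^sup>L N (\<lambda>w. f (Y0 w)) - integral\<^sup>L N (\<lambda>w. h (g (Y0 w)))\<bar> \<le> 3 * \<epsilon>"
    proof -
      have "\<bar>integral\<^sup>L N (\<lambda>w. f (Y0 w)) - integral\<^sup>L N (\<lambda>w. h (g (Y0 w)))\<bar> \<le> \<epsilon> + 2 * 1 * measure N {w \<in> space N. Y0 w \<notin> K}"
      proof (rule integral_diff_le_off_set[OF N])
        fix w assume w: "w \<in> space N - {w \<in> space N. Y0 w \<notin> K}"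
        then show "\<bar>f (Y0 w) - h (g (Y0 w))\<bar> \<le> \<epsilon>"
          unfolding f_def by (intro lipschitz_extension_approx[OF BL1_D(1)[OF h] \<delta>0(1) hmod m(1)]) (use \<epsilon> in auto)
      qed (use f1 BL1_D(1)[OF h] \<epsilon> in \<open>auto simp: less_imp_le\<close>)
      then show ?thesis using K(3) by simp
    qed
    moreover have "integral\<^sup>L N (\<lambda>w. \<psi> (Y0 w)) \<le> \<epsilon>"
      using integral_near_indicator_le[OF N Y0 K(1) \<delta>(1)] K(3) by (simp add: \<psi>_def)
    ultimately show ?case
      using f1 \<psi>1 L by (intro bexI[OF _ fBL] bexI[OF _ \<psi>BL]) auto
  qed
qed

text \<open>The conditional extended continuous mapping theorem. For each single \<open>h\<close> the comparison of test
  functions bounds the conditional expectation of \<open>h\<close> at the statistic by conditional expectations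
  for \<open>Y\<close>, outside a null set. The null set depends on \<open>h\<close>, of which there are uncountably many,
  so the supremum over \<open>h\<close> calls for a good choice of versions. The bounds, one for each accuracy
  \<open>\<epsilon> j\<close>, only involve measurable functions. Thus they hold on an event of the conditioning
  sigma-algebra with full probability, and off this event the conditional expectation may be
  redefined to be the limit value. Then the bounds hold everywhere for all \<open>h\<close> simultaneously.\<close>

theorem cond_weakly_converges_mapping:
  fixes Y :: "nat \<Rightarrow> 'a \<Rightarrow> 'm::metric_space" and g :: "'m \<Rightarrow> real" and G :: "nat \<Rightarrow> 'a \<Rightarrow> 'm \<Rightarrow> real"
  assumes M: "\<And>n. prob_space (M n)" "\<And>n. subalgebra (M n) (F n)" and N: "prob_space N"
    and conv: "cond_weakly_converges M F Y N Y0"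
    and tight: "\<And>\<epsilon>. 0 < \<epsilon> \<Longrightarrow> \<exists>K. compact K \<and> K \<subseteq> S \<and> measure N {w \<in> space N. Y0 w \<notin> K} \<le> \<epsilon>"
    and cont: "continuous_on S g" and gm[measurable]: "(\<lambda>w. g (Y0 w)) \<in> borel_measurable N"
    and G: "\<And>K \<epsilon> \<eta>. compact K \<Longrightarrow> K \<subseteq> S \<Longrightarrow> 0 < \<epsilon> \<Longrightarrow> 0 < \<eta> \<Longrightarrow>
      \<exists>\<delta>>0. \<exists>B. (\<forall>n. B n \<in> sets (M n)) \<and> (\<forall>\<^sub>F n in sequentially. measure (M n) (B n) \<le> \<eta> \<and>
        (\<forall>\<omega>\<in>space (M n) - B n. \<forall>k\<in>K. \<forall>y. dist y k < \<delta> \<longrightarrow> \<bar>G n \<omega> y - g k\<bar> \<le> \<epsilon>))"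
  shows "cond_weakly_converges M F (\<lambda>n \<omega>. G n \<omega> (Y n \<omega>)) N (\<lambda>w. g (Y0 w))"
proof -
  have Y0[measurable]: "Y0 \<in> borel_measurable N" using conv by (simp add: cond_weakly_converges_def)
  define E where "E h = integral\<^sup>L N (\<lambda>w. h (Y0 w))" for h :: "'m \<Rightarrow> real"
  define E' where "E' h = integral\<^sup>L N (\<lambda>w. h (g (Y0 w)))" for h :: "real \<Rightarrow> real"
  obtain c where c: "\<And>n h. h \<in> BL1 \<Longrightarrow> cond_outer_exp_version (M n) (F n) (\<lambda>\<omega>. h (Y n \<omega>)) (c n h)"
    and c0: "tendsto_zero_outer_prob M (\<lambda>n \<omega>. SUP h\<in>BL1. ereal \<bar>c n h \<omega> - E h\<bar>)"
    using conv unfolding cond_weakly_converges_def E_def by blast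
  define \<Delta> where "\<Delta> n \<omega> = (SUP h\<in>BL1. ereal \<bar>c n h \<omega> - E h\<bar>)" for n \<omega>
  define c' where "c' n h = (SOME u. cond_outer_exp_version (M n) (F n) (\<lambda>\<omega>. h (G n \<omega> (Y n \<omega>))) u)" for n and h :: "real \<Rightarrow> real"
  have c': "cond_outer_exp_version (M n) (F n) (\<lambda>\<omega>. h (G n \<omega> (Y n \<omega>))) (c' n h)" if "h \<in> BL1" for n and h :: "real \<Rightarrow> real"
    by (rule ex_cond_outer_exp_version[OF M(1)[of n], where F="F n" and f="\<lambda>\<omega>. h (G n \<omega> (Y n \<omega>))" and C=1, OF BL1_D(1)[OF that]])
      (unfold c'_def, rule someI[where P="cond_outer_exp_version (M n) (F n) (\<lambda>\<omega>. h (G n \<omega> (Y n \<omega>)))"])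
  define p where "p n B = real_cond_exp (M n) (F n) (indicator B)" for n B
  \<comment> \<open>The bound for a single \<open>h\<close>: \<open>3 * \<epsilon>\<close> from comparing functions, \<open>3 * \<epsilon>\<close> from comparing the
    integrals under the limit law, and \<open>2 * \<epsilon>\<close> for the mass of the limit law off the compact set.\<close>
  define rhs where "rhs \<epsilon> L B n h1 h2 \<omega> = 8 * \<epsilon> + L * (\<bar>c n h1 \<omega> - E h1\<bar> + 2 * \<bar>c n h2 \<omega> - E h2\<bar>) + 2 * \<bar>p n B \<omega>\<bar>"
    for \<epsilon> L B n h1 h2 \<omega>
  define \<epsilon> where "\<epsilon> j = 1 / real (j + 2)" for j :: nat
  have \<epsilon>: "0 < \<epsilon> j" "\<epsilon> j < 1" for j by (auto simp: \<epsilon>_def)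
  define good where "good j L B n0 \<longleftrightarrow> 1 \<le> L \<and> (\<forall>n. B n \<in> sets (M n)) \<and> (\<forall>n\<ge>n0. measure (M n) (B n) \<le> (\<epsilon> j)\<^sup>2) \<and>
      (\<forall>n\<ge>n0. \<forall>h\<in>BL1. \<exists>h1\<in>BL1. \<exists>h2\<in>BL1. AE \<omega> in M n. \<bar>c' n h \<omega> - E' h\<bar> \<le> rhs (\<epsilon> j) L (B n) n h1 h2 \<omega>)"
    for j L B n0
  have "\<exists>L B n0. good j L B n0" for j
  proof -
    obtain K where K: "compact K" "K \<subseteq> S" "measure N {w \<in> space N. Y0 w \<notin> K} \<le> \<epsilon> j" using tight \<epsilon>(1) by blast
    have "0 < (\<epsilon> j)\<^sup>2" using \<epsilon>(1)[of j] by simp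
    from G[OF K(1,2) \<epsilon>(1) this] obtain \<delta>1 B n0 where \<delta>1: "0 < \<delta>1" and B: "\<And>n. B n \<in> sets (M n)"
      and n0: "\<And>n. n0 \<le> n \<Longrightarrow> measure (M n) (B n) \<le> (\<epsilon> j)\<^sup>2"
        "\<And>n \<omega> k y. n0 \<le> n \<Longrightarrow> \<omega> \<in> space (M n) - B n \<Longrightarrow> k \<in> K \<Longrightarrow> dist y k < \<delta>1 \<Longrightarrow> \<bar>G n \<omega> y - g k\<bar> \<le> \<epsilon> j"
      unfolding eventually_sequentially by metis
    obtain L where L: "1 \<le> L"
      "\<And>h. h \<in> BL1 \<Longrightarrow> \<exists>h1\<in>BL1. \<exists>h2\<in>BL1. (\<forall>y. \<bar>L * h1 y\<bar> \<le> 1) \<and> (\<forall>y. 0 \<le> h2 y) \<and>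
      (\<forall>y v. (\<forall>k\<in>K. dist y k < \<delta>1 \<longrightarrow> \<bar>v - g k\<bar> \<le> \<epsilon> j) \<longrightarrow> \<bar>h v - L * h1 y\<bar> \<le> 3 * \<epsilon> j + 2 * L * h2 y) \<and>
      \<bar>L * integral\<^sup>L N (\<lambda>w. h1 (Y0 w)) - integral\<^sup>L N (\<lambda>w. h (g (Y0 w)))\<bar> \<le> 3 * \<epsilon> j \<and>
      L * integral\<^sup>L N (\<lambda>w. h2 (Y0 w)) \<le> \<epsilon> j"
      by (rule lipschitz_test_functions[OF N Y0 gm K(1) continuous_on_subset[OF cont K(2)] K(3) \<epsilon> \<delta>1]) blast
    have "\<exists>h1\<in>BL1. \<exists>h2\<in>BL1. AE \<omega> in M n. \<bar>c' n h \<omega> - E' h\<bar> \<le> rhs (\<epsilon> j) L (B n) n h1 h2 \<omega>"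
      if n: "n0 \<le> n" and h: "h \<in> BL1" for n h
    proof -
      obtain h1 h2 where h12: "h1 \<in> BL1" "h2 \<in> BL1"
        and h1: "\<And>y. \<bar>L * h1 y\<bar> \<le> 1" and h2: "\<And>y. 0 \<le> h2 y"
        and close: "\<And>y v. (\<And>k. k \<in> K \<Longrightarrow> dist y k < \<delta>1 \<Longrightarrow> \<bar>v - g k\<bar> \<le> \<epsilon> j) \<Longrightarrow> \<bar>h v - L * h1 y\<bar> \<le> 3 * \<epsilon> j + 2 * L * h2 y"
        and E1: "\<bar>L * E h1 - E' h\<bar> \<le> 3 * \<epsilon> j" and E2: "L * E h2 \<le> \<epsilon> j"
        using L(2)[OF h] unfolding E_def E'_def by blast
      have point: "\<bar>h (G n \<omega> (Y n \<omega>)) - L * h1 (Y n \<omega>)\<bar> \<le> 3 * \<epsilon> j + 2 * L * h2 (Y n \<omega>) + 2 * indicator (B n) \<omega>"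
        if \<omega>: "\<omega> \<in> space (M n)" for \<omega>
      proof (cases "\<omega> \<in> B n")
        case True
        have "0 \<le> 2 * L * h2 (Y n \<omega>)" using L(1) h2 by simp
        then show ?thesis using True h1[of "Y n \<omega>"] BL1_D(1)[OF h, of "G n \<omega> (Y n \<omega>)"] \<epsilon>(1)[of j] by simp
      next
        case False
        then have "\<bar>h (G n \<omega> (Y n \<omega>)) - L * h1 (Y n \<omega>)\<bar> \<le> 3 * \<epsilon> j + 2 * L * h2 (Y n \<omega>)"
          using n0(2)[OF n] \<omega> by (intro close) auto
        then show ?thesis using False by simp
      qed
      have up: "AE \<omega> in M n. c' n h \<omega> \<le> L * c n h1 \<omega> + 3 * \<epsilon> j + 2 * L * c n h2 \<omega> + 2 * p n (B n) \<omega>"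
        unfolding p_def
        by (rule cond_outer_exp_le_combination[OF M c'[OF h] c[OF h12(1)] c[OF h12(2)] BL1_D(1)[OF h]
              BL1_D(1)[OF h12(1)] BL1_D(1)[OF h12(2)] B])
          (use L(1) point in \<open>fastforce simp: abs_le_iff\<close>)+
      \<comment> \<open>Least majorants are sublinear but not odd, so the reverse comparison is a separate step.\<close>
      have lo: "AE \<omega> in M n. c n h1 \<omega> \<le> 1 / L * c' n h \<omega> + 3 * \<epsilon> j / L + 2 * c n h2 \<omega> + 2 / L * p n (B n) \<omega>"
        unfolding p_def
      proof (rule cond_outer_exp_le_combination[OF M c[OF h12(1)] c'[OF h] c[OF h12(2)] BL1_D(1)[OF h12(1)]
              BL1_D(1)[OF h] BL1_D(1)[OF h12(2)] B])
        fix \<omega> assume "\<omega> \<in> space (M n)"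
        then have "L * h1 (Y n \<omega>) \<le> h (G n \<omega> (Y n \<omega>)) + 3 * \<epsilon> j + 2 * L * h2 (Y n \<omega>) + 2 * indicator (B n) \<omega>"
          using point[of \<omega>] by linarith
        also have "\<dots> = L * (1 / L * h (G n \<omega> (Y n \<omega>)) + 3 * \<epsilon> j / L + 2 * h2 (Y n \<omega>) + 2 / L * indicator (B n) \<omega>)"
          using L(1) by (simp add: algebra_simps)
        finally show "h1 (Y n \<omega>) \<le> 1 / L * h (G n \<omega> (Y n \<omega>)) + 3 * \<epsilon> j / L + 2 * h2 (Y n \<omega>) + 2 / L * indicator (B n) \<omega>"
          using L(1) by (simp only: mult_le_cancel_left)
      qed (use L(1) in auto)
      from up lo have "AE \<omega> in M n. \<bar>c' n h \<omega> - E' h\<bar> \<le> rhs (\<epsilon> j) L (B n) n h1 h2 \<omega>"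
      proof eventually_elim
        case (elim \<omega>)
        have "L * c n h1 \<omega> \<le> L * (1 / L * c' n h \<omega> + 3 * \<epsilon> j / L + 2 * c n h2 \<omega> + 2 / L * p n (B n) \<omega>)"
          using elim(2) L(1) by (intro mult_left_mono) auto
        also have "\<dots> = c' n h \<omega> + 3 * \<epsilon> j + 2 * L * c n h2 \<omega> + 2 * p n (B n) \<omega>"
          using L(1) by (simp add: algebra_simps)
        finally have lo: "L * c n h1 \<omega> \<le> c' n h \<omega> + 3 * \<epsilon> j + 2 * (L * c n h2 \<omega>) + 2 * p n (B n) \<omega>" by simp
        have up: "c' n h \<omega> \<le> L * c n h1 \<omega> + 3 * \<epsilon> j + 2 * (L * c n h2 \<omega>) + 2 * p n (B n) \<omega>"
          using elim(1) by simp
        have a: "\<bar>L * x - L * y\<bar> = L * \<bar>x - y\<bar>" for x y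
          using L(1) by (simp add: right_diff_distrib[symmetric] abs_mult)
        show ?case
          unfolding rhs_def using lo up E1 E2 a[of "c n h1 \<omega>" "E h1"] a[of "c n h2 \<omega>" "E h2"]
          by (simp only: distrib_left mult.left_commute[of L 2])
      qed
      then show ?thesis using h12 by blast
    qed
    then have "good j L B n0" unfolding good_def using L(1) B n0(1) by blast
    then show ?thesis by blast
  qed
  then obtain L B n0 where gd: "\<And>j. good j (L j) (B j) (n0 j)" by metis
  have L: "1 \<le> L j" and B: "B j n \<in> sets (M n)" and Bs: "n0 j \<le> n \<Longrightarrow> measure (M n) (B j n) \<le> (\<epsilon> j)\<^sup>2"
    and ex: "n0 j \<le> n \<Longrightarrow> h \<in> BL1 \<Longrightarrow> \<exists>h1\<in>BL1. \<exists>h2\<in>BL1. AE \<omega> in M n. \<bar>c' n h \<omega> - E' h\<bar> \<le> rhs (\<epsilon> j) (L j) (B j n) n h1 h2 \<omega>"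
    for j n h using gd[of j] unfolding good_def by blast+
  define H where "H j n h = (SOME h12. fst h12 \<in> BL1 \<and> snd h12 \<in> BL1 \<and>
      (AE \<omega> in M n. \<bar>c' n h \<omega> - E' h\<bar> \<le> rhs (\<epsilon> j) (L j) (B j n) n (fst h12) (snd h12) \<omega>))" for j n h
  have H: "fst (H j n h) \<in> BL1 \<and> snd (H j n h) \<in> BL1 \<and>
      (AE \<omega> in M n. \<bar>c' n h \<omega> - E' h\<bar> \<le> rhs (\<epsilon> j) (L j) (B j n) n (fst (H j n h)) (snd (H j n h)) \<omega>)"
    if jn: "n0 j \<le> n" "h \<in> BL1" for j n h
  proof -
    obtain h1 h2 where "h1 \<in> BL1" "h2 \<in> BL1" "AE \<omega> in M n. \<bar>c' n h \<omega> - E' h\<bar> \<le> rhs (\<epsilon> j) (L j) (B j n) n h1 h2 \<omega>"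
      using ex[OF jn] by blast
    then show ?thesis
      unfolding H_def
      by (intro someI[of "\<lambda>h12. fst h12 \<in> BL1 \<and> snd h12 \<in> BL1 \<and>
          (AE \<omega> in M n. \<bar>c' n h \<omega> - E' h\<bar> \<le> rhs (\<epsilon> j) (L j) (B j n) n (fst h12) (snd h12) \<omega>)" "(h1, h2)"]) simp
  qed
  define A where "A n h = {\<omega> \<in> space (F n). \<forall>j. n0 j \<le> n \<longrightarrow>
      \<bar>c' n h \<omega> - E' h\<bar> \<le> rhs (\<epsilon> j) (L j) (B j n) n (fst (H j n h)) (snd (H j n h)) \<omega>}" for n h
  define c'' where "c'' n h \<omega> = (if \<omega> \<in> A n h then c' n h \<omega> else E' h)" for n h \<omega>
  have spF: "space (F n) = space (M n)" for n using M(2)[of n] by (simp add: subalgebra_def)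
  have c'': "cond_outer_exp_version (M n) (F n) (\<lambda>\<omega>. h (G n \<omega> (Y n \<omega>))) (c'' n h)" if h: "h \<in> BL1" for n h
  proof -
    have [measurable]: "c' n h \<in> borel_measurable (F n)" using c'[OF h] by (simp add: cond_outer_exp_version_def)
    have Aj: "{\<omega> \<in> space (F n). n0 j \<le> n \<longrightarrow> \<bar>c' n h \<omega> - E' h\<bar> \<le> rhs (\<epsilon> j) (L j) (B j n) n (fst (H j n h)) (snd (H j n h)) \<omega>} \<in> sets (F n)" for j
    proof (cases "n0 j \<le> n")
      case True
      have [measurable]: "c n (fst (H j n h)) \<in> borel_measurable (F n)" "c n (snd (H j n h)) \<in> borel_measurable (F n)"
        using H[OF True h] c unfolding cond_outer_exp_version_def by blast+
      have [measurable]: "p n (B j n) \<in> borel_measurable (F n)" unfolding p_def by (rule borel_measurable_cond_exp)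
      have [measurable]: "rhs (\<epsilon> j) (L j) (B j n) n (fst (H j n h)) (snd (H j n h)) \<in> borel_measurable (F n)"
        unfolding rhs_def by (intro borel_measurable_add borel_measurable_times borel_measurable_abs
            borel_measurable_diff borel_measurable_const) fact+
      show ?thesis by measurable
    qed simp
    then have A[measurable]: "A n h \<in> sets (F n)" unfolding A_def by (rule sets.sets_Collect_countable_All)
    have "AE \<omega> in M n. \<forall>j. n0 j \<le> n \<longrightarrow> \<bar>c' n h \<omega> - E' h\<bar> \<le> rhs (\<epsilon> j) (L j) (B j n) n (fst (H j n h)) (snd (H j n h)) \<omega>"
      unfolding AE_all_countable
    proof
      fix j
      show "AE \<omega> in M n. n0 j \<le> n \<longrightarrow> \<bar>c' n h \<omega> - E' h\<bar> \<le> rhs (\<epsilon> j) (L j) (B j n) n (fst (H j n h)) (snd (H j n h)) \<omega>"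
        using H[of j n h] h by (cases "n0 j \<le> n") simp_all
    qed
    then have AE: "AE \<omega> in M n. c'' n h \<omega> = c' n h \<omega>"
      using AE_space by eventually_elim (auto simp: c''_def A_def spF)
    have "c'' n h \<in> borel_measurable (F n)" unfolding c''_def by measurable
    moreover obtain u where u: "least_measurable_majorant (M n) (\<lambda>\<omega>. h (G n \<omega> (Y n \<omega>))) u"
        "AE \<omega> in M n. c' n h \<omega> = real_cond_exp (M n) (F n) u \<omega>"
      using c'[OF h, of n] unfolding cond_outer_exp_version_def by blast
    moreover have "AE \<omega> in M n. c'' n h \<omega> = real_cond_exp (M n) (F n) u \<omega>"
      using AE u(2) by eventually_elim simp
    ultimately show ?thesis unfolding cond_outer_exp_version_def by blast
  qed
  have sup: "(SUP h\<in>BL1. ereal \<bar>c'' n h \<omega> - E' h\<bar>) \<le> ereal (8 * \<epsilon> j + 3 * L j * d + 2 * \<bar>p n (B j n) \<omega>\<bar>)"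
    if n: "n0 j \<le> n" and \<omega>: "\<omega> \<in> space (M n)" and d: "\<Delta> n \<omega> \<le> ereal d" for n j \<omega> d
  proof (rule SUP_least)
    fix h :: "real \<Rightarrow> real" assume h: "h \<in> BL1"
    note H = H[OF n h]
    have "ereal \<bar>c n h' \<omega> - E h'\<bar> \<le> ereal d" if "h' \<in> BL1" for h'
      using SUP_upper[OF that, of "\<lambda>h. ereal \<bar>c n h \<omega> - E h\<bar>"] d unfolding \<Delta>_def by (rule order_trans)
    then have d1: "\<bar>c n h' \<omega> - E h'\<bar> \<le> d" if "h' \<in> BL1" for h' using that by simp
    then have d0: "0 \<le> d" using H by (meson abs_ge_zero order_trans)
    show "ereal \<bar>c'' n h \<omega> - E' h\<bar> \<le> ereal (8 * \<epsilon> j + 3 * L j * d + 2 * \<bar>p n (B j n) \<omega>\<bar>)"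
    proof (cases "\<omega> \<in> A n h")
      case True
      then have "\<bar>c'' n h \<omega> - E' h\<bar> \<le> rhs (\<epsilon> j) (L j) (B j n) n (fst (H j n h)) (snd (H j n h)) \<omega>"
        using n by (simp add: c''_def A_def)
      also have "\<dots> \<le> 8 * \<epsilon> j + L j * (d + 2 * d) + 2 * \<bar>p n (B j n) \<omega>\<bar>"
        unfolding rhs_def using H d1 L[of j] by (intro add_mono mult_left_mono order_refl) auto
      finally show ?thesis by (simp add: algebra_simps)
    next
      case False
      then show ?thesis using \<epsilon>(1)[of j] L[of j] d0 by (simp add: c''_def)
    qed
  qed
  have "tendsto_zero_outer_prob M (\<lambda>n \<omega>. SUP h\<in>BL1. ereal \<bar>c'' n h \<omega> - E' h\<bar>)"
    unfolding tendsto_zero_outer_prob_def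
  proof (intro allI impI ennreal_tendsto_zeroI)
    fix e \<tau> :: real assume e: "0 < e" and \<tau>: "0 < \<tau>"
    \<comment> \<open>The first bound makes \<open>8 * \<epsilon> j < e / 4\<close>, the second one bounds \<open>(\<epsilon> j)\<^sup>2 / (e / 8)\<close> by \<open>\<tau> / 2\<close>.\<close>
    define r where "r = min (e / 32) (\<tau> * e / 16)"
    have r: "0 < r" using e \<tau> by (simp add: r_def)
    obtain j where "1 / real (Suc j) < r" using nat_approx_posE[OF r] by blast
    moreover have "\<epsilon> j \<le> 1 / real (Suc j)" unfolding \<epsilon>_def by (intro divide_left_mono) auto
    ultimately have "\<epsilon> j < r" by linarith
    then have j: "\<epsilon> j < e / 32" "\<epsilon> j < \<tau> * e / 16" by (auto simp: r_def)
    define d where "d = e / (24 * L j)"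
    have d: "0 < d" "3 * L j * d = e / 8" using e L[of j] by (auto simp: d_def)
    have "\<forall>\<^sub>F n in sequentially. outer_measure_of (M n) {\<omega> \<in> space (M n). \<Delta> n \<omega> > ereal d} < ennreal (\<tau> / 2)"
      using c0 d(1) \<tau> unfolding tendsto_zero_outer_prob_def \<Delta>_def[symmetric] by (intro order_tendstoD) auto
    then show "\<forall>\<^sub>F n in sequentially. outer_measure_of (M n) {\<omega> \<in> space (M n). ereal e < (SUP h\<in>BL1. ereal \<bar>c'' n h \<omega> - E' h\<bar>)} \<le> ennreal \<tau>"
      using eventually_ge_at_top[of "n0 j"]
    proof eventually_elim
      case (elim n)
      let ?D = "{\<omega> \<in> space (M n). \<Delta> n \<omega> > ereal d}" and ?P = "{\<omega> \<in> space (M n). e / 8 \<le> \<bar>p n (B j n) \<omega>\<bar>}"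
      interpret prob_space "M n" by (rule M)
      have P: "?P \<in> sets (M n)"
      proof -
        have [measurable]: "p n (B j n) \<in> borel_measurable (M n)" unfolding p_def by (rule borel_measurable_cond_exp2)
        show ?thesis by measurable
      qed
      have "{\<omega> \<in> space (M n). ereal e < (SUP h\<in>BL1. ereal \<bar>c'' n h \<omega> - E' h\<bar>)} \<subseteq> ?D \<union> ?P"
      proof (rule subsetI, rule ccontr)
        fix \<omega> assume *: "\<omega> \<in> {\<omega> \<in> space (M n). ereal e < (SUP h\<in>BL1. ereal \<bar>c'' n h \<omega> - E' h\<bar>)}" "\<omega> \<notin> ?D \<union> ?P"
        then have "(SUP h\<in>BL1. ereal \<bar>c'' n h \<omega> - E' h\<bar>) \<le> ereal (8 * \<epsilon> j + 3 * L j * d + 2 * \<bar>p n (B j n) \<omega>\<bar>)"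
          by (intro sup[OF elim(2)]) auto
        also have "\<dots> \<le> ereal e" using * j(1) d(2) e by auto
        finally show False using * by (simp add: not_less[symmetric])
      qed
      then have "outer_measure_of (M n) {\<omega> \<in> space (M n). ereal e < (SUP h\<in>BL1. ereal \<bar>c'' n h \<omega> - E' h\<bar>)}
          \<le> outer_measure_of (M n) ?D + outer_measure_of (M n) ?P"
        by (intro order_trans[OF outer_measure_of_mono outer_measure_of_Un_le]) auto
      also have "\<dots> \<le> ennreal (\<tau> / 2) + ennreal (\<tau> / 2)"
      proof (intro add_mono less_imp_le[OF elim(1)])
        have "measure (M n) ?P \<le> measure (M n) (B j n) / (e / 8)"
          unfolding p_def by (rule real_cond_exp_indicator_tail[OF M B]) (use e in simp)
        also have "\<dots> \<le> (\<epsilon> j)\<^sup>2 / (e / 8)" using Bs[OF elim(2)] e by (intro divide_right_mono) auto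
        also have "\<dots> \<le> \<tau> / 2"
        proof -
          have "(\<epsilon> j)\<^sup>2 \<le> \<epsilon> j * 1" unfolding power2_eq_square using \<epsilon>[of j] by (intro mult_left_mono) auto
          then have "(\<epsilon> j)\<^sup>2 \<le> \<tau> / 2 * (e / 8)" using j(2) by simp
          then show ?thesis using e by (subst pos_divide_le_eq) auto
        qed
        finally show "outer_measure_of (M n) ?P \<le> ennreal (\<tau> / 2)"
          using P by (simp add: emeasure_eq_measure ennreal_leI)
      qed
      also have "\<dots> = ennreal \<tau>" using \<tau> by (simp add: ennreal_plus[symmetric] del: ennreal_plus)
      finally show ?case .
    qed
  qed
  then show ?thesis
    unfolding cond_weakly_converges_def using gm c'' by (auto simp: E'_def intro!: exI[of _ c''])
qed

section \<open>Increments of a differentiable map at scale one over root n\<close>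

lemma scaled_increment_uniform_on_compact:
  fixes \<phi> :: "'b::real_normed_vector \<Rightarrow> 'e::real_normed_vector"
  assumes seq: "\<And>t bs hs h. (\<And>n. t n \<noteq> 0) \<Longrightarrow> (\<And>n. bs n \<in> A) \<Longrightarrow> t \<longlonglongrightarrow> (0::real) \<Longrightarrow> bs \<longlonglongrightarrow> b \<Longrightarrow>
      hs \<longlonglongrightarrow> h \<Longrightarrow> h \<in> S \<Longrightarrow> (\<lambda>n. inverse (t n) *\<^sub>R (\<phi> (bs n + t n *\<^sub>R hs n) - \<phi> (bs n))) \<longlonglongrightarrow> \<phi>' h"
    and cont: "continuous_on S \<phi>'" and K: "compact K" "K \<subseteq> S" and "0 < \<epsilon>"
  obtains \<delta> n0 where "0 < \<delta>" "0 < n0"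
    "\<And>n b' k y. n0 \<le> n \<Longrightarrow> b' \<in> A \<Longrightarrow> dist b' b < \<delta> \<Longrightarrow> k \<in> K \<Longrightarrow> dist y k < \<delta> \<Longrightarrow>
      norm (sqrt (real n) *\<^sub>R (\<phi> (b' + inverse (sqrt (real n)) *\<^sub>R y) - \<phi> b') - \<phi>' k) < \<epsilon>"
proof -
  obtain \<delta> where \<delta>: "0 < \<delta>"
    "\<And>t b' k y. 0 < \<bar>t\<bar> \<Longrightarrow> \<bar>t\<bar> < \<delta> \<Longrightarrow> b' \<in> A \<Longrightarrow> dist b' b < \<delta> \<Longrightarrow> k \<in> K \<Longrightarrow> dist y k < \<delta> \<Longrightarrow>
      norm (inverse t *\<^sub>R (\<phi> (b' + t *\<^sub>R y) - \<phi> b') - \<phi>' k) < \<epsilon>"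
    by (rule difference_quotient_uniform_on_compact[OF seq cont K \<open>0 < \<epsilon>\<close>]) blast+
  have "(\<lambda>n. inverse (sqrt (real n))) \<longlonglongrightarrow> 0"
    by (intro tendsto_inverse_0_at_top filterlim_compose[OF sqrt_at_top] filterlim_real_sequentially)
  then have "\<forall>\<^sub>F n in sequentially. inverse (sqrt (real n)) < \<delta> \<and> 0 < n"
    using order_tendstoD(2)[OF _ \<delta>(1)] eventually_gt_at_top[of 0] by (intro eventually_conj) auto
  then obtain n1 where n1: "\<And>n. n1 \<le> n \<Longrightarrow> inverse (sqrt (real n)) < \<delta> \<and> 0 < n"
    by (auto simp: eventually_sequentially)
  show thesis
  proof (rule that[OF \<delta>(1), of "Suc n1"])
    fix n b' k y assume *: "Suc n1 \<le> n" "b' \<in> A" "dist b' b < \<delta>" "k \<in> K" "dist y k < \<delta>"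
    then have "inverse (sqrt (real n)) < \<delta>" "0 < n" using n1[of n] by auto
    then show "norm (sqrt (real n) *\<^sub>R (\<phi> (b' + inverse (sqrt (real n)) *\<^sub>R y) - \<phi> b') - \<phi>' k) < \<epsilon>"
      using \<delta>(2)[of "inverse (sqrt (real n))" b' k y] * by simp
  qed simp
qed

lemma hadamard_derivative_sequence:
  assumes "hadamard_derivative \<phi> UNIV b S \<phi>'" "\<And>n. t n \<noteq> 0" "\<And>n. bs n \<in> {b}"
    "t \<longlonglongrightarrow> (0::real)" "hs \<longlonglongrightarrow> h" "h \<in> S"
  shows "(\<lambda>n. inverse (t n) *\<^sub>R (\<phi> (bs n + t n *\<^sub>R hs n) - \<phi> (bs n))) \<longlonglongrightarrow> \<phi>' h"
proof -
  have "(\<lambda>n. inverse (t n) *\<^sub>R (\<phi> (b + t n *\<^sub>R hs n) - \<phi> b)) \<longlonglongrightarrow> \<phi>' h"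
    using assms unfolding hadamard_derivative_def by simp
  then show ?thesis using assms(3) by simp
qed

text \<open>The derivative is only continuous on \<open>S\<close>, nothing is known about it elsewhere; it suffices that
  \<open>S\<close> is a Borel set containing all values of \<open>Y\<close>.\<close>

lemma measurable_norm_derivative:
  fixes \<phi>' :: "'b::real_normed_vector \<Rightarrow> 'e::real_normed_vector"
  assumes "continuous_on S \<phi>'" "S \<in> sets borel" "Y \<in> borel_measurable N" "\<And>w. w \<in> space N \<Longrightarrow> Y w \<in> S"
  shows "(\<lambda>w. norm (\<phi>' (Y w))) \<in> borel_measurable N"
proof -
  have "(\<lambda>y. norm (\<phi>' y)) \<in> borel_measurable (restrict_space borel S)"
    by (intro borel_measurable_continuous_on_restrict continuous_on_norm assms)
  moreover have "Y \<in> measurable N (restrict_space borel S)"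
    using assms by (intro measurable_restrict_space2) auto
  ultimately show ?thesis by (rule measurable_compose[rotated])
qed

section \<open>Tail probabilities and quantiles\<close>

definition ramp :: "real \<Rightarrow> real \<Rightarrow> real \<Rightarrow> real" where
  "ramp a b x = max 0 (min 1 ((x - a) / (b - a)))"

lemma ramp_bounds:
  assumes "a < b"
  shows "0 \<le> ramp a b x" "ramp a b x \<le> 1" "x \<le> a \<Longrightarrow> ramp a b x = 0" "b \<le> x \<Longrightarrow> ramp a b x = 1"
    and "\<bar>ramp a b x - ramp a b y\<bar> \<le> 1 / (b - a) * dist x y"
proof -
  show "0 \<le> ramp a b x" "ramp a b x \<le> 1" by (auto simp: ramp_def)
  have "(x - a) / (b - a) \<le> 0" if "x \<le> a" using that assms by (simp add: divide_nonpos_pos)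
  then show "x \<le> a \<Longrightarrow> ramp a b x = 0" by (simp add: ramp_def)
  have "1 \<le> (x - a) / (b - a)" if "b \<le> x" using that assms by (simp add: le_divide_eq)
  then show "b \<le> x \<Longrightarrow> ramp a b x = 1" by (simp add: ramp_def)
  have "\<bar>(x - a) / (b - a) - (y - a) / (b - a)\<bar> = 1 / (b - a) * dist x y"
    using assms by (simp add: diff_divide_distrib[symmetric] dist_real_def)
  then show "\<bar>ramp a b x - ramp a b y\<bar> \<le> 1 / (b - a) * dist x y"
    unfolding ramp_def by linarith
qed

text \<open>One half of the portmanteau theorem for outer probabilities, for sets \<open>A\<close> and \<open>B\<close> that are
  separated by a continuous function \<open>h\<close>.\<close>

lemma weakly_converges_portmanteau:
  fixes T :: "nat \<Rightarrow> 'a \<Rightarrow> real" and h :: "real \<Rightarrow> real"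
  assumes M: "\<And>n. prob_space (M n)" and N: "prob_space N" and conv: "weakly_converges M T N W"
    and h: "continuous_on UNIV h" "\<And>x. 0 \<le> h x" "\<And>x. h x \<le> 1" "\<And>x. x \<in> A \<Longrightarrow> h x = 1" "\<And>x. x \<notin> B \<Longrightarrow> h x = 0"
    and B: "B \<in> sets borel" and "0 < \<epsilon>"
  shows "\<forall>\<^sub>F n in sequentially. outer_measure_of (M n) {\<omega> \<in> space (M n). T n \<omega> \<in> A}
    \<le> ennreal (measure N {w \<in> space N. W w \<in> B} + \<epsilon>)"
proof -
  interpret N: prob_space N by (rule N)
  have [measurable]: "W \<in> borel_measurable N" "B \<in> sets borel" "h \<in> borel_measurable borel"
    using conv B h by (auto simp: weakly_converges_def intro: borel_measurable_continuous_onI)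
  have "bounded (range h)" unfolding bounded_iff using h(2,3) by (auto intro!: exI[of _ 1])
  then have lim: "(\<lambda>n. outer_expectation (M n) (\<lambda>\<omega>. h (T n \<omega>))) \<longlonglongrightarrow> integral\<^sup>L N (\<lambda>w. h (W w))"
    using conv h(1) by (simp add: weakly_converges_def)
  have "integral\<^sup>L N (\<lambda>w. h (W w)) \<le> integral\<^sup>L N (indicator {w \<in> space N. W w \<in> B})"
  proof (rule integral_mono)
    show "integrable N (\<lambda>w. h (W w))"
      by (rule N.integrable_const_bound[where B=1]) (use h in auto)
    show "integrable N (indicat_real {w \<in> space N. W w \<in> B})"
      by (intro integrable_real_indicator) (auto simp: N.emeasure_eq_measure)
    show "h (W w) \<le> indicator {w \<in> space N. W w \<in> B} w" if "w \<in> space N" for w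
      using that h(3,5)[of "W w"] by (auto simp: indicator_def)
  qed
  then have "integral\<^sup>L N (\<lambda>w. h (W w)) < measure N {w \<in> space N. W w \<in> B} + \<epsilon>"
    using \<open>0 < \<epsilon>\<close> by simp
  from order_tendstoD(2)[OF lim this] show ?thesis
  proof eventually_elim
    case (elim n)
    have "outer_measure_of (M n) {\<omega> \<in> space (M n). T n \<omega> \<in> A} \<le> ennreal (outer_expectation (M n) (\<lambda>\<omega>. h (T n \<omega>)))"
      using h by (intro outer_measure_le_outer_expectation[OF M, of _ _ 1]) auto
    also have "\<dots> \<le> ennreal (measure N {w \<in> space N. W w \<in> B} + \<epsilon>)" using elim by (intro ennreal_leI) simp
    finally show ?case .
  qed
qed

lemma weakly_converges_upper_tail:
  fixes T :: "nat \<Rightarrow> 'a \<Rightarrow> real"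
  assumes "\<And>n. prob_space (M n)" "prob_space N" "weakly_converges M T N W" and "a < b" "0 < \<epsilon>"
  shows "\<forall>\<^sub>F n in sequentially. outer_measure_of (M n) {\<omega> \<in> space (M n). b \<le> T n \<omega>}
    \<le> ennreal (measure N {w \<in> space N. a < W w} + \<epsilon>)"
  using weakly_converges_portmanteau[OF assms(1-3), where h="ramp a b" and A="{b..}" and B="{a<..}" and \<epsilon>=\<epsilon>]
    ramp_bounds[OF \<open>a < b\<close>] continuous_on_if_lipschitz[OF ramp_bounds(5)[OF \<open>a < b\<close>]] \<open>0 < \<epsilon>\<close> by simp

lemma weakly_converges_lower_tail:
  fixes T :: "nat \<Rightarrow> 'a \<Rightarrow> real"
  assumes "\<And>n. prob_space (M n)" "prob_space N" "weakly_converges M T N W" and "a < b" "0 < \<epsilon>"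
  shows "\<forall>\<^sub>F n in sequentially. outer_measure_of (M n) {\<omega> \<in> space (M n). T n \<omega> \<le> a}
    \<le> ennreal (measure N {w \<in> space N. W w \<le> b} + \<epsilon>)"
  using weakly_converges_portmanteau[OF assms(1-3), where h="\<lambda>x. 1 - ramp a b x" and A="{..a}" and B="{..b}" and \<epsilon>=\<epsilon>]
    ramp_bounds[OF \<open>a < b\<close>] continuous_on_diff[OF continuous_on_const continuous_on_if_lipschitz[OF ramp_bounds(5)[OF \<open>a < b\<close>]]] \<open>0 < \<epsilon>\<close> by simp

lemma inner_measure_of_neg:
  assumes "prob_space M"
  shows "inner_measure_of M {\<omega> \<in> space M. \<not> P \<omega>} = 1 - outer_measure_of M {\<omega> \<in> space M. P \<omega>}"
proof -
  have "space M - {\<omega> \<in> space M. \<not> P \<omega>} = {\<omega> \<in> space M. P \<omega>}" by auto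
  then show ?thesis using inner_measure_of_eq_compl[OF assms, of "{\<omega> \<in> space M. \<not> P \<omega>}"] by auto
qed

lemma inner_tendsto_1_iff:
  assumes "\<And>n. prob_space (M n)"
  shows "(\<lambda>n. inner_measure_of (M n) {\<omega> \<in> space (M n). \<not> P n \<omega>}) \<longlonglongrightarrow> 1 \<longleftrightarrow>
    (\<lambda>n. outer_measure_of (M n) {\<omega> \<in> space (M n). P n \<omega>}) \<longlonglongrightarrow> 0"
proof -
  have le1: "outer_measure_of (M n) {\<omega> \<in> space (M n). P n \<omega>} \<le> 1" for n
  proof -
    interpret prob_space "M n" by (rule assms)
    show ?thesis using outer_measure_of_mono[of "{\<omega> \<in> space (M n). P n \<omega>}" "space (M n)" "M n"] emeasure_space_1 by auto
  qed
  have "((\<lambda>n. 1 - outer_measure_of (M n) {\<omega> \<in> space (M n). P n \<omega>}) \<longlonglongrightarrow> 1) \<longleftrightarrow>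
    (\<lambda>n. outer_measure_of (M n) {\<omega> \<in> space (M n). P n \<omega>}) \<longlonglongrightarrow> 0" (is "?L \<longleftrightarrow> ?R")
  proof
    assume ?R
    from tendsto_diff_ennreal[OF tendsto_const[of 1] this] show ?L by simp
  next
    assume ?L
    from tendsto_diff_ennreal[OF tendsto_const[of 1] this]
    have "(\<lambda>n. 1 - (1 - outer_measure_of (M n) {\<omega> \<in> space (M n). P n \<omega>})) \<longlonglongrightarrow> 0" by simp
    then show ?R using le1 by (simp add: diff_diff_ennreal'')
  qed
  then show ?thesis by (simp add: inner_measure_of_neg[OF assms])
qed

text \<open>Let \<open>q\<close> be the smallest \<open>p\<close>-quantile. Left of \<open>q\<close> the distribution function is less than
  \<open>p\<close>, and since \<open>q\<close> is not an atom it tends to \<open>p\<close> there. If the distribution function is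
  flat at the level \<open>p\<close>, quantiles are not unique and it really is the smallest one that matters.\<close>

lemma ex_cdf_below_quantile:
  assumes "real_distribution \<mu>" and p: "0 < p" "p < 1" and no_atom: "\<And>t. is_quantile \<mu> p t \<Longrightarrow> measure \<mu> {t} = 0" and "0 < \<eta>"
  obtains s t where "s < t" "p - \<eta> \<le> cdf \<mu> s" "cdf \<mu> t < p"
proof -
  interpret real_distribution \<mu> by fact
  obtain l where l: "cdf \<mu> l < p"
    using order_tendstoD(2)[OF cdf_lim_at_bot p(1)] by (auto simp: eventually_at_bot_linorder)
  obtain u where u: "p < cdf \<mu> u"
    using order_tendstoD(1)[OF cdf_lim_at_top_prob p(2)] by (auto simp: eventually_at_top_linorder)
  define q where "q = Inf {t. p \<le> cdf \<mu> t}"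
  have ne: "{t. p \<le> cdf \<mu> t} \<noteq> {}" using u by (auto intro!: exI[of _ u])
  have bdd: "bdd_below {t. p \<le> cdf \<mu> t}"
  proof (rule bdd_belowI)
    fix t assume "t \<in> {t. p \<le> cdf \<mu> t}"
    then show "l \<le> t" using l cdf_nondecreasing[of t l] by (cases "l \<le> t") auto
  qed
  have below: "cdf \<mu> t < p" if "t < q" for t
    using cInf_lower[OF _ bdd, of t] that unfolding q_def by (metis mem_Collect_eq not_less)
  have above: "p \<le> cdf \<mu> t" if t: "q < t" for t
  proof -
    obtain r where "p \<le> cdf \<mu> r" "r < t" using cInf_lessD[OF ne, of t] t unfolding q_def by auto
    then show ?thesis using cdf_nondecreasing[of r t] by simp
  qed
  have "p \<le> cdf \<mu> q"
  proof (rule tendsto_lowerbound)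
    show "(cdf \<mu> \<longlongrightarrow> cdf \<mu> q) (at_right q)"
      using cdf_is_right_cont[of q] by (simp add: continuous_within)
    show "\<forall>\<^sub>F t in at_right q. p \<le> cdf \<mu> t"
      using above by (auto simp: eventually_at_right_field intro!: exI[of _ "q + 1"])
  qed simp
  have left: "measure \<mu> {..<q} \<le> p"
  proof (rule tendsto_upperbound[OF cdf_at_left])
    show "\<forall>\<^sub>F t in at_left q. cdf \<mu> t \<le> p"
      using below by (auto simp: eventually_at_left_field less_imp_le intro!: exI[of _ "q - 1"])
  qed simp
  have "is_quantile \<mu> p q" using left \<open>p \<le> cdf \<mu> q\<close> by (simp add: is_quantile_def cdf_def)
  then have "measure \<mu> {q} = 0" by (rule no_atom)
  moreover have "measure \<mu> {..q} = measure \<mu> {..<q} + measure \<mu> {q}"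
    by (subst finite_measure_Union[symmetric]) (auto simp: ivl_disj_un_singleton(2)[symmetric] Un_commute)
  ultimately have "p - \<eta> < measure \<mu> {..<q}" using \<open>p \<le> cdf \<mu> q\<close> \<open>0 < \<eta>\<close> by (simp add: cdf_def)
  from order_tendstoD(1)[OF cdf_at_left this] obtain s where "s < q" "p - \<eta> < cdf \<mu> s"
    unfolding eventually_at_left_field by (metis dense)
  moreover obtain t where "s < t" "t < q" using dense[OF \<open>s < q\<close>] by blast
  ultimately show thesis using that[of s t] below[of t] by simp
qed

text \<open>The counterpart for the largest \<open>p\<close>-quantile \<open>q\<close>: right of \<open>q\<close> the distribution function
  exceeds \<open>p\<close>, and by right-continuity and the lack of an atom it tends to \<open>p\<close> there.\<close>

lemma ex_cdf_above_quantile: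
  assumes "real_distribution \<mu>" and p: "0 < p" "p < 1" and no_atom: "\<And>t. is_quantile \<mu> p t \<Longrightarrow> measure \<mu> {t} = 0" and "0 < \<eta>"
  obtains s t where "s < t" "p < cdf \<mu> s" "cdf \<mu> t \<le> p + \<eta>"
proof -
  interpret real_distribution \<mu> by fact
  obtain l where l: "cdf \<mu> l < p"
    using order_tendstoD(2)[OF cdf_lim_at_bot p(1)] by (auto simp: eventually_at_bot_linorder)
  obtain u where u: "p < cdf \<mu> u"
    using order_tendstoD(1)[OF cdf_lim_at_top_prob p(2)] by (auto simp: eventually_at_top_linorder)
  define q where "q = Sup {t. cdf \<mu> t \<le> p}"
  have ne: "{t. cdf \<mu> t \<le> p} \<noteq> {}" using l by (auto intro!: exI[of _ l])
  have bdd: "bdd_above {t. cdf \<mu> t \<le> p}"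
  proof (rule bdd_aboveI)
    fix t assume "t \<in> {t. cdf \<mu> t \<le> p}"
    then show "t \<le> u" using u cdf_nondecreasing[of u t] by (cases "t \<le> u") auto
  qed
  have above: "p < cdf \<mu> t" if "q < t" for t
    using cSup_upper[OF _ bdd, of t] that unfolding q_def by (metis mem_Collect_eq not_less)
  have below: "cdf \<mu> t \<le> p" if t: "t < q" for t
  proof -
    obtain r where "cdf \<mu> r \<le> p" "t < r" using less_cSupD[OF ne, of t] t unfolding q_def by auto
    then show ?thesis using cdf_nondecreasing[of t r] by simp
  qed
  have right: "(cdf \<mu> \<longlongrightarrow> cdf \<mu> q) (at_right q)"
    using cdf_is_right_cont[of q] by (simp add: continuous_within)
  have "p \<le> cdf \<mu> q"
  proof (rule tendsto_lowerbound[OF right])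
    show "\<forall>\<^sub>F t in at_right q. p \<le> cdf \<mu> t"
      using above by (auto simp: eventually_at_right_field less_imp_le intro!: exI[of _ "q + 1"])
  qed simp
  have left: "measure \<mu> {..<q} \<le> p"
  proof (rule tendsto_upperbound[OF cdf_at_left])
    show "\<forall>\<^sub>F t in at_left q. cdf \<mu> t \<le> p"
      using below by (auto simp: eventually_at_left_field intro!: exI[of _ "q - 1"])
  qed simp
  have "is_quantile \<mu> p q" using left \<open>p \<le> cdf \<mu> q\<close> by (simp add: is_quantile_def cdf_def)
  then have "measure \<mu> {q} = 0" by (rule no_atom)
  moreover have "measure \<mu> {..q} = measure \<mu> {..<q} + measure \<mu> {q}"
    by (subst finite_measure_Union[symmetric]) (auto simp: ivl_disj_un_singleton(2)[symmetric] Un_commute)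
  ultimately have "cdf \<mu> q < p + \<eta>" using left \<open>0 < \<eta>\<close> by (simp add: cdf_def)
  from order_tendstoD(2)[OF right this] obtain t where "q < t" "cdf \<mu> t < p + \<eta>"
    unfolding eventually_at_right_field by (metis dense)
  moreover obtain s where "q < s" "s < t" using dense[OF \<open>q < t\<close>] by blast
  ultimately show thesis using that[of s t] above[of s] by simp
qed

section \<open>Conditional laws on the bootstrap space\<close>

lemma prob_space_boot_space:
  assumes "prob_space H" "prob_space Q"
  shows "prob_space (boot_space H Q n)"
proof -
  interpret H: prob_space H by fact
  interpret Q: prob_space Q by fact
  have "prob_space (sample_space H n)" by (intro prob_space_PiM assms)
  then interpret S: prob_space "sample_space H n" .
  interpret pair_prob_space "sample_space H n" Q by unfold_locales
  show ?thesis unfolding boot_space_def by unfold_locales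
qed

lemma subalgebra_sample_algebra: "subalgebra (boot_space H Q n) (sample_algebra H Q n)"
proof -
  have "fst \<in> measurable (boot_space H Q n) (sample_space H n)" unfolding boot_space_def by (rule measurable_fst)
  then show ?thesis
    unfolding subalgebra_def sample_algebra_def
    by (auto simp: sets_vimage_algebra2 measurable_space measurable_sets)
qed

text \<open>By Fubini's theorem, as an event determined by the observations is a set in the first factor times
  the whole second one.\<close>

lemma real_cond_exp_sample_algebra:
  assumes "prob_space H" "prob_space Q" and g: "integrable (boot_space H Q n) g"
  shows "AE \<omega> in boot_space H Q n. real_cond_exp (boot_space H Q n) (sample_algebra H Q n) g \<omega> = (\<integral>z. g (fst \<omega>, z) \<partial>Q)"
proof -
  let ?M = "boot_space H Q n" and ?F = "sample_algebra H Q n" and ?S = "sample_space H n"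
  interpret H: prob_space H by fact
  interpret Q: prob_space Q by fact
  have "prob_space ?S" by (intro prob_space_PiM assms)
  then interpret S: prob_space ?S .
  interpret SQ: pair_prob_space ?S Q by unfold_locales
  interpret prob_space ?M by (rule prob_space_boot_space[OF assms(1,2)])
  interpret sigma_finite_subalgebra ?M ?F
    by (rule sigma_finite_subalgebraI[OF prob_space_boot_space[OF assms(1,2)] subalgebra_sample_algebra])
  have fst_m[measurable]: "fst \<in> measurable ?M ?S" unfolding boot_space_def by (rule measurable_fst)
  have d: "distr ?M ?S fst = ?S" unfolding boot_space_def by (rule Q.distr_pair_fst)
  have gi: "integrable (?S \<Otimes>\<^sub>M Q) g" using g by (simp add: boot_space_def)
  define k where "k x = (\<integral>z. g (x, z) \<partial>Q)" for x
  have ki: "integrable ?S k" unfolding k_def by (rule SQ.integrable_fst'[OF gi])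
  note [measurable] = borel_measurable_integrable[OF ki] borel_measurable_integrable[OF g]
  have kfi: "integrable ?M (\<lambda>\<omega>. k (fst \<omega>))"
  proof -
    have "integrable (distr ?M ?S fst) k" using ki by (simp only: d)
    then show ?thesis by (rule integrable_distr[OF fst_m])
  qed
  have "AE \<omega> in ?M. real_cond_exp ?M ?F g \<omega> = k (fst \<omega>)"
  proof (rule real_cond_exp_charact[OF _ g kfi])
    have "fst \<in> measurable ?F ?S"
      unfolding sample_algebra_def by (rule measurable_vimage_algebra1) (auto simp: boot_space_def space_pair_measure)
    from measurable_compose[OF this borel_measurable_integrable[OF ki]]
    show "(\<lambda>\<omega>. k (fst \<omega>)) \<in> borel_measurable ?F" .
    fix A assume A: "A \<in> sets ?F"
    have "sets ?F = {fst -` B \<inter> space ?M |B. B \<in> sets ?S}"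
      unfolding sample_algebra_def by (rule sets_vimage_algebra2) (auto simp: boot_space_def space_pair_measure)
    then obtain B where B[measurable]: "B \<in> sets ?S" and AB: "A = fst -` B \<inter> space ?M" using A by blast
    have ind: "indicator A \<omega> = (indicator B (fst \<omega>) :: real)" if "\<omega> \<in> space ?M" for \<omega>
      using that by (simp add: AB indicator_def)
    have "(\<integral>\<omega>\<in>A. g \<omega> \<partial>?M) = (\<integral>\<omega>. indicator B (fst \<omega>) * g \<omega> \<partial>?M)"
      unfolding set_lebesgue_integral_def by (intro Bochner_Integration.integral_cong) (auto simp: ind)
    also have "\<dots> = (\<integral>x. (\<integral>z. indicator B (fst (x, z)) * g (x, z) \<partial>Q) \<partial>?S)"
    proof -
      have "integrable ?M (\<lambda>\<omega>. indicator B (fst \<omega>) * g \<omega>)"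
        by (rule Bochner_Integration.integrable_bound[OF g]) (auto simp: indicator_def)
      then show ?thesis unfolding boot_space_def by (subst SQ.integral_fst') auto
    qed
    also have "\<dots> = (\<integral>x. indicator B x * k x \<partial>?S)"
      by (simp add: k_def)
    also have "\<dots> = (\<integral>\<omega>. indicator B (fst \<omega>) * k (fst \<omega>) \<partial>?M)"
      by (subst d[symmetric], subst integral_distr) auto
    also have "\<dots> = (\<integral>\<omega>\<in>A. k (fst \<omega>) \<partial>?M)"
      unfolding set_lebesgue_integral_def by (intro Bochner_Integration.integral_cong) (auto simp: ind)
    finally show "(\<integral>\<omega>\<in>A. g \<omega> \<partial>?M) = (\<integral>\<omega>\<in>A. k (fst \<omega>) \<partial>?M)" .
  qed
  then show ?thesis by (simp add: k_def)
qed

text \<open>The function \<open>f\<close> is measurable in each fibre but not necessarily jointly. Conditioning sees its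
  least jointly measurable majorant, so there is only an inequality. Applied to \<open>f\<close> and \<open>- f\<close>
  it is as good as an equation in the limit.\<close>

lemma fibre_integral_le_cond_outer_exp:
  assumes HQ: "prob_space H" "prob_space Q"
    and c: "cond_outer_exp_version (boot_space H Q n) (sample_algebra H Q n) f c"
    and bd: "\<And>\<omega>. \<omega> \<in> space (boot_space H Q n) \<Longrightarrow> \<bar>f \<omega>\<bar> \<le> C"
    and meas: "\<And>x. x \<in> space (sample_space H n) \<Longrightarrow> (\<lambda>z. f (x, z)) \<in> borel_measurable Q"
  shows "AE \<omega> in boot_space H Q n. (\<integral>z. f (fst \<omega>, z) \<partial>Q) \<le> c \<omega>"
proof -
  let ?M = "boot_space H Q n" and ?S = "sample_space H n"
  interpret H: prob_space H by fact
  interpret Q: prob_space Q by fact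
  have "prob_space ?S" by (intro prob_space_PiM HQ)
  then interpret S: prob_space ?S .
  interpret SQ: pair_prob_space ?S Q by unfold_locales
  have M: "prob_space ?M" by (rule prob_space_boot_space[OF HQ])
  obtain g where g: "least_measurable_majorant ?M f g"
      "AE \<omega> in ?M. c \<omega> = real_cond_exp ?M (sample_algebra H Q n) g \<omega>"
    using c unfolding cond_outer_exp_version_def by blast
  have fg: "\<And>\<omega>. \<omega> \<in> space ?M \<Longrightarrow> f \<omega> \<le> g \<omega>" and gM: "integrable ?M g"
    using least_measurable_majorantD[OF M g(1), of C] bd by blast+
  have gi: "integrable (?S \<Otimes>\<^sub>M Q) g" using gM by (simp add: boot_space_def)
  have "AE x in ?S. integrable Q (\<lambda>z. g (x, z))" by (rule SQ.AE_integrable_fst'[OF gi])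
  then have "AE x in ?S. (\<integral>z. f (x, z) \<partial>Q) \<le> (\<integral>z. g (x, z) \<partial>Q)"
    using AE_space
  proof eventually_elim
    case (elim x)
    have sp: "(x, z) \<in> space ?M" if "z \<in> space Q" for z
      using that elim by (simp add: boot_space_def space_pair_measure)
    have "integrable Q (\<lambda>z. f (x, z))"
      by (rule Q.integrable_const_bound[where B=C]) (use meas[OF elim(2)] bd sp in auto)
    then show ?case using elim(1) fg sp by (intro integral_mono) auto
  qed
  then have "AE x in distr ?M ?S fst. (\<integral>z. f (x, z) \<partial>Q) \<le> (\<integral>z. g (x, z) \<partial>Q)"
    unfolding boot_space_def by (subst Q.distr_pair_fst)
  then have "AE \<omega> in ?M. (\<integral>z. f (fst \<omega>, z) \<partial>Q) \<le> (\<integral>z. g (fst \<omega>, z) \<partial>Q)"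
    by (rule AE_distrD[rotated]) (simp add: boot_space_def)
  with g(2) real_cond_exp_sample_algebra[OF HQ gM] show ?thesis
    by eventually_elim simp
qed

text \<open>Conditional weak convergence is a statement about outer conditional expectations; this is what
  it says about the actual conditional laws, which define the bootstrap quantiles.\<close>

lemma conditional_law_upper_bound:
  fixes T :: "nat \<Rightarrow> (nat \<Rightarrow> 'x) \<times> 'z \<Rightarrow> real" and f :: "real \<Rightarrow> real"
  assumes HQ: "prob_space H" "prob_space Q"
    and conv: "cond_weakly_converges (boot_space H Q) (sample_algebra H Q) T N W"
    and meas: "\<And>n x. 0 < n \<Longrightarrow> x \<in> space (sample_space H n) \<Longrightarrow> (\<lambda>z. T n (x, z)) \<in> borel_measurable Q"
    and f: "\<And>x. \<bar>f x\<bar> \<le> 1" "\<And>x y. \<bar>f x - f y\<bar> \<le> L * dist x y" and "0 < e"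
  shows "(\<lambda>n. outer_measure_of (boot_space H Q n) {\<omega> \<in> space (boot_space H Q n).
      integral\<^sup>L N (\<lambda>w. f (W w)) + e < (\<integral>z. f (T n (fst \<omega>, z)) \<partial>Q)}) \<longlonglongrightarrow> 0"
proof -
  define m where "m = max 1 L"
  have m: "1 \<le> m" "L \<le> m" by (auto simp: m_def)
  define h where "h x = f x / m" for x
  have h: "h \<in> BL1" unfolding h_def by (rule BL1_divide[OF f m(2,1)])
  have fh: "f x = m * h x" for x using m by (simp add: h_def)
  have [measurable]: "h \<in> borel_measurable borel" by (rule BL1_D(3)[OF h])
  obtain c where c: "\<And>n h. h \<in> BL1 \<Longrightarrow> cond_outer_exp_version (boot_space H Q n) (sample_algebra H Q n) (\<lambda>\<omega>. h (T n \<omega>)) (c n h)"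
    and c0: "tendsto_zero_outer_prob (boot_space H Q) (\<lambda>n \<omega>. SUP h\<in>BL1. ereal \<bar>c n h \<omega> - integral\<^sup>L N (\<lambda>w. h (W w))\<bar>)"
    using conv unfolding cond_weakly_converges_def by blast
  define \<Delta> where "\<Delta> n \<omega> = (SUP h\<in>BL1. ereal \<bar>c n h \<omega> - integral\<^sup>L N (\<lambda>w. h (W w))\<bar>)" for n \<omega>
  have "0 < e / m" using \<open>0 < e\<close> m by simp
  then have lim: "(\<lambda>n. outer_measure_of (boot_space H Q n) {\<omega> \<in> space (boot_space H Q n). ereal (e / m) < \<Delta> n \<omega>}) \<longlonglongrightarrow> 0"
    using c0 unfolding tendsto_zero_outer_prob_def \<Delta>_def[symmetric] by blast
  show ?thesis
  proof (rule tendsto_sandwich[OF _ _ tendsto_const lim])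
    show "\<forall>\<^sub>F n in sequentially. outer_measure_of (boot_space H Q n) {\<omega> \<in> space (boot_space H Q n).
      integral\<^sup>L N (\<lambda>w. f (W w)) + e < (\<integral>z. f (T n (fst \<omega>, z)) \<partial>Q)}
      \<le> outer_measure_of (boot_space H Q n) {\<omega> \<in> space (boot_space H Q n). ereal (e / m) < \<Delta> n \<omega>}"
      using eventually_gt_at_top[of 0]
    proof eventually_elim
      case (elim n)
      let ?M = "boot_space H Q n"
      let ?A = "{\<omega> \<in> space ?M. integral\<^sup>L N (\<lambda>w. f (W w)) + e < (\<integral>z. f (T n (fst \<omega>, z)) \<partial>Q)}"
      let ?D = "{\<omega> \<in> space ?M. ereal (e / m) < \<Delta> n \<omega>}"
      have "AE \<omega> in ?M. (\<integral>z. h (T n (fst \<omega>, z)) \<partial>Q) \<le> c n h \<omega>"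
        by (rule fibre_integral_le_cond_outer_exp[OF HQ c[OF h] BL1_D(1)[OF h]])
          (use measurable_compose[OF meas[OF elim] BL1_D(3)[OF h]] in auto)
      then obtain Z where Z: "{\<omega> \<in> space ?M. \<not> (\<integral>z. h (T n (fst \<omega>, z)) \<partial>Q) \<le> c n h \<omega>} \<subseteq> Z" "emeasure ?M Z = 0" "Z \<in> sets ?M"
        by (rule AE_E)
      have "?A \<subseteq> ?D \<union> Z"
      proof (rule subsetI, rule ccontr)
        fix \<omega> assume \<omega>: "\<omega> \<in> ?A" "\<omega> \<notin> ?D \<union> Z"
        then have 1: "(\<integral>z. h (T n (fst \<omega>, z)) \<partial>Q) \<le> c n h \<omega>" using Z(1) by blast
        have "ereal \<bar>c n h \<omega> - integral\<^sup>L N (\<lambda>w. h (W w))\<bar> \<le> \<Delta> n \<omega>"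
          unfolding \<Delta>_def by (rule SUP_upper[OF h])
        also have "\<dots> \<le> ereal (e / m)" using \<omega> by (auto simp: not_less)
        finally have "c n h \<omega> \<le> integral\<^sup>L N (\<lambda>w. h (W w)) + e / m" by simp
        then have "(\<integral>z. h (T n (fst \<omega>, z)) \<partial>Q) \<le> integral\<^sup>L N (\<lambda>w. h (W w)) + e / m" using 1 by simp
        then have "m * (\<integral>z. h (T n (fst \<omega>, z)) \<partial>Q) \<le> m * (integral\<^sup>L N (\<lambda>w. h (W w)) + e / m)"
          using m by (intro mult_left_mono) auto
        also have "\<dots> = m * integral\<^sup>L N (\<lambda>w. h (W w)) + e" using m by (simp add: distrib_left)
        finally show False using \<omega>(1) by (simp add: fh)
      qed
      then have "outer_measure_of ?M ?A \<le> outer_measure_of ?M ?D + outer_measure_of ?M Z"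
        using sets.sets_into_space[OF Z(3)] by (intro order_trans[OF outer_measure_of_mono outer_measure_of_Un_le]) auto
      also have "\<dots> = outer_measure_of ?M ?D" using Z by simp
      finally show ?case .
    qed
  qed simp
qed

text \<open>If the quantile \<open>\<xi>\<close> were less than \<open>a\<close>, the conditional law would give at least mass \<open>p\<close>
  to \<open>{..a}\<close>, whereas the limit law gives strictly less than \<open>p\<close> even to \<open>{..b}\<close>. The gap
  between \<open>a\<close> and \<open>b\<close> leaves room for a Lipschitz function in between.\<close>

lemma cond_quantile_lower_bound:
  fixes T :: "nat \<Rightarrow> (nat \<Rightarrow> 'x) \<times> 'z \<Rightarrow> real"
  assumes HQ: "prob_space H" "prob_space Q" and N: "prob_space N"
    and conv: "cond_weakly_converges (boot_space H Q) (sample_algebra H Q) T N W"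
    and quant: "cond_quantile H Q T p \<xi>" and "a < b" and p: "measure N {w \<in> space N. W w \<le> b} < p"
  shows "(\<lambda>n. outer_measure_of (boot_space H Q n) {\<omega> \<in> space (boot_space H Q n). \<xi> n (fst \<omega>) < a}) \<longlonglongrightarrow> 0"
proof -
  interpret N: prob_space N by (rule N)
  interpret Q: prob_space Q by fact
  have [measurable]: "W \<in> borel_measurable N" using conv by (simp add: cond_weakly_converges_def)
  have meas: "(\<lambda>z. T n (x, z)) \<in> borel_measurable Q"
    and q: "is_quantile (distr Q borel (\<lambda>z. T n (x, z))) p (\<xi> n x)"
    if "0 < n" "x \<in> space (sample_space H n)" for n x
    using quant that unfolding cond_quantile_def by auto
  define f where "f x = 1 - ramp a b x" for x
  have f: "0 \<le> f x" "f x \<le> 1" "x \<le> a \<Longrightarrow> f x = 1" "b \<le> x \<Longrightarrow> f x = 0" "\<bar>f x - f y\<bar> \<le> 1 / (b - a) * dist x y" for x y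
    using ramp_bounds[OF \<open>a < b\<close>, where x=x] ramp_bounds(5)[OF \<open>a < b\<close>, of y x] by (auto simp: f_def dist_commute)
  have f1: "\<bar>f x\<bar> \<le> 1" for x using f(1,2)[of x] by simp
  have [measurable]: "f \<in> borel_measurable borel"
    by (intro borel_measurable_continuous_onI continuous_on_if_lipschitz[OF f(5)])
  have "integral\<^sup>L N (\<lambda>w. f (W w)) \<le> integral\<^sup>L N (indicator {w \<in> space N. W w \<le> b})"
  proof (rule integral_mono)
    show "integrable N (\<lambda>w. f (W w))" by (rule N.integrable_const_bound[where B=1]) (use f1 in auto)
    show "integrable N (indicat_real {w \<in> space N. W w \<le> b})"
      by (intro integrable_real_indicator) (auto simp: N.emeasure_eq_measure)
    show "f (W w) \<le> indicator {w \<in> space N. W w \<le> b} w" if "w \<in> space N" for w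
      using that f(2,4)[of "W w"] by (auto simp: indicator_def)
  qed
  then have EN: "integral\<^sup>L N (\<lambda>w. f (W w)) \<le> measure N {w \<in> space N. W w \<le> b}" by simp
  define e where "e = (p - measure N {w \<in> space N. W w \<le> b}) / 2"
  have e: "0 < e" using p by (simp add: e_def)
  show ?thesis
  proof (rule tendsto_sandwich[OF _ _ tendsto_const conditional_law_upper_bound[OF HQ conv meas f1 f(5) e]])
    show "\<forall>\<^sub>F n in sequentially. outer_measure_of (boot_space H Q n) {\<omega> \<in> space (boot_space H Q n). \<xi> n (fst \<omega>) < a}
      \<le> outer_measure_of (boot_space H Q n) {\<omega> \<in> space (boot_space H Q n).
      integral\<^sup>L N (\<lambda>w. f (W w)) + e < (\<integral>z. f (T n (fst \<omega>, z)) \<partial>Q)}"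
      using eventually_gt_at_top[of 0]
    proof (eventually_elim, intro outer_measure_of_mono subsetI)
      fix n \<omega> assume n: "0 < n" and \<omega>: "\<omega> \<in> {\<omega> \<in> space (boot_space H Q n). \<xi> n (fst \<omega>) < a}"
      then have x: "fst \<omega> \<in> space (sample_space H n)" by (auto simp: boot_space_def space_pair_measure)
      note [measurable] = meas[OF n x]
      have "p \<le> measure (distr Q borel (\<lambda>z. T n (fst \<omega>, z))) {..\<xi> n (fst \<omega>)}"
        using q[OF n x] by (simp add: is_quantile_def)
      also have "\<dots> = measure Q {z \<in> space Q. T n (fst \<omega>, z) \<le> \<xi> n (fst \<omega>)}"
        by (subst measure_distr) (auto intro!: arg_cong[where f="measure Q"])
      also have "\<dots> = integral\<^sup>L Q (indicator {z \<in> space Q. T n (fst \<omega>, z) \<le> \<xi> n (fst \<omega>)})" by simp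
      also have "\<dots> \<le> (\<integral>z. f (T n (fst \<omega>, z)) \<partial>Q)"
      proof (rule integral_mono)
        show "integrable Q (\<lambda>z. f (T n (fst \<omega>, z)))" by (rule Q.integrable_const_bound[where B=1]) (use f1 in auto)
        show "integrable Q (indicat_real {z \<in> space Q. T n (fst \<omega>, z) \<le> \<xi> n (fst \<omega>)})"
          by (intro integrable_real_indicator) (auto simp: Q.emeasure_eq_measure)
        show "indicator {z \<in> space Q. T n (fst \<omega>, z) \<le> \<xi> n (fst \<omega>)} z \<le> f (T n (fst \<omega>, z))" for z
          using \<omega> f(1)[of "T n (fst \<omega>, z)"] f(3)[of "T n (fst \<omega>, z)"] by (auto simp: indicator_def)
      qed
      finally have "p \<le> (\<integral>z. f (T n (fst \<omega>, z)) \<partial>Q)" .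
      moreover have "integral\<^sup>L N (\<lambda>w. f (W w)) + e < p" using EN p by (simp add: e_def field_simps)
      ultimately show "\<omega> \<in> {\<omega> \<in> space (boot_space H Q n). integral\<^sup>L N (\<lambda>w. f (W w)) + e < (\<integral>z. f (T n (fst \<omega>, z)) \<partial>Q)}"
        using \<omega> by auto
    qed
  qed simp
qed

text \<open>Symmetric to the lower bound. The negative of a Lipschitz indicator is used as test function,
  since upper bounds on conditional laws are what is available.\<close>

lemma cond_quantile_upper_bound:
  fixes T :: "nat \<Rightarrow> (nat \<Rightarrow> 'x) \<times> 'z \<Rightarrow> real"
  assumes HQ: "prob_space H" "prob_space Q" and N: "prob_space N"
    and conv: "cond_weakly_converges (boot_space H Q) (sample_algebra H Q) T N W"
    and quant: "cond_quantile H Q T p \<xi>" and "a < b" and p: "p < measure N {w \<in> space N. W w \<le> a}"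
  shows "(\<lambda>n. outer_measure_of (boot_space H Q n) {\<omega> \<in> space (boot_space H Q n). b < \<xi> n (fst \<omega>)}) \<longlonglongrightarrow> 0"
proof -
  interpret N: prob_space N by (rule N)
  interpret Q: prob_space Q by fact
  have [measurable]: "W \<in> borel_measurable N" using conv by (simp add: cond_weakly_converges_def)
  have meas: "(\<lambda>z. T n (x, z)) \<in> borel_measurable Q"
    and q: "is_quantile (distr Q borel (\<lambda>z. T n (x, z))) p (\<xi> n x)"
    if "0 < n" "x \<in> space (sample_space H n)" for n x
    using quant that unfolding cond_quantile_def by auto
  define f where "f x = ramp a b x - 1" for x
  have f: "f x \<le> 0" "- 1 \<le> f x" "x \<le> a \<Longrightarrow> f x = - 1" "b \<le> x \<Longrightarrow> f x = 0" "\<bar>f x - f y\<bar> \<le> 1 / (b - a) * dist x y" for x y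
    using ramp_bounds[OF \<open>a < b\<close>, where x=x] ramp_bounds(5)[OF \<open>a < b\<close>, of x y] by (auto simp: f_def)
  have f1: "\<bar>f x\<bar> \<le> 1" for x using f(1,2)[of x] by simp
  have [measurable]: "f \<in> borel_measurable borel"
    by (intro borel_measurable_continuous_onI continuous_on_if_lipschitz[OF f(5)])
  have "integral\<^sup>L N (\<lambda>w. f (W w)) \<le> integral\<^sup>L N (\<lambda>w. - indicator {w \<in> space N. W w \<le> a} w)"
  proof (rule integral_mono)
    show "integrable N (\<lambda>w. f (W w))" by (rule N.integrable_const_bound[where B=1]) (use f1 in auto)
    show "integrable N (\<lambda>w. - indicat_real {w \<in> space N. W w \<le> a} w)"
      by (intro integrable_minus integrable_real_indicator) (auto simp: N.emeasure_eq_measure)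
    show "f (W w) \<le> - indicator {w \<in> space N. W w \<le> a} w" if "w \<in> space N" for w
      using that f(1,3)[of "W w"] by (auto simp: indicator_def)
  qed
  then have EN: "integral\<^sup>L N (\<lambda>w. f (W w)) \<le> - measure N {w \<in> space N. W w \<le> a}" by simp
  define e where "e = (measure N {w \<in> space N. W w \<le> a} - p) / 2"
  have e: "0 < e" using p by (simp add: e_def)
  show ?thesis
  proof (rule tendsto_sandwich[OF _ _ tendsto_const conditional_law_upper_bound[OF HQ conv meas f1 f(5) e]])
    show "\<forall>\<^sub>F n in sequentially. outer_measure_of (boot_space H Q n) {\<omega> \<in> space (boot_space H Q n). b < \<xi> n (fst \<omega>)}
      \<le> outer_measure_of (boot_space H Q n) {\<omega> \<in> space (boot_space H Q n).
      integral\<^sup>L N (\<lambda>w. f (W w)) + e < (\<integral>z. f (T n (fst \<omega>, z)) \<partial>Q)}"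
      using eventually_gt_at_top[of 0]
    proof (eventually_elim, intro outer_measure_of_mono subsetI)
      fix n \<omega> assume n: "0 < n" and \<omega>: "\<omega> \<in> {\<omega> \<in> space (boot_space H Q n). b < \<xi> n (fst \<omega>)}"
      then have x: "fst \<omega> \<in> space (sample_space H n)" by (auto simp: boot_space_def space_pair_measure)
      note [measurable] = meas[OF n x]
      have "- p \<le> - measure (distr Q borel (\<lambda>z. T n (fst \<omega>, z))) {..<\<xi> n (fst \<omega>)}"
        using q[OF n x] by (simp add: is_quantile_def)
      also have "\<dots> = - measure Q {z \<in> space Q. T n (fst \<omega>, z) < \<xi> n (fst \<omega>)}"
        by (subst measure_distr) (auto intro!: arg_cong[where f="measure Q"])
      also have "\<dots> = integral\<^sup>L Q (\<lambda>z. - indicator {z \<in> space Q. T n (fst \<omega>, z) < \<xi> n (fst \<omega>)} z)" by simp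
      also have "\<dots> \<le> (\<integral>z. f (T n (fst \<omega>, z)) \<partial>Q)"
      proof (rule integral_mono)
        show "integrable Q (\<lambda>z. f (T n (fst \<omega>, z)))" by (rule Q.integrable_const_bound[where B=1]) (use f1 in auto)
        show "integrable Q (\<lambda>z. - indicat_real {z \<in> space Q. T n (fst \<omega>, z) < \<xi> n (fst \<omega>)} z)"
          by (intro integrable_minus integrable_real_indicator) (auto simp: Q.emeasure_eq_measure)
        show "- indicator {z \<in> space Q. T n (fst \<omega>, z) < \<xi> n (fst \<omega>)} z \<le> f (T n (fst \<omega>, z))" if "z \<in> space Q" for z
          using \<omega> that f(2)[of "T n (fst \<omega>, z)"] f(4)[of "T n (fst \<omega>, z)"] by (auto simp: indicator_def)
      qed
      finally have "- p \<le> (\<integral>z. f (T n (fst \<omega>, z)) \<partial>Q)" .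
      moreover have "integral\<^sup>L N (\<lambda>w. f (W w)) + e < - p" using EN p by (simp add: e_def field_simps)
      ultimately show "\<omega> \<in> {\<omega> \<in> space (boot_space H Q n). integral\<^sup>L N (\<lambda>w. f (W w)) + e < (\<integral>z. f (T n (fst \<omega>, z)) \<partial>Q)}"
        using \<omega> by auto
    qed
  qed simp
qed

section \<open>Delta methods\<close>

lemma scaled_norm_bound:
  fixes u v :: "'e::real_normed_vector"
  assumes "0 \<le> r" "norm (r *\<^sub>R u - v) < \<epsilon>"
  shows "\<bar>r * norm u - norm v\<bar> \<le> \<epsilon>"
  using norm_triangle_ineq3[of "r *\<^sub>R u" v] assms by simp

lemma hadamard_derivative_on_subspace:
  assumes "hadamard_derivative \<phi> B b S \<phi>'" "subspace S"
  shows "continuous_on S \<phi>'" and "\<And>x y. x \<in> S \<Longrightarrow> y \<in> S \<Longrightarrow> \<phi>' (x + y) = \<phi>' x + \<phi>' y"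
  using assms by (auto simp: hadamard_derivative_def continuous_linear_on_def span_eq_iff[THEN iffD2])

lemma hadamard_increment_uniform_on_compact:
  fixes \<phi> :: "'b::real_normed_vector \<Rightarrow> 'e::real_normed_vector"
  assumes diff: "hadamard_derivative \<phi> UNIV b S \<phi>'" and S: "subspace S"
    and K: "compact K" "K \<subseteq> S" and "0 < \<epsilon>"
  obtains \<delta> n0 where "0 < \<delta>" "0 < n0"
    "\<And>n k y. n0 \<le> n \<Longrightarrow> k \<in> K \<Longrightarrow> dist y k < \<delta> \<Longrightarrow>
      norm (sqrt (real n) *\<^sub>R (\<phi> (b + inverse (sqrt (real n)) *\<^sub>R y) - \<phi> b) - \<phi>' k) < \<epsilon>"
proof (rule scaled_increment_uniform_on_compact[where A="{b}" and b=b and S=S and \<phi>=\<phi> and \<phi>'=\<phi>' and K=K and \<epsilon>=\<epsilon>])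
  show "(\<lambda>n. inverse (t n) *\<^sub>R (\<phi> (bs n + t n *\<^sub>R hs n) - \<phi> (bs n))) \<longlonglongrightarrow> \<phi>' h"
    if "\<And>n. t n \<noteq> 0" "\<And>n. bs n \<in> {b}" "t \<longlonglongrightarrow> (0::real)" "hs \<longlonglongrightarrow> h" "h \<in> S" for t bs hs h
    by (rule hadamard_derivative_sequence[OF diff that])
  show "continuous_on S \<phi>'" by (rule hadamard_derivative_on_subspace(1)[OF diff S])
  fix \<delta> n0 assume "0 < \<delta>" "0 < n0" and *: "\<And>n b' k y. n0 \<le> n \<Longrightarrow> b' \<in> {b} \<Longrightarrow> dist b' b < \<delta> \<Longrightarrow> k \<in> K \<Longrightarrow> dist y k < \<delta> \<Longrightarrow>
      norm (sqrt (real n) *\<^sub>R (\<phi> (b' + inverse (sqrt (real n)) *\<^sub>R y) - \<phi> b') - \<phi>' k) < \<epsilon>"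
  show thesis
  proof (rule that[OF \<open>0 < \<delta>\<close> \<open>0 < n0\<close>])
    fix n k y assume "n0 \<le> n" "k \<in> K" "dist y k < \<delta>"
    then show "norm (sqrt (real n) *\<^sub>R (\<phi> (b + inverse (sqrt (real n)) *\<^sub>R y) - \<phi> b) - \<phi>' k) < \<epsilon>"
      using *[of n b k y] \<open>0 < \<delta>\<close> by simp
  qed
qed (rule K \<open>0 < \<epsilon>\<close>)+

text \<open>The base point \<open>b\<close> is deterministic here, so that Hadamard differentiability at \<open>b\<close> is just what
  \<open>weakly_converges_mapping\<close> asks of the increments.\<close>

theorem delta_method_norm:
  fixes Y :: "nat \<Rightarrow> 'a \<Rightarrow> 'b::real_normed_vector" and \<phi> :: "'b \<Rightarrow> 'e::real_normed_vector"
  assumes M: "\<And>n. prob_space (M n)" and N: "prob_space N"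
    and diff: "hadamard_derivative \<phi> UNIV b S \<phi>'" and S: "subspace S" "S \<in> sets borel"
    and Y0: "tight_random_element N Y0" "\<And>w. w \<in> space N \<Longrightarrow> Y0 w \<in> S"
    and conv: "weakly_converges M Y N Y0"
  shows "weakly_converges M (\<lambda>n \<omega>. sqrt (real n) * norm (\<phi> (b + inverse (sqrt (real n)) *\<^sub>R Y n \<omega>) - \<phi> b))
    N (\<lambda>w. norm (\<phi>' (Y0 w)))"
proof (rule weakly_converges_mapping[OF M N conv, where S=S and g="\<lambda>y. norm (\<phi>' y)"
      and G="\<lambda>n y. sqrt (real n) * norm (\<phi> (b + inverse (sqrt (real n)) *\<^sub>R y) - \<phi> b)"])
  note cont = hadamard_derivative_on_subspace(1)[OF diff S(1)]
  show "continuous_on S (\<lambda>y. norm (\<phi>' y))" by (intro continuous_on_norm cont)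
  show "(\<lambda>w. norm (\<phi>' (Y0 w))) \<in> borel_measurable N"
    using Y0 by (intro measurable_norm_derivative[OF cont S(2)]) (auto simp: tight_random_element_def)
  show "\<exists>K. compact K \<and> K \<subseteq> S \<and> measure N {w \<in> space N. Y0 w \<notin> K} \<le> \<epsilon>" if "0 < \<epsilon>" for \<epsilon>
    using tight_random_element_compact_in[OF N Y0(1) S(2) Y0(2) that] by metis
  fix K and \<epsilon> :: real assume K: "compact K" "K \<subseteq> S" and \<epsilon>: "0 < \<epsilon>"
  obtain \<delta> n0 where \<delta>: "0 < \<delta>" and "0 < n0" and n0:
    "\<And>n k y. n0 \<le> n \<Longrightarrow> k \<in> K \<Longrightarrow> dist y k < \<delta> \<Longrightarrow>
      norm (sqrt (real n) *\<^sub>R (\<phi> (b + inverse (sqrt (real n)) *\<^sub>R y) - \<phi> b) - \<phi>' k) < \<epsilon>"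
    by (rule hadamard_increment_uniform_on_compact[OF diff S(1) K \<epsilon>]) blast
  have "\<forall>\<^sub>F n in sequentially. \<forall>k\<in>K. \<forall>y. dist y k < \<delta> \<longrightarrow>
      \<bar>sqrt (real n) * norm (\<phi> (b + inverse (sqrt (real n)) *\<^sub>R y) - \<phi> b) - norm (\<phi>' k)\<bar> \<le> \<epsilon>"
    using eventually_ge_at_top[of n0]
  proof (eventually_elim, intro ballI allI impI scaled_norm_bound)
    fix n k y assume "n0 \<le> n" "k \<in> K" "dist y k < \<delta>"
    then show "norm (sqrt (real n) *\<^sub>R (\<phi> (b + inverse (sqrt (real n)) *\<^sub>R y) - \<phi> b) - \<phi>' k) < \<epsilon>"
      using n0[of n k y] by simp
  qed simp
  then show "\<exists>\<delta>>0. \<forall>\<^sub>F n in sequentially. \<forall>k\<in>K. \<forall>y. dist y k < \<delta> \<longrightarrow>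
      \<bar>sqrt (real n) * norm (\<phi> (b + inverse (sqrt (real n)) *\<^sub>R y) - \<phi> b) - norm (\<phi>' k)\<bar> \<le> \<epsilon>"
    using \<delta> by blast
qed

text \<open>The common consequence of the two alternative assumptions on the random base points \<open>\<rho> n\<close>:
  outside an event \<open>B n\<close> of small probability, increments starting from \<open>\<rho> n\<close> behave like the
  derivative \<open>\<phi>'\<close> near compact sets of directions.\<close>

definition increments_approximated ::
  "(nat \<Rightarrow> 'a measure) \<Rightarrow> (nat \<Rightarrow> 'a \<Rightarrow> 'b::real_normed_vector) \<Rightarrow> ('b \<Rightarrow> 'e::real_normed_vector) \<Rightarrow> 'b set \<Rightarrow> ('b \<Rightarrow> 'e) \<Rightarrow> bool"
where
  "increments_approximated M \<rho> \<phi> S \<phi>' \<longleftrightarrow>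
    (\<forall>K \<epsilon> \<eta>. compact K \<and> K \<subseteq> S \<and> 0 < \<epsilon> \<and> 0 < \<eta> \<longrightarrow>
      (\<exists>\<delta>>0. \<exists>B. (\<forall>n. B n \<in> sets (M n)) \<and> (\<forall>\<^sub>F n in sequentially. measure (M n) (B n) \<le> \<eta> \<and>
        (\<forall>\<omega>\<in>space (M n) - B n. \<forall>k\<in>K. \<forall>y. dist y k < \<delta> \<longrightarrow>
          norm (sqrt (real n) *\<^sub>R (\<phi> (\<rho> n \<omega> + inverse (sqrt (real n)) *\<^sub>R y) - \<phi> (\<rho> n \<omega>)) - \<phi>' k) < \<epsilon>))))"

theorem cond_delta_method_norm:
  fixes Y :: "nat \<Rightarrow> 'a \<Rightarrow> 'b::real_normed_vector" and \<phi> :: "'b \<Rightarrow> 'e::real_normed_vector"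
  assumes M: "\<And>n. prob_space (M n)" "\<And>n. subalgebra (M n) (F n)" and N: "prob_space N"
    and approx: "increments_approximated M \<rho> \<phi> S \<phi>'"
    and cont: "continuous_on S \<phi>'" and S: "S \<in> sets borel"
    and Y0: "tight_random_element N Y0" "\<And>w. w \<in> space N \<Longrightarrow> Y0 w \<in> S"
    and conv: "cond_weakly_converges M F Y N Y0"
  shows "cond_weakly_converges M F
    (\<lambda>n \<omega>. sqrt (real n) * norm (\<phi> (\<rho> n \<omega> + inverse (sqrt (real n)) *\<^sub>R Y n \<omega>) - \<phi> (\<rho> n \<omega>)))
    N (\<lambda>w. norm (\<phi>' (Y0 w)))"
proof (rule cond_weakly_converges_mapping[OF M N conv, where S=S and g="\<lambda>y. norm (\<phi>' y)"
      and G="\<lambda>n \<omega> y. sqrt (real n) * norm (\<phi> (\<rho> n \<omega> + inverse (sqrt (real n)) *\<^sub>R y) - \<phi> (\<rho> n \<omega>))"])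
  show "continuous_on S (\<lambda>y. norm (\<phi>' y))" by (intro continuous_on_norm cont)
  show "(\<lambda>w. norm (\<phi>' (Y0 w))) \<in> borel_measurable N"
    using Y0 by (intro measurable_norm_derivative[OF cont S]) (auto simp: tight_random_element_def)
  show "\<exists>K. compact K \<and> K \<subseteq> S \<and> measure N {w \<in> space N. Y0 w \<notin> K} \<le> \<epsilon>" if "0 < \<epsilon>" for \<epsilon>
    using tight_random_element_compact_in[OF N Y0(1) S Y0(2) that] by metis
  fix K and \<epsilon> \<eta> :: real assume K: "compact K" "K \<subseteq> S" and \<epsilon>: "0 < \<epsilon>" "0 < \<eta>"
  then obtain \<delta> B where \<delta>: "0 < \<delta>" "\<And>n. B n \<in> sets (M n)" and ev: "\<forall>\<^sub>F n in sequentially. measure (M n) (B n) \<le> \<eta> \<and>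
        (\<forall>\<omega>\<in>space (M n) - B n. \<forall>k\<in>K. \<forall>y. dist y k < \<delta> \<longrightarrow>
          norm (sqrt (real n) *\<^sub>R (\<phi> (\<rho> n \<omega> + inverse (sqrt (real n)) *\<^sub>R y) - \<phi> (\<rho> n \<omega>)) - \<phi>' k) < \<epsilon>)"
    using approx unfolding increments_approximated_def by blast
  from ev have "\<forall>\<^sub>F n in sequentially. measure (M n) (B n) \<le> \<eta> \<and>
        (\<forall>\<omega>\<in>space (M n) - B n. \<forall>k\<in>K. \<forall>y. dist y k < \<delta> \<longrightarrow>
          \<bar>sqrt (real n) * norm (\<phi> (\<rho> n \<omega> + inverse (sqrt (real n)) *\<^sub>R y) - \<phi> (\<rho> n \<omega>)) - norm (\<phi>' k)\<bar> \<le> \<epsilon>)"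
    by eventually_elim (auto intro!: scaled_norm_bound)
  with \<delta> show "\<exists>\<delta>>0. \<exists>B. (\<forall>n. B n \<in> sets (M n)) \<and> (\<forall>\<^sub>F n in sequentially. measure (M n) (B n) \<le> \<eta> \<and>
        (\<forall>\<omega>\<in>space (M n) - B n. \<forall>k\<in>K. \<forall>y. dist y k < \<delta> \<longrightarrow>
          \<bar>sqrt (real n) * norm (\<phi> (\<rho> n \<omega> + inverse (sqrt (real n)) *\<^sub>R y) - \<phi> (\<rho> n \<omega>)) - norm (\<phi>' k)\<bar> \<le> \<epsilon>))"
    by blast
qed

lemma ex_measurable_covers:
  assumes "\<And>n. A n \<subseteq> space (M n)"
  obtains B where "\<And>n. B n \<in> sets (M n)" "\<And>n. A n \<subseteq> B n" "\<And>n. emeasure (M n) (B n) = outer_measure_of (M n) (A n)"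
proof -
  have "\<forall>n. \<exists>E. E \<in> sets (M n) \<and> A n \<subseteq> E \<and> emeasure (M n) E = outer_measure_of (M n) (A n)"
    using outer_measure_of_attain[OF assms] by metis
  from choice[OF this] show thesis using that by blast
qed

text \<open>Uniform differentiability treats all base points near \<open>b\<close> alike, so that the exceptional event
  only has to contain the samples with \<open>\<rho> n\<close> far from \<open>b\<close>.\<close>

lemma increments_approximated_uniformly:
  fixes \<rho> :: "nat \<Rightarrow> 'a \<Rightarrow> 'b::real_normed_vector" and \<phi> :: "'b \<Rightarrow> 'e::real_normed_vector"
  assumes M: "\<And>n. prob_space (M n)"
    and diff: "uniformly_hadamard_derivative \<phi> UNIV b S \<phi>'" and cont: "continuous_on S \<phi>'"
    and \<rho>: "tendsto_zero_outer_prob M (\<lambda>n \<omega>. ereal (dist (\<rho> n \<omega>) b))"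
  shows "increments_approximated M \<rho> \<phi> S \<phi>'"
  unfolding increments_approximated_def
proof (intro allI impI, elim conjE, goal_cases)
  case (1 K \<epsilon> \<eta>)
  note K = 1(1,2) and \<epsilon> = 1(3) and \<eta> = 1(4)
  have seq: "(\<lambda>n. inverse (t n) *\<^sub>R (\<phi> (bs n + t n *\<^sub>R hs n) - \<phi> (bs n))) \<longlonglongrightarrow> \<phi>' h"
    if "\<And>n. t n \<noteq> 0" "\<And>n. bs n \<in> UNIV" "t \<longlonglongrightarrow> (0::real)" "bs \<longlonglongrightarrow> b" "hs \<longlonglongrightarrow> h" "h \<in> S" for t bs hs h
    using diff that unfolding uniformly_hadamard_derivative_def by simp
  obtain \<delta> n0 where \<delta>: "0 < \<delta>" and n0:
    "\<And>n b' k y. n0 \<le> n \<Longrightarrow> b' \<in> UNIV \<Longrightarrow> dist b' b < \<delta> \<Longrightarrow> k \<in> K \<Longrightarrow> dist y k < \<delta> \<Longrightarrow>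
      norm (sqrt (real n) *\<^sub>R (\<phi> (b' + inverse (sqrt (real n)) *\<^sub>R y) - \<phi> b') - \<phi>' k) < \<epsilon>"
    by (rule scaled_increment_uniform_on_compact[OF seq cont K \<epsilon>]) blast+
  define A where "A n = {\<omega> \<in> space (M n). ereal (\<delta> / 2) < ereal (dist (\<rho> n \<omega>) b)}" for n
  obtain B where B: "\<And>n. B n \<in> sets (M n)" "\<And>n. A n \<subseteq> B n" "\<And>n. emeasure (M n) (B n) = outer_measure_of (M n) (A n)"
    by (rule ex_measurable_covers[of A M]) (auto simp: A_def)
  have "(\<lambda>n. outer_measure_of (M n) (A n)) \<longlonglongrightarrow> 0"
    using \<rho> \<delta> unfolding tendsto_zero_outer_prob_def A_def by (meson half_gt_zero)
  from order_tendstoD(2)[OF this, of "ennreal \<eta>"] have "\<forall>\<^sub>F n in sequentially. outer_measure_of (M n) (A n) < ennreal \<eta>"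
    using \<eta> by simp
  then have "\<forall>\<^sub>F n in sequentially. measure (M n) (B n) \<le> \<eta> \<and>
        (\<forall>\<omega>\<in>space (M n) - B n. \<forall>k\<in>K. \<forall>y. dist y k < \<delta> \<longrightarrow>
          norm (sqrt (real n) *\<^sub>R (\<phi> (\<rho> n \<omega> + inverse (sqrt (real n)) *\<^sub>R y) - \<phi> (\<rho> n \<omega>)) - \<phi>' k) < \<epsilon>)"
    using eventually_ge_at_top[of n0]
  proof eventually_elim
    case (elim n)
    interpret prob_space "M n" by (rule M)
    have "ennreal (measure (M n) (B n)) < ennreal \<eta>" using elim(1) B(3)[of n] by (simp add: emeasure_eq_measure)
    then have "measure (M n) (B n) \<le> \<eta>" by (simp add: ennreal_less_iff)
    moreover have "dist (\<rho> n \<omega>) b < \<delta>" if "\<omega> \<in> space (M n) - B n" for \<omega>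
    proof -
      have "\<omega> \<notin> A n" using that B(2)[of n] by blast
      then have "dist (\<rho> n \<omega>) b \<le> \<delta> / 2" using that by (auto simp: A_def)
      then show ?thesis using \<delta> by simp
    qed
    ultimately show ?case using n0[OF elim(2)] by blast
  qed
  then show ?case
    using \<delta> B(1) by blast
qed

text \<open>With \<open>Z = sqrt n (\<rho> n - b)\<close>, the increment from \<open>\<rho> n\<close> in direction \<open>y\<close> is the increment
  from \<open>b\<close> in direction \<open>Z + y\<close> minus the one in direction \<open>Z\<close>. If \<open>Z\<close> is close to \<open>l\<close> in a
  compact set \<open>L\<close> and \<open>y\<close> is close to \<open>k \<in> K\<close>, these are approximately \<open>\<phi>' (k + l)\<close> and
  \<open>\<phi>' l\<close>. The directions \<open>k + l\<close> and \<open>l\<close> range over a compact subset of \<open>S\<close>, as \<open>S\<close> is a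
  linear space, and the difference is \<open>\<phi>' k\<close> by linearity.\<close>

lemma increments_approximated_tight:
  fixes \<rho> :: "nat \<Rightarrow> 'a \<Rightarrow> 'b::real_normed_vector" and \<phi> :: "'b \<Rightarrow> 'e::real_normed_vector"
  assumes M: "\<And>n. prob_space (M n)"
    and diff: "hadamard_derivative \<phi> UNIV b S \<phi>'" and S: "subspace S"
    and tight: "asymptotically_tight_in S M (\<lambda>n \<omega>. sqrt (real n) *\<^sub>R (\<rho> n \<omega> - b))"
  shows "increments_approximated M \<rho> \<phi> S \<phi>'"
  unfolding increments_approximated_def
proof (intro allI impI, elim conjE, goal_cases)
  case (1 K \<epsilon> \<eta>)
  note K = 1(1,2) and \<epsilon> = 1(3) and \<eta> = 1(4)
  note add = hadamard_derivative_on_subspace(2)[OF diff S]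
  define Z where "Z n \<omega> = sqrt (real n) *\<^sub>R (\<rho> n \<omega> - b)" for n \<omega>
  \<comment> \<open>For \<open>\<eta> \<ge> 2\<close> the numbers \<open>1 - \<eta>\<close> and \<open>1 - \<eta> / 2\<close> both vanish as extended nonnegative reals.\<close>
  define \<eta>' where "\<eta>' = min \<eta> (1/2)"
  have \<eta>': "0 < \<eta>'" "\<eta>' \<le> \<eta>" "\<eta>' < 1" using \<eta> by (auto simp: \<eta>'_def)
  then have "0 < \<eta>' / 2" by simp
  with tight obtain L where L: "compact L" "L \<subseteq> S" and lim: "\<And>\<delta>. 0 < \<delta> \<Longrightarrow>
     ennreal (1 - \<eta>' / 2) \<le> liminf (\<lambda>n. inner_measure_of (M n) {\<omega> \<in> space (M n). Z n \<omega> \<in> (\<Union>k\<in>L. ball k \<delta>)})"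
    unfolding asymptotically_tight_in_def Z_def by meson
  define KL where "KL = {k + l | k l. k \<in> K \<and> l \<in> L} \<union> L"
  have KL: "compact KL" "KL \<subseteq> S"
    using compact_sums[OF K(1) L(1)] L K subspace_add[OF S] unfolding KL_def by auto
  have \<epsilon>2: "0 < \<epsilon> / 2" using \<epsilon> by simp
  obtain \<delta> n0 where \<delta>: "0 < \<delta>" and n0pos: "0 < n0" and n0:
    "\<And>n k y. n0 \<le> n \<Longrightarrow> k \<in> KL \<Longrightarrow> dist y k < \<delta> \<Longrightarrow>
      norm (sqrt (real n) *\<^sub>R (\<phi> (b + inverse (sqrt (real n)) *\<^sub>R y) - \<phi> b) - \<phi>' k) < \<epsilon> / 2"
    by (rule hadamard_increment_uniform_on_compact[OF diff S KL \<epsilon>2]) blast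
  define A where "A n = {\<omega> \<in> space (M n). Z n \<omega> \<notin> (\<Union>k\<in>L. ball k (\<delta> / 2))}" for n
  obtain B where B: "\<And>n. B n \<in> sets (M n)" "\<And>n. A n \<subseteq> B n" "\<And>n. emeasure (M n) (B n) = outer_measure_of (M n) (A n)"
    by (rule ex_measurable_covers[of A M]) (auto simp: A_def)
  have "ennreal (1 - \<eta>') < ennreal (1 - \<eta>' / 2)" using \<eta>' by (intro ennreal_lessI) auto
  also have "\<dots> \<le> liminf (\<lambda>n. inner_measure_of (M n) {\<omega> \<in> space (M n). Z n \<omega> \<in> (\<Union>k\<in>L. ball k (\<delta> / 2))})"
    using \<delta> by (intro lim) simp
  finally have "\<forall>\<^sub>F n in sequentially. ennreal (1 - \<eta>') < inner_measure_of (M n) {\<omega> \<in> space (M n). Z n \<omega> \<in> (\<Union>k\<in>L. ball k (\<delta> / 2))}"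
    by (rule less_LiminfD)
  then have "\<forall>\<^sub>F n in sequentially. measure (M n) (B n) \<le> \<eta> \<and>
        (\<forall>\<omega>\<in>space (M n) - B n. \<forall>k\<in>K. \<forall>y. dist y k < \<delta> / 2 \<longrightarrow>
          norm (sqrt (real n) *\<^sub>R (\<phi> (\<rho> n \<omega> + inverse (sqrt (real n)) *\<^sub>R y) - \<phi> (\<rho> n \<omega>)) - \<phi>' k) < \<epsilon>)"
    using eventually_ge_at_top[of n0]
  proof eventually_elim
    case (elim n)
    interpret prob_space "M n" by (rule M)
    have "inner_measure_of (M n) {\<omega> \<in> space (M n). Z n \<omega> \<in> (\<Union>k\<in>L. ball k (\<delta> / 2))} = 1 - emeasure (M n) (B n)"
      using inner_measure_of_neg[OF M, where P="\<lambda>\<omega>. Z n \<omega> \<notin> (\<Union>k\<in>L. ball k (\<delta> / 2))"] B(3)[of n] by (simp add: A_def)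
    also have "\<dots> = ennreal (1 - measure (M n) (B n))"
      by (simp add: emeasure_eq_measure ennreal_minus ennreal_1[symmetric] del: ennreal_1)
    finally have "ennreal (1 - \<eta>') < ennreal (1 - measure (M n) (B n))" using elim(1) by simp
    then have "measure (M n) (B n) < \<eta>'" using \<eta>' by (subst (asm) ennreal_less_iff) auto
    then have "measure (M n) (B n) \<le> \<eta>" using \<eta>' by simp
    moreover have "norm (sqrt (real n) *\<^sub>R (\<phi> (\<rho> n \<omega> + inverse (sqrt (real n)) *\<^sub>R y) - \<phi> (\<rho> n \<omega>)) - \<phi>' k) < \<epsilon>"
      if \<omega>: "\<omega> \<in> space (M n) - B n" and k: "k \<in> K" "dist y k < \<delta> / 2" for \<omega> k y
    proof -
      have "\<omega> \<notin> A n" using \<omega> B(2)[of n] by blast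
      then obtain l where l: "l \<in> L" "dist (Z n \<omega>) l < \<delta> / 2" using \<omega> by (auto simp: A_def dist_commute)
      let ?r = "sqrt (real n)"
      have r: "0 < ?r" using elim(2) n0pos by simp
      have \<rho>: "b + inverse ?r *\<^sub>R Z n \<omega> = \<rho> n \<omega>" using r by (simp add: Z_def)
      have \<rho>y: "b + inverse ?r *\<^sub>R (Z n \<omega> + y) = \<rho> n \<omega> + inverse ?r *\<^sub>R y"
        using \<rho> by (simp add: scaleR_add_right add.assoc[symmetric])
      have 1: "norm (?r *\<^sub>R (\<phi> (\<rho> n \<omega>) - \<phi> b) - \<phi>' l) < \<epsilon> / 2"
        using n0[OF elim(2), of l "Z n \<omega>"] \<delta> l by (simp add: \<rho> KL_def)
      have "dist (Z n \<omega> + y) (k + l) \<le> dist (Z n \<omega>) l + dist y k"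
        by (metis add.commute dist_triangle_add)
      then have "dist (Z n \<omega> + y) (k + l) < \<delta>" using l k by linarith
      moreover have "k + l \<in> KL" using k l by (auto simp: KL_def)
      ultimately have 2: "norm (?r *\<^sub>R (\<phi> (\<rho> n \<omega> + inverse ?r *\<^sub>R y) - \<phi> b) - \<phi>' (k + l)) < \<epsilon> / 2"
        using n0[OF elim(2), of "k + l" "Z n \<omega> + y"] \<delta> by (simp only: \<rho>y)
      have "\<phi>' (k + l) = \<phi>' k + \<phi>' l" using k l K L by (intro add) auto
      then have eq: "?r *\<^sub>R (\<phi> (\<rho> n \<omega> + inverse ?r *\<^sub>R y) - \<phi> (\<rho> n \<omega>)) - \<phi>' k =
        (?r *\<^sub>R (\<phi> (\<rho> n \<omega> + inverse ?r *\<^sub>R y) - \<phi> b) - \<phi>' (k + l)) - (?r *\<^sub>R (\<phi> (\<rho> n \<omega>) - \<phi> b) - \<phi>' l)"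
        by (simp add: scaleR_diff_right)
      show ?thesis
        unfolding eq using norm_triangle_ineq4[of "?r *\<^sub>R (\<phi> (\<rho> n \<omega> + inverse ?r *\<^sub>R y) - \<phi> b) - \<phi>' (k + l)"
            "?r *\<^sub>R (\<phi> (\<rho> n \<omega>) - \<phi> b) - \<phi>' l"] 1 2 by linarith
    qed
    ultimately show ?case by blast
  qed
  moreover have "0 < \<delta> / 2" using \<delta> by simp
  ultimately show ?case
    using B(1) by blast
qed

section \<open>Level and power of the bootstrap test\<close>

lemma law_on_reals:
  assumes "prob_space N" "W \<in> borel_measurable N"
  shows "real_distribution (distr N borel W)" and "cdf (distr N borel W) t = measure N {w \<in> space N. W w \<le> t}"
proof -
  interpret prob_space N by fact
  show "real_distribution (distr N borel W)" using assms(2) by (rule real_distribution_distr)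
  show "cdf (distr N borel W) t = measure N {w \<in> space N. W w \<le> t}"
    using assms(2) unfolding cdf_def by (subst measure_distr) (auto intro!: arg_cong[where f="measure N"])
qed

lemma ex_large_cdf:
  fixes W :: "'p \<Rightarrow> real"
  assumes "prob_space N" "W \<in> borel_measurable N" "p < 1"
  obtains t where "p < measure N {w \<in> space N. W w \<le> t}"
proof -
  interpret real_distribution "distr N borel W" by (rule law_on_reals(1)[OF assms(1,2)])
  obtain t where "p < cdf (distr N borel W) t"
    using order_tendstoD(1)[OF cdf_lim_at_top_prob assms(3)] by (auto simp: eventually_at_top_linorder)
  then show thesis using that law_on_reals(2)[OF assms(1,2)] by metis
qed

text \<open>A weakly convergent sequence is bounded in probability, hence of smaller order than \<open>sqrt n\<close>.\<close>

lemma diverges_weakly_if_dominates: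
  fixes W :: "nat \<Rightarrow> 'a \<Rightarrow> real"
  assumes M: "\<And>n. prob_space (M n)" and N: "prob_space N" and conv: "weakly_converges M W N W0"
    and "0 < c" and dom: "\<And>n \<omega>. sqrt (real n) * c \<le> T n \<omega> + W n \<omega>"
  shows "diverges_weakly M T"
  unfolding diverges_weakly_def
proof
  fix t
  interpret N: prob_space N by (rule N)
  have W0[measurable]: "W0 \<in> borel_measurable N" using conv by (simp add: weakly_converges_def)
  have "(\<lambda>n. outer_measure_of (M n) {\<omega> \<in> space (M n). T n \<omega> \<le> t}) \<longlonglongrightarrow> 0"
  proof (rule ennreal_tendsto_zeroI)
    fix \<tau> :: real assume \<tau>: "0 < \<tau>"
    obtain s where s: "1 - \<tau> / 2 < measure N {w \<in> space N. W0 w \<le> s}"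
      by (rule ex_large_cdf[OF N W0, of "1 - \<tau> / 2"]) (use \<tau> in auto)
    have "{w \<in> space N. s < W0 w} = space N - {w \<in> space N. W0 w \<le> s}" by auto
    then have "measure N {w \<in> space N. s < W0 w} = 1 - measure N {w \<in> space N. W0 w \<le> s}"
      by (simp add: N.prob_compl)
    then have s': "measure N {w \<in> space N. s < W0 w} \<le> \<tau> / 2" using s by simp
    have "filterlim (\<lambda>n. sqrt (real n) * c) at_top sequentially"
      by (intro filterlim_at_top_mult_tendsto_pos[OF tendsto_const \<open>0 < c\<close>] filterlim_compose[OF sqrt_at_top]
          filterlim_real_sequentially)
    then have "\<forall>\<^sub>F n in sequentially. t + (s + 1) \<le> sqrt (real n) * c"
      by (simp add: filterlim_at_top)
    moreover have "\<forall>\<^sub>F n in sequentially. outer_measure_of (M n) {\<omega> \<in> space (M n). s + 1 \<le> W n \<omega>}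
        \<le> ennreal (measure N {w \<in> space N. s < W0 w} + \<tau> / 2)"
      by (rule weakly_converges_upper_tail[OF M N conv]) (use \<tau> in auto)
    ultimately show "\<forall>\<^sub>F n in sequentially. outer_measure_of (M n) {\<omega> \<in> space (M n). T n \<omega> \<le> t} \<le> ennreal \<tau>"
    proof eventually_elim
      case (elim n)
      have "outer_measure_of (M n) {\<omega> \<in> space (M n). T n \<omega> \<le> t} \<le> outer_measure_of (M n) {\<omega> \<in> space (M n). s + 1 \<le> W n \<omega>}"
      proof (rule outer_measure_of_mono, rule subsetI)
        fix \<omega> assume "\<omega> \<in> {\<omega> \<in> space (M n). T n \<omega> \<le> t}"
        then show "\<omega> \<in> {\<omega> \<in> space (M n). s + 1 \<le> W n \<omega>}" using dom[of n \<omega>] elim(1) by simp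
      qed
      also note elim(2)
      also have "ennreal (measure N {w \<in> space N. s < W0 w} + \<tau> / 2) \<le> ennreal \<tau>"
        using s' by (intro ennreal_leI) simp
      finally show ?case .
    qed
  qed
  then show "(\<lambda>n. inner_measure_of (M n) {\<omega> \<in> space (M n). t < T n \<omega>}) \<longlonglongrightarrow> 1"
    using inner_tendsto_1_iff[where M=M, OF M, where P="\<lambda>n \<omega>. T n \<omega> \<le> t"] by (simp add: not_le)
qed

lemma inner_measure_of_le_outer: "inner_measure_of M A \<le> outer_measure_of M A"
  unfolding inner_measure_of_def
  by (rule SUP_least) (metis (no_types, lifting) mem_Collect_eq outer_measure_of_eq outer_measure_of_mono)

lemma ennreal_tendstoI:
  fixes f :: "nat \<Rightarrow> ennreal"
  assumes "0 < a" and "\<And>\<tau>. 0 < \<tau> \<Longrightarrow> \<forall>\<^sub>F n in sequentially. f n \<le> ennreal (a + \<tau>)"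
    and "\<And>\<tau>. 0 < \<tau> \<Longrightarrow> \<forall>\<^sub>F n in sequentially. ennreal (a - \<tau>) \<le> f n"
  shows "f \<longlonglongrightarrow> ennreal a"
proof (rule order_tendstoI)
  fix y assume y: "y < ennreal a"
  then obtain r where r: "y = ennreal r" "0 \<le> r" by (cases y) auto
  then have "r < a" using y \<open>0 < a\<close> by (simp add: ennreal_less_iff)
  then have "0 < (a - r) / 2" "ennreal r < ennreal (a - (a - r) / 2)"
    using r by (auto simp: ennreal_less_iff field_simps)
  then show "\<forall>\<^sub>F n in sequentially. y < f n"
    using assms(3)[of "(a - r) / 2"] r by (auto elim!: eventually_mono order.strict_trans2)
next
  fix y assume y: "ennreal a < y"
  then obtain z where z: "ennreal a < z" "z < y" using dense by blast
  then obtain r where r: "z = ennreal r" "0 \<le> r" by (cases z) (auto simp: top.not_eq_extremum)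
  then have "a < r" using z \<open>0 < a\<close> by (simp add: ennreal_less_iff)
  then show "\<forall>\<^sub>F n in sequentially. f n < y"
    using assms(2)[of "r - a"] r z(2) by (auto elim!: eventually_mono order.strict_trans1)
qed

lemma bootstrap_test_power:
  fixes T Ts :: "nat \<Rightarrow> (nat \<Rightarrow> 'x) \<times> 'z \<Rightarrow> real"
  assumes HQ: "prob_space H" "prob_space Q" and N: "prob_space N"
    and T: "diverges_weakly (boot_space H Q) T"
    and Ts: "cond_weakly_converges (boot_space H Q) (sample_algebra H Q) Ts N W"
    and quant: "cond_quantile H Q Ts p \<xi>" and p: "p < 1"
  shows "(\<lambda>n. inner_measure_of (boot_space H Q n) {\<omega> \<in> space (boot_space H Q n). \<xi> n (fst \<omega>) < T n \<omega>}) \<longlonglongrightarrow> 1"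
proof -
  note M = prob_space_boot_space[OF HQ]
  have W: "W \<in> borel_measurable N" using Ts by (simp add: cond_weakly_converges_def)
  obtain a where a: "p < measure N {w \<in> space N. W w \<le> a}" by (rule ex_large_cdf[OF N W p])
  let ?X = "\<lambda>n. {\<omega> \<in> space (boot_space H Q n). a + 1 < \<xi> n (fst \<omega>)}"
  let ?T = "\<lambda>n. {\<omega> \<in> space (boot_space H Q n). T n \<omega> \<le> a + 1}"
  have "(\<lambda>n. outer_measure_of (boot_space H Q n) (?X n)) \<longlonglongrightarrow> 0"
    by (rule cond_quantile_upper_bound[OF HQ N Ts quant _ a]) simp
  moreover have "(\<lambda>n. outer_measure_of (boot_space H Q n) (?T n)) \<longlonglongrightarrow> 0"
    using T inner_tendsto_1_iff[where M="boot_space H Q", OF M, where P="\<lambda>n \<omega>. T n \<omega> \<le> a + 1"] unfolding diverges_weakly_def by (simp add: not_le)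
  ultimately have lim: "(\<lambda>n. outer_measure_of (boot_space H Q n) (?X n) + outer_measure_of (boot_space H Q n) (?T n)) \<longlonglongrightarrow> 0"
    using tendsto_add[of _ "0::ennreal" _ _ 0] by fastforce
  have "(\<lambda>n. outer_measure_of (boot_space H Q n) {\<omega> \<in> space (boot_space H Q n). T n \<omega> \<le> \<xi> n (fst \<omega>)}) \<longlonglongrightarrow> 0"
  proof (rule tendsto_sandwich[OF _ _ tendsto_const lim])
    show "\<forall>\<^sub>F n in sequentially. outer_measure_of (boot_space H Q n) {\<omega> \<in> space (boot_space H Q n). T n \<omega> \<le> \<xi> n (fst \<omega>)}
      \<le> outer_measure_of (boot_space H Q n) (?X n) + outer_measure_of (boot_space H Q n) (?T n)"
      by (intro always_eventually allI order_trans[OF outer_measure_of_mono outer_measure_of_Un_le]) auto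
  qed simp
  then show ?thesis
    using inner_tendsto_1_iff[where M="boot_space H Q", OF M, where P="\<lambda>n \<omega>. T n \<omega> \<le> \<xi> n (fst \<omega>)"] by (simp add: not_le)
qed

text \<open>Up to small probability, \<open>\<xi> n \<le> T n\<close> implies \<open>r \<le> T n\<close> for some level \<open>r\<close> just below the
  smallest quantile of the limit law, and is implied by \<open>r < T n\<close> for some level just above the
  largest one. Both events have asymptotic probability close to \<open>\<alpha>\<close>. The bound from above is
  for outer and the one from below for inner probability, so both have the limit \<open>\<alpha>\<close>.\<close>

lemma bootstrap_test_level:
  fixes T Ts :: "nat \<Rightarrow> (nat \<Rightarrow> 'x) \<times> 'z \<Rightarrow> real"
  assumes HQ: "prob_space H" "prob_space Q" and N: "prob_space N1" "prob_space N2"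
    and T: "weakly_converges (boot_space H Q) T N1 W1"
    and Ts: "cond_weakly_converges (boot_space H Q) (sample_algebra H Q) Ts N2 W2"
    and same: "distr N2 borel W2 = distr N1 borel W1"
    and quant: "cond_quantile H Q Ts (1 - \<alpha>) \<xi>" and \<alpha>: "0 < \<alpha>" "\<alpha> < 1"
    and no_atom: "\<And>t. is_quantile (distr N1 borel W1) (1 - \<alpha>) t \<Longrightarrow> measure N1 {w \<in> space N1. W1 w = t} = 0"
  shows "(\<lambda>n. outer_measure_of (boot_space H Q n) {\<omega> \<in> space (boot_space H Q n). \<xi> n (fst \<omega>) \<le> T n \<omega>}) \<longlonglongrightarrow> ennreal \<alpha>"
    and "(\<lambda>n. inner_measure_of (boot_space H Q n) {\<omega> \<in> space (boot_space H Q n). \<xi> n (fst \<omega>) \<le> T n \<omega>}) \<longlonglongrightarrow> ennreal \<alpha>"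
proof -
  note M = prob_space_boot_space[OF HQ]
  interpret N1: prob_space N1 by (rule N)
  have W[measurable]: "W1 \<in> borel_measurable N1" "W2 \<in> borel_measurable N2"
    using T Ts by (simp_all add: weakly_converges_def cond_weakly_converges_def)
  define \<mu> where "\<mu> = distr N1 borel W1"
  have \<mu>: "real_distribution \<mu>" unfolding \<mu>_def by (rule law_on_reals(1)[OF N(1) W(1)])
  have F1: "cdf \<mu> t = measure N1 {w \<in> space N1. W1 w \<le> t}" for t
    unfolding \<mu>_def by (rule law_on_reals(2)[OF N(1) W(1)])
  have F2: "cdf \<mu> t = measure N2 {w \<in> space N2. W2 w \<le> t}" for t
    unfolding \<mu>_def same[symmetric] by (rule law_on_reals(2)[OF N(2) W(2)])
  have atom: "measure \<mu> {t} = 0" if "is_quantile \<mu> (1 - \<alpha>) t" for t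
  proof -
    have "measure \<mu> {t} = measure N1 {w \<in> space N1. W1 w = t}"
      unfolding \<mu>_def by (subst measure_distr) (auto intro!: arg_cong[where f="measure N1"])
    then show ?thesis using no_atom that by (simp add: \<mu>_def)
  qed
  have p: "0 < 1 - \<alpha>" "1 - \<alpha> < 1" using \<alpha> by auto
  let ?M = "boot_space H Q"
  let ?R = "\<lambda>n. {\<omega> \<in> space (?M n). \<xi> n (fst \<omega>) \<le> T n \<omega>}"
  have up: "\<forall>\<^sub>F n in sequentially. outer_measure_of (?M n) (?R n) \<le> ennreal (\<alpha> + \<tau>)" if \<tau>: "0 < \<tau>" for \<tau>
  proof -
    have \<tau>3: "0 < \<tau> / 3" using \<tau> by simp
    obtain s t where st: "s < t" "1 - \<alpha> - \<tau> / 3 \<le> cdf \<mu> s" "cdf \<mu> t < 1 - \<alpha>"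
      by (rule ex_cdf_below_quantile[OF \<mu> p atom \<tau>3])
    define r where "r = (s + t) / 2"
    have r: "s < r" "r < t" using st by (auto simp: r_def)
    have "(\<lambda>n. outer_measure_of (?M n) {\<omega> \<in> space (?M n). \<xi> n (fst \<omega>) < r}) \<longlonglongrightarrow> 0"
      using st(3) by (intro cond_quantile_lower_bound[OF HQ N(2) Ts quant r(2)]) (simp add: F2)
    from order_tendstoD(2)[OF this, of "ennreal (\<tau> / 3)"]
    have "\<forall>\<^sub>F n in sequentially. outer_measure_of (?M n) {\<omega> \<in> space (?M n). \<xi> n (fst \<omega>) < r} < ennreal (\<tau> / 3)"
      using \<tau>3 by simp
    moreover have "\<forall>\<^sub>F n in sequentially. outer_measure_of (?M n) {\<omega> \<in> space (?M n). r \<le> T n \<omega>}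
        \<le> ennreal (measure N1 {w \<in> space N1. s < W1 w} + \<tau> / 3)"
      by (rule weakly_converges_upper_tail[OF M N(1) T r(1) \<tau>3])
    ultimately show ?thesis
    proof eventually_elim
      case (elim n)
      have "{w \<in> space N1. s < W1 w} = space N1 - {w \<in> space N1. W1 w \<le> s}" by auto
      then have "measure N1 {w \<in> space N1. s < W1 w} = 1 - cdf \<mu> s"
        by (simp add: N1.prob_compl F1)
      then have le: "measure N1 {w \<in> space N1. s < W1 w} + \<tau> / 3 \<le> \<alpha> + \<tau> / 3 + \<tau> / 3" using st(2) by simp
      have "outer_measure_of (?M n) (?R n) \<le> outer_measure_of (?M n) {\<omega> \<in> space (?M n). \<xi> n (fst \<omega>) < r}
          + outer_measure_of (?M n) {\<omega> \<in> space (?M n). r \<le> T n \<omega>}"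
        by (intro order_trans[OF outer_measure_of_mono outer_measure_of_Un_le]) auto
      also have "\<dots> \<le> ennreal (\<tau> / 3) + ennreal (\<alpha> + \<tau> / 3 + \<tau> / 3)"
        by (intro add_mono less_imp_le[OF elim(1)] order_trans[OF elim(2)] ennreal_leI le)
      also have "\<dots> = ennreal (\<alpha> + \<tau>)" using \<tau> \<alpha> by (subst ennreal_plus[symmetric]) auto
      finally show ?case .
    qed
  qed
  have lo: "\<forall>\<^sub>F n in sequentially. ennreal (\<alpha> - \<tau>) \<le> inner_measure_of (?M n) (?R n)" if \<tau>: "0 < \<tau>" for \<tau>
  proof -
    have \<tau>3: "0 < \<tau> / 3" using \<tau> by simp
    obtain s t where st: "s < t" "1 - \<alpha> < cdf \<mu> s" "cdf \<mu> t \<le> 1 - \<alpha> + \<tau> / 3"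
      by (rule ex_cdf_above_quantile[OF \<mu> p atom \<tau>3])
    define r where "r = (s + t) / 2"
    have r: "s < r" "r < t" using st by (auto simp: r_def)
    have "(\<lambda>n. outer_measure_of (?M n) {\<omega> \<in> space (?M n). r < \<xi> n (fst \<omega>)}) \<longlonglongrightarrow> 0"
      using st(2) by (intro cond_quantile_upper_bound[OF HQ N(2) Ts quant r(1)]) (simp add: F2)
    from order_tendstoD(2)[OF this, of "ennreal (\<tau> / 3)"]
    have "\<forall>\<^sub>F n in sequentially. outer_measure_of (?M n) {\<omega> \<in> space (?M n). r < \<xi> n (fst \<omega>)} < ennreal (\<tau> / 3)"
      using \<tau>3 by simp
    moreover have "\<forall>\<^sub>F n in sequentially. outer_measure_of (?M n) {\<omega> \<in> space (?M n). T n \<omega> \<le> r}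
        \<le> ennreal (measure N1 {w \<in> space N1. W1 w \<le> t} + \<tau> / 3)"
      by (rule weakly_converges_lower_tail[OF M N(1) T r(2) \<tau>3])
    ultimately show ?thesis
    proof eventually_elim
      case (elim n)
      have le: "measure N1 {w \<in> space N1. W1 w \<le> t} + \<tau> / 3 \<le> 1 - \<alpha> + \<tau> / 3 + \<tau> / 3" using st(3) by (simp add: F1)
      have "outer_measure_of (?M n) {\<omega> \<in> space (?M n). \<not> \<xi> n (fst \<omega>) \<le> T n \<omega>}
          \<le> outer_measure_of (?M n) {\<omega> \<in> space (?M n). r < \<xi> n (fst \<omega>)}
          + outer_measure_of (?M n) {\<omega> \<in> space (?M n). T n \<omega> \<le> r}"
        by (intro order_trans[OF outer_measure_of_mono outer_measure_of_Un_le]) auto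
      also have "\<dots> \<le> ennreal (\<tau> / 3) + ennreal (1 - \<alpha> + \<tau> / 3 + \<tau> / 3)"
        by (intro add_mono less_imp_le[OF elim(1)] order_trans[OF elim(2)] ennreal_leI le)
      also have "\<dots> = ennreal (1 - \<alpha> + \<tau>)" using \<tau> \<alpha> by (subst ennreal_plus[symmetric]) auto
      finally have "1 - ennreal (1 - \<alpha> + \<tau>) \<le> 1 - outer_measure_of (?M n) {\<omega> \<in> space (?M n). \<not> \<xi> n (fst \<omega>) \<le> T n \<omega>}"
        by (rule ennreal_minus_mono[OF order_refl])
      also have "\<dots> = inner_measure_of (?M n) (?R n)"
        using inner_measure_of_neg[OF M, where P="\<lambda>\<omega>. \<not> \<xi> n (fst \<omega>) \<le> T n \<omega>"] by simp
      also have "1 - ennreal (1 - \<alpha> + \<tau>) = ennreal (\<alpha> - \<tau>)"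
        using \<alpha> \<tau> by (subst ennreal_1[symmetric], subst ennreal_minus) auto
      finally show ?case .
    qed
  qed
  show "(\<lambda>n. outer_measure_of (?M n) (?R n)) \<longlonglongrightarrow> ennreal \<alpha>"
  proof (rule ennreal_tendstoI[OF \<alpha>(1) up])
    show "\<forall>\<^sub>F n in sequentially. ennreal (\<alpha> - \<tau>) \<le> outer_measure_of (?M n) (?R n)" if "0 < \<tau>" for \<tau>
      using lo[OF that] by eventually_elim (rule order_trans[OF _ inner_measure_of_le_outer])
  qed
  show "(\<lambda>n. inner_measure_of (?M n) (?R n)) \<longlonglongrightarrow> ennreal \<alpha>"
  proof (rule ennreal_tendstoI[OF \<alpha>(1) _ lo])
    show "\<forall>\<^sub>F n in sequentially. inner_measure_of (?M n) (?R n) \<le> ennreal (\<alpha> + \<tau>)" if "0 < \<tau>" for \<tau>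
      using up[OF that] by eventually_elim (rule order_trans[OF inner_measure_of_le_outer])
  qed
qed

text \<open>The two limit theorems are the delta methods, with the normalized errors scaled back by
  \<open>inverse (sqrt n)\<close>. At \<open>n = 0\<close> this does not give the statistic's argument, but then the
  statistics vanish.\<close>

theorem theorem3p1:
  fixes H :: "'x measure" and Q :: "'z measure"
    and \<iota> :: "'x measure \<Rightarrow> 'd::real_normed_vector"
    and \<phi> :: "'d \<times> (real ^ 'k) \<Rightarrow> 'e::real_normed_vector"
    and R :: "nat \<Rightarrow> (nat \<Rightarrow> 'x) \<Rightarrow> 'x measure"
    and Xs :: "nat \<Rightarrow> nat \<Rightarrow> (nat \<Rightarrow> 'x) \<times> 'z \<Rightarrow> 'x"
    and \<theta>hat :: "nat \<Rightarrow> (nat \<Rightarrow> 'x) \<Rightarrow> real ^ 'k"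
    and \<theta>s :: "nat \<Rightarrow> (nat \<Rightarrow> 'x) \<Rightarrow> (nat \<Rightarrow> 'x) \<Rightarrow> real ^ 'k"
    and \<theta> :: "'d \<Rightarrow> real ^ 'k" and RH :: 'd and D0 :: "'d set"
    and \<phi>H \<phi>RH :: "'d \<times> (real ^ 'k) \<Rightarrow> 'e"
    and N1 :: "'p measure" and GH :: "'p \<Rightarrow> 'd" and UH :: "'p \<Rightarrow> real ^ 'k"
    and N2 :: "'q measure" and GR :: "'q \<Rightarrow> 'd" and VR :: "'q \<Rightarrow> real ^ 'k"
  assumes scheme: "bootstrap_scheme H Q R Xs"
    and embedding: "inj_on \<iota> {P. prob_space P \<and> sets P = sets H}"
    and D0: "subspace D0" "D0 \<times> (UNIV :: (real ^ 'k) set) \<in> sets borel"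
    and diff_H: "hadamard_derivative \<phi> UNIV (\<iota> H, \<theta> (\<iota> H)) (D0 \<times> UNIV) \<phi>H"
    and diff_RH: "hadamard_derivative \<phi> UNIV (RH, \<theta> RH) (D0 \<times> UNIV) \<phi>RH"
    and limits: "prob_space N1" "tight_random_element N1 (\<lambda>w. (GH w, UH w))"
      "\<forall>w\<in>space N1. GH w \<in> D0"
      "prob_space N2" "tight_random_element N2 (\<lambda>w. (GR w, VR w))"
      "\<forall>w\<in>space N2. GR w \<in> D0"
    and B1: "weakly_converges (boot_space H Q)
      (\<lambda>n \<omega>. sqrt (real n) *\<^sub>R
         (\<iota> (empirical H n (fst \<omega>)) - \<iota> H, \<theta>hat n (fst \<omega>) - \<theta> (\<iota> H)))
      N1 (\<lambda>w. (GH w, UH w))"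
    and B2: "cond_weakly_converges (boot_space H Q) (sample_algebra H Q)
      (\<lambda>n \<omega>. sqrt (real n) *\<^sub>R
         (\<iota> (empirical H n (boot_sample Xs n \<omega>)) - \<iota> (R n (fst \<omega>)),
          \<theta>s n (boot_sample Xs n \<omega>) (fst \<omega>) - \<theta>hat n (fst \<omega>)))
      N2 (\<lambda>w. (GR w, VR w))"
    and B3_or_relaxed:
      "(\<theta> RH = \<theta> (\<iota> H) \<and>
        asymptotically_tight_in (D0 \<times> UNIV) (boot_space H Q)
          (\<lambda>n \<omega>. sqrt (real n) *\<^sub>R (\<iota> (R n (fst \<omega>)) - RH, \<theta>hat n (fst \<omega>) - \<theta> (\<iota> H))))
       \<or>
       (uniformly_hadamard_derivative \<phi> UNIV (RH, \<theta> RH) (D0 \<times> UNIV) \<phi>RH \<and>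
        tendsto_zero_outer_prob (boot_space H Q)
          (\<lambda>n \<omega>. ereal (dist (\<iota> (R n (fst \<omega>)), \<theta>hat n (fst \<omega>)) (RH, \<theta> RH))))"
  shows
    "(\<phi> (\<iota> H, \<theta> (\<iota> H)) = 0 \<longrightarrow>
        weakly_converges (boot_space H Q) (test_stat \<phi> \<iota> H \<theta>hat)
          N1 (\<lambda>w. norm (\<phi>H (GH w, UH w))))
     \<and> (\<phi> (\<iota> H, \<theta> (\<iota> H)) \<noteq> 0 \<longrightarrow>
        diverges_weakly (boot_space H Q) (test_stat \<phi> \<iota> H \<theta>hat))
     \<and> cond_weakly_converges (boot_space H Q) (sample_algebra H Q)
        (boot_stat \<phi> \<iota> H \<theta>hat \<theta>s R Xs) N2 (\<lambda>w. norm (\<phi>RH (GR w, VR w)))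
     \<and> (\<forall>\<alpha> \<xi>. 0 < \<alpha> \<and> \<alpha> < 1 \<and>
          (\<forall>t. is_quantile (distr N1 borel (\<lambda>w. norm (\<phi>H (GH w, UH w)))) (1 - \<alpha>) t \<longrightarrow>
               measure N1 {w \<in> space N1. norm (\<phi>H (GH w, UH w)) = t} = 0) \<and>
          cond_quantile H Q (boot_stat \<phi> \<iota> H \<theta>hat \<theta>s R Xs) (1 - \<alpha>) \<xi> \<longrightarrow>
          (\<phi> (\<iota> H, \<theta> (\<iota> H)) = 0 \<and>
           distr N2 borel (\<lambda>w. norm (\<phi>RH (GR w, VR w))) =
           distr N1 borel (\<lambda>w. norm (\<phi>H (GH w, UH w))) \<longrightarrow>
             (\<lambda>n. outer_measure_of (boot_space H Q n)
                {\<omega> \<in> space (boot_space H Q n). test_stat \<phi> \<iota> H \<theta>hat n \<omega> \<ge> \<xi> n (fst \<omega>)})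
               \<longlonglongrightarrow> ennreal \<alpha> \<and>
             (\<lambda>n. inner_measure_of (boot_space H Q n)
                {\<omega> \<in> space (boot_space H Q n). test_stat \<phi> \<iota> H \<theta>hat n \<omega> \<ge> \<xi> n (fst \<omega>)})
               \<longlonglongrightarrow> ennreal \<alpha>)
          \<and> (\<phi> (\<iota> H, \<theta> (\<iota> H)) \<noteq> 0 \<longrightarrow>
             (\<lambda>n. inner_measure_of (boot_space H Q n)
                {\<omega> \<in> space (boot_space H Q n). test_stat \<phi> \<iota> H \<theta>hat n \<omega> > \<xi> n (fst \<omega>)})
               \<longlonglongrightarrow> 1))"
proof -
  let ?M = "boot_space H Q" and ?F = "sample_algebra H Q"
  let ?b = "(\<iota> H, \<theta> (\<iota> H))" and ?b' = "(RH, \<theta> RH)" and ?S = "D0 \<times> (UNIV :: (real ^ 'k) set)"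
  let ?T = "test_stat \<phi> \<iota> H \<theta>hat :: nat \<Rightarrow> (nat \<Rightarrow> 'x) \<times> 'z \<Rightarrow> real"
  let ?Ts = "boot_stat \<phi> \<iota> H \<theta>hat \<theta>s R Xs"
  let ?W1 = "\<lambda>w. norm (\<phi>H (GH w, UH w))" and ?W2 = "\<lambda>w. norm (\<phi>RH (GR w, VR w))"
  have HQ: "prob_space H" "prob_space Q" using scheme by (auto simp: bootstrap_scheme_def)
  note M = prob_space_boot_space[OF HQ]
  have S: "subspace ?S" using D0(1) by (rule subspace_Times) (rule subspace_UNIV)
  define W where "W n \<omega> = sqrt (real n) * norm (\<phi> (\<iota> (empirical H n (fst \<omega>)), \<theta>hat n (fst \<omega>)) - \<phi> ?b)"
    for n and \<omega> :: "(nat \<Rightarrow> 'x) \<times> 'z"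
  have unscale: "sqrt (real n) * norm (\<phi> (c + inverse (sqrt (real n)) *\<^sub>R sqrt (real n) *\<^sub>R (d - c)) - \<phi> c)
      = sqrt (real n) * norm (\<phi> d - \<phi> c)" for n c d
    by (cases "n = 0") simp_all
  have "weakly_converges ?M (\<lambda>n \<omega>. sqrt (real n) * norm (\<phi> (?b + inverse (sqrt (real n)) *\<^sub>R sqrt (real n) *\<^sub>R
         (\<iota> (empirical H n (fst \<omega>)) - \<iota> H, \<theta>hat n (fst \<omega>) - \<theta> (\<iota> H))) - \<phi> ?b)) N1 ?W1"
    by (rule delta_method_norm[OF M limits(1) diff_H S D0(2) limits(2) _ B1]) (use limits(3) in auto)
  then have W: "weakly_converges ?M W N1 ?W1"
    unfolding W_def diff_Pair[symmetric] unscale .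
  have T: "weakly_converges ?M ?T N1 ?W1" if "\<phi> ?b = 0"
  proof -
    have "?T = W" using that by (intro ext) (simp add: test_stat_def W_def)
    then show ?thesis using W by simp
  qed
  have Tdiv: "diverges_weakly ?M ?T" if "\<phi> ?b \<noteq> 0"
  proof (rule diverges_weakly_if_dominates[OF M limits(1) W, of "norm (\<phi> ?b)"])
    fix n and \<omega> :: "(nat \<Rightarrow> 'x) \<times> 'z"
    let ?x = "\<phi> (\<iota> (empirical H n (fst \<omega>)), \<theta>hat n (fst \<omega>))"
    have "norm (\<phi> ?b) \<le> norm ?x + norm (?x - \<phi> ?b)" using norm_triangle_sub[of "\<phi> ?b" ?x] by (simp add: norm_minus_commute)
    then have "sqrt (real n) * norm (\<phi> ?b) \<le> sqrt (real n) * (norm ?x + norm (?x - \<phi> ?b))"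
      by (intro mult_left_mono) auto
    then show "sqrt (real n) * norm (\<phi> ?b) \<le> ?T n \<omega> + W n \<omega>"
      by (simp add: test_stat_def W_def distrib_left)
  qed (use that in simp)
  define \<rho> where "\<rho> n \<omega> = (\<iota> (R n (fst \<omega>)), \<theta>hat n (fst \<omega>))" for n and \<omega> :: "(nat \<Rightarrow> 'x) \<times> 'z"
  have approx: "increments_approximated ?M \<rho> \<phi> ?S \<phi>RH"
    using B3_or_relaxed
  proof
    assume *: "\<theta> RH = \<theta> (\<iota> H) \<and>
        asymptotically_tight_in ?S ?M (\<lambda>n \<omega>. sqrt (real n) *\<^sub>R (\<iota> (R n (fst \<omega>)) - RH, \<theta>hat n (fst \<omega>) - \<theta> (\<iota> H)))"
    show ?thesis
      by (rule increments_approximated_tight[OF M diff_RH S]) (use * in \<open>simp add: \<rho>_def\<close>)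
  next
    assume *: "uniformly_hadamard_derivative \<phi> UNIV ?b' ?S \<phi>RH \<and>
        tendsto_zero_outer_prob ?M (\<lambda>n \<omega>. ereal (dist (\<iota> (R n (fst \<omega>)), \<theta>hat n (fst \<omega>)) ?b'))"
    show ?thesis
      by (rule increments_approximated_uniformly[OF M _ hadamard_derivative_on_subspace(1)[OF diff_RH S]])
        (use * in \<open>auto simp: \<rho>_def\<close>)
  qed
  have "cond_weakly_converges ?M ?F (\<lambda>n \<omega>. sqrt (real n) * norm (\<phi> (\<rho> n \<omega> + inverse (sqrt (real n)) *\<^sub>R sqrt (real n) *\<^sub>R
         (\<iota> (empirical H n (boot_sample Xs n \<omega>)) - \<iota> (R n (fst \<omega>)),
          \<theta>s n (boot_sample Xs n \<omega>) (fst \<omega>) - \<theta>hat n (fst \<omega>))) - \<phi> (\<rho> n \<omega>))) N2 ?W2"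
    by (rule cond_delta_method_norm[OF M subalgebra_sample_algebra limits(4) approx
          hadamard_derivative_on_subspace(1)[OF diff_RH S] D0(2) limits(5) _ B2]) (use limits(6) in auto)
  then have Ts: "cond_weakly_converges ?M ?F ?Ts N2 ?W2"
    unfolding \<rho>_def diff_Pair[symmetric] unscale boot_stat_def[abs_def] .
  show ?thesis
  proof (intro conjI impI allI)
    fix \<alpha> \<xi>
    assume A: "0 < \<alpha> \<and> \<alpha> < 1 \<and>
          (\<forall>t. is_quantile (distr N1 borel ?W1) (1 - \<alpha>) t \<longrightarrow> measure N1 {w \<in> space N1. ?W1 w = t} = 0) \<and>
          cond_quantile H Q ?Ts (1 - \<alpha>) \<xi>"
    show "(\<lambda>n. inner_measure_of (?M n) {\<omega> \<in> space (?M n). ?T n \<omega> > \<xi> n (fst \<omega>)}) \<longlonglongrightarrow> 1" if "\<phi> ?b \<noteq> 0"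
      by (rule bootstrap_test_power[OF HQ limits(4) Tdiv[OF that] Ts]) (use A in auto)
    assume B: "\<phi> ?b = 0 \<and> distr N2 borel ?W2 = distr N1 borel ?W1"
    note level = bootstrap_test_level[OF HQ limits(1,4) T[OF conjunct1[OF B]] Ts conjunct2[OF B]]
    show "(\<lambda>n. outer_measure_of (?M n) {\<omega> \<in> space (?M n). ?T n \<omega> \<ge> \<xi> n (fst \<omega>)}) \<longlonglongrightarrow> ennreal \<alpha>"
      by (rule level(1)) (use A in auto)
    show "(\<lambda>n. inner_measure_of (?M n) {\<omega> \<in> space (?M n). ?T n \<omega> \<ge> \<xi> n (fst \<omega>)}) \<longlonglongrightarrow> ennreal \<alpha>"
      by (rule level(2)) (use A in auto)
  qed (use T Tdiv Ts in auto)
qed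

end
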